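(* Let $F=(x_1^2+x_2^2)(y_1^2+\cdots+y_n^2)\in\mathbb{C}[x_1,x_2,y_1,\ldots,y_n]$ with $n\ge 2$. Then $\operatorname{Rk}F=4n$. If $\mathbb{X}\subset\mathbb{P}^{n+1}$ is a set of $4n$ distinct points apolar to $F$, then the following facts hold: (i) The forbidden locus of $F$ is $\mathcal{F}_F=V(X_1^2+X_2^2)\cup V(Y_1^2+\cdots+Y_n^2)$. (ii) If $\mathbb{Y}$ is the projection of $\mathbb{X}$ from $V(Y_1,\ldots,Y_n)$ on $V(X_1,X_2)$, then $\mathbb{Y}$ is a set of $n$ distinct points in linear general position, that is, $\operatorname{HF}(\mathbb{Y},0)=1$, $\operatorname{HF}(\mathbb{Y},1)=n$, $\operatorname{HF}(\mathbb{Y},2)=n$, and $\operatorname{HF}(\mathbb{Y},i)=n$ for $i\ge 3$. (iii) Let $\mathbb{Y}=\{Q_1,\ldots,Q_n\}$ and let $\ell=V(Y_1,\ldots,Y_n)$. If $\Lambda_i=\langle\ell,Q_i\rangle$, where $\langle\ell,Q_i\rangle$ denotes the linear span of $\ell$ and $Q_i$, then $\mathbb{X}\cap\Lambda_i$ is a set of four distinct points for $1\le i\le n$ contained in two lines passing through $Q_i$. (iv) If $\mathbb{X}$ is a minimal apolar set to $F$, then there exists $\sigma\in O(n)$, the orthogonal group on the variables $Y_1,\ldots,Y_n$, such that $$I(\sigma(\mathbb{X}))=(\{Y_iY_j\}_{1\le i<j\le n},\ \mathcal{Q}_1,\ \mathcal{Q}_2),$$ where $\mathcal{Q}_1=X_1^2+\sum_{i=2}^n\alpha_i(Y_1^2-Y_i^2)$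 and $\mathcal{Q}_2=X_2^2+\sum_{i=2}^n\beta_i(Y_1^2-Y_i^2)$ for some $\alpha_i,\beta_i\in\mathbb{C}\setminus\{0\}$, $2\le i\le n$, such that $\sum_{i=2}^n\alpha_i\ne 0$ and $\sum_{i=2}^n\beta_i\ne 0$. (v) If $\mathbb{W}$ is the projection of $\mathbb{X}$ from $V(X_1,X_2)$ on $V(Y_1,\ldots,Y_n)$, then $\mathbb{W}$ is a set of $2k$ points with $k\le n$.
   Context: Let $S=\mathbb{C}[x_1,x_2,y_1,\ldots,y_n]$ and $T=\mathbb{C}[X_1,X_2,Y_1,\ldots,Y_n]$, both standard graded. $T$ acts on $S$ by differentiation (apolarity): $X_i$ acts as $\partial/\partial x_i$ and $Y_j$ as $\partial/\partial y_j$; the action is written $g\circ F$. For a form $F\in S$, $F^\perp=\{g\in T:g\circ F=0\}$. A point $[a_1:a_2:b_1:\cdots:b_n]\in\mathbb{P}^{n+1}$ corresponds to the linear form $a_1x_1+a_2x_2+b_1y_1+\cdots+b_ny_n$, and $T$ is the homogeneous coordinate ring of $\mathbb{P}^{n+1}$. For homogeneous elements of $T$, $V(\cdot)\subset\mathbb{P}^{n+1}$ denotes their common zero locus. For a finite set of points $\mathbb{X}$, $I(\mathbb{X})\subset T$ is its homogeneous (radical) ideal and $\operatorname{HF}(\mathbb{X},i)=\dim_{\mathbb{C}}(T/I(\mathbb{X}))_i$. $\mathbb{X}$ is apolar to $F$ if $I(\mathbb{X})\subset F^\perp$. The Waring rank $\operatorname{Rk}F$ of a form $F$ of degree $d$ is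 the least $r$ such that $F=\sum_{i=1}^r\alpha_iL_i^d$ with $\alpha_i\in\mathbb{C}$ and $L_i$ linear forms; equivalently, the least cardinality of a finite set of points apolar to $F$. A minimal apolar set is an apolar set of points of cardinality $\operatorname{Rk}F$. The Waring locus $\mathcal{W}_F$ is the set of points belonging to some minimal apolar set of $F$; the forbidden locus is $\mathcal{F}_F=\mathbb{P}^{n+1}\setminus\mathcal{W}_F$. The projection from $V(Y_1,\ldots,Y_n)$ on $V(X_1,X_2)$ is $[a_1:a_2:b_1:\cdots:b_n]\mapsto[0:0:b_1:\cdots:b_n]$; the projection from $V(X_1,X_2)$ on $V(Y_1,\ldots,Y_n)$ is $[a_1:a_2:b_1:\cdots:b_n]\mapsto[a_1:a_2:0:\cdots:0]$. $O(n)$ is the group of complex orthogonal $n\times n$ matrices, acting linearly on the coordinates $(b_1,\ldots,b_n)$ of points and trivially on $a_1,a_2$. A set of points is in linear general position if each of its subsets has the maximal possible linear span.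
   Formalization: In (iv), X_1^2 and X_2^2 are replaced by (X_1 - iX_2)^2 and (X_1 + iX_2)^2: as printed, Q_1 applied to F gives 2(y_1^2+...+y_n^2), which is not 0, so Q_1 cannot lie in the ideal of a set apolar to F. *)

theory Defs
  imports "HOL-Analysis.Analysis" "HOL-Library.Poly_Mapping"
begin

section \<open>Polynomials with complex coefficients\<close>

text \<open>
  A monomial is an exponent function \<^typ>\<open>'v \<Rightarrow>\<^sub>0 nat\<close>; multiplication on
  \<^typ>\<open>('v \<Rightarrow>\<^sub>0 nat) \<Rightarrow>\<^sub>0 complex\<close> is the convolution product of
  \<^theory>\<open>HOL-Library.Poly_Mapping\<close>. The ring of differential operators and the ring it acts on
  are two copies of the same polynomial ring, represented by the same type.
\<close>

type_synonym 'v mpoly = "('v \<Rightarrow>\<^sub>0 nat) \<Rightarrow>\<^sub>0 complex"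

definition Var :: "'v \<Rightarrow> 'v mpoly" where
  "Var v = Poly_Mapping.single (Poly_Mapping.single v 1) 1"

definition Const :: "complex \<Rightarrow> 'v mpoly" where
  "Const c = Poly_Mapping.single 0 c"

definition mdeg :: "('v::finite \<Rightarrow>\<^sub>0 nat) \<Rightarrow> nat" where
  "mdeg m = (\<Sum>v\<in>UNIV. Poly_Mapping.lookup m v)"

definition homogeneous :: "nat \<Rightarrow> 'v::finite mpoly \<Rightarrow> bool" where
  "homogeneous d p \<longleftrightarrow> (\<forall>m\<in>Poly_Mapping.keys p. mdeg m = d)"

definition total_degree :: "'v::finite mpoly \<Rightarrow> nat" where
  "total_degree p = Max (insert 0 (mdeg ` Poly_Mapping.keys p))"

definition eval_at :: "'v::finite mpoly \<Rightarrow> complex ^ 'v \<Rightarrow> complex" where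
  "eval_at p a = (\<Sum>m\<in>Poly_Mapping.keys p. Poly_Mapping.lookup p m *
     (\<Prod>v\<in>UNIV. (a $ v) ^ Poly_Mapping.lookup m v))"

definition ideal_gen :: "'v mpoly set \<Rightarrow> 'v mpoly set" where
  "ideal_gen B = module.span (*) B"

lemma module_mpoly: "module ((*) :: 'v mpoly \<Rightarrow> 'v mpoly \<Rightarrow> 'v mpoly)"
  by unfold_locales (simp_all add: algebra_simps)

abbreviation cdim :: "'v mpoly set \<Rightarrow> nat" where
  "cdim \<equiv> vector_space.dim (\<lambda>c p. Const c * p)"

lemma vector_space_mpoly: "vector_space (\<lambda>c (p :: 'v mpoly). Const c * p)"
  by unfold_locales
    (simp_all add: Const_def algebra_simps single_add mult_single flip: mult.assoc)


section \<open>Apolarity\<close>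

text \<open>The coefficient produced when the monomial \<open>k\<close> is differentiated \<open>m v\<close> times with
  respect to each variable \<open>v\<close>; it is \<open>0\<close> unless \<open>m \<le> k\<close> pointwise.\<close>

definition diff_coeff :: "('v::finite \<Rightarrow>\<^sub>0 nat) \<Rightarrow> ('v \<Rightarrow>\<^sub>0 nat) \<Rightarrow> complex" where
  "diff_coeff m k = (\<Prod>v\<in>UNIV. \<Prod>j<Poly_Mapping.lookup m v.
     of_nat (Poly_Mapping.lookup k v) - of_nat j)"

definition apolar_act :: "'v::finite mpoly \<Rightarrow> 'v mpoly \<Rightarrow> 'v mpoly" where
  "apolar_act g F = (\<Sum>m\<in>Poly_Mapping.keys g. \<Sum>k\<in>Poly_Mapping.keys F.
     Poly_Mapping.single (k - m)
       (Poly_Mapping.lookup g m * Poly_Mapping.lookup F k * diff_coeff m k))"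

definition perp :: "'v::finite mpoly \<Rightarrow> 'v mpoly set" where
  "perp F = {g. apolar_act g F = 0}"

text \<open>The action is the ring action in which each variable acts as the corresponding partial
  derivative.\<close>

definition partial_deriv :: "'v \<Rightarrow> 'v mpoly \<Rightarrow> 'v mpoly" where
  "partial_deriv v F = (\<Sum>k\<in>Poly_Mapping.keys F.
     Poly_Mapping.single (k - Poly_Mapping.single v 1) (of_nat (Poly_Mapping.lookup k v) * Poly_Mapping.lookup F k))"

lemma apolar_act_superset:
  assumes "finite A" "Poly_Mapping.keys g \<subseteq> A" "finite B" "Poly_Mapping.keys F \<subseteq> B"
  shows "apolar_act g F = (\<Sum>m\<in>A. \<Sum>k\<in>B.
     Poly_Mapping.single (k - m)
       (Poly_Mapping.lookup g m * Poly_Mapping.lookup F k * diff_coeff m k))"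
proof -
  have "apolar_act g F = (\<Sum>m\<in>Poly_Mapping.keys g. \<Sum>k\<in>B.
     Poly_Mapping.single (k - m)
       (Poly_Mapping.lookup g m * Poly_Mapping.lookup F k * diff_coeff m k))"
    unfolding apolar_act_def
    by (intro sum.cong refl sum.mono_neutral_left) (use assms in \<open>auto simp: in_keys_iff\<close>)
  also have "\<dots> = (\<Sum>m\<in>A. \<Sum>k\<in>B.
     Poly_Mapping.single (k - m)
       (Poly_Mapping.lookup g m * Poly_Mapping.lookup F k * diff_coeff m k))"
    by (intro sum.mono_neutral_left) (use assms in \<open>auto simp: in_keys_iff\<close>)
  finally show ?thesis .
qed

lemma apolar_act_add_left: "apolar_act (g + h) F = apolar_act g F + apolar_act h F"
proof -
  have *: "Poly_Mapping.keys (g + h) \<subseteq> Poly_Mapping.keys g \<union> Poly_Mapping.keys h" by (rule Poly_Mapping.keys_add)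
  show ?thesis
    by (subst (1 2 3) apolar_act_superset[where A = "Poly_Mapping.keys g \<union> Poly_Mapping.keys h" and B = "Poly_Mapping.keys F"])
      (use * in \<open>auto simp: lookup_add algebra_simps single_add sum.distrib\<close>)
qed

lemma apolar_act_add_right: "apolar_act g (F + G) = apolar_act g F + apolar_act g G"
proof -
  have *: "Poly_Mapping.keys (F + G) \<subseteq> Poly_Mapping.keys F \<union> Poly_Mapping.keys G" by (rule Poly_Mapping.keys_add)
  show ?thesis
    by (subst (1 2 3) apolar_act_superset[where A = "Poly_Mapping.keys g" and B = "Poly_Mapping.keys F \<union> Poly_Mapping.keys G"])
      (use * in \<open>auto simp: lookup_add algebra_simps single_add sum.distrib\<close>)
qed

lemma apolar_act_zero_left [simp]: "apolar_act 0 F = 0"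
  by (simp add: apolar_act_def)

lemma apolar_act_zero_right [simp]: "apolar_act g 0 = 0"
  by (simp add: apolar_act_def)

lemma apolar_act_single:
  "apolar_act (Poly_Mapping.single m a) (Poly_Mapping.single k b) =
     Poly_Mapping.single (k - m) (a * b * diff_coeff m k)"
  by (subst apolar_act_superset[where A = "{m}" and B = "{k}"]) (auto simp: lookup_single)

lemma mpoly_induct [case_names zero add]:
  fixes p :: "'v mpoly"
  assumes "P 0" and "\<And>p m c. P p \<Longrightarrow> P (p + Poly_Mapping.single m c)"
  shows "P p"
proof (induction p rule: update_induct)
  case const
  then show ?case by (rule assms)
next
  case (update f a b)
  have "Poly_Mapping.update a b f = f + Poly_Mapping.single a b"
    using update(1) by (intro poly_mapping_eqI)
      (auto simp: lookup_update lookup_add lookup_single in_keys_iff)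
  with assms(2)[OF update(3)] show ?case by simp
qed

lemma diff_coeff_add: "diff_coeff (l + m) k = diff_coeff m k * diff_coeff l (k - m)"
proof -
  have eq: "(\<Prod>j<b + a. of_nat k - of_nat j :: complex) =
      (\<Prod>j<a. of_nat k - of_nat j) * (\<Prod>j<b. of_nat (k - a) - of_nat j)" for a b k :: nat
  proof (cases "a \<le> k")
    case True
    have "(\<Prod>j<a + b. of_nat k - of_nat j :: complex) =
        (\<Prod>j<a. of_nat k - of_nat j) * (\<Prod>j<b. of_nat k - of_nat (a + j))"
      by (induction b) (simp_all add: algebra_simps)
    then show ?thesis using True
      by (simp add: of_nat_diff algebra_simps)
  next
    case False
    then have "(\<Prod>j<a. of_nat k - of_nat j :: complex) = 0"
      and "(\<Prod>j<b + a. of_nat k - of_nat j :: complex) = 0"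
      by (auto intro!: bexI[of _ k])
    then show ?thesis by (simp only: mult_zero_left)
  qed
  show ?thesis
    unfolding diff_coeff_def lookup_add lookup_minus eq prod.distrib ..
qed

lemma apolar_act_mult: "apolar_act (g * h) F = apolar_act g (apolar_act h F)"
proof (induction F rule: mpoly_induct)
  case zero
  show ?case by simp
next
  case (add F k c)
  have "apolar_act (g * h) (Poly_Mapping.single k c) =
      apolar_act g (apolar_act h (Poly_Mapping.single k c))"
  proof (induction g rule: mpoly_induct)
    case (add g l a)
    have "apolar_act (Poly_Mapping.single l a * h) (Poly_Mapping.single k c) =
      apolar_act (Poly_Mapping.single l a) (apolar_act h (Poly_Mapping.single k c))"
    proof (induction h rule: mpoly_induct)
      case (add h m b)
      then show ?case
        by (simp add: distrib_left apolar_act_add_left apolar_act_add_right mult_single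
            apolar_act_single diff_coeff_add diff_diff_add add.commute mult_ac)
    qed simp
    with add show ?case
      by (simp add: distrib_right apolar_act_add_left)
  qed simp
  with add show ?case
    by (simp add: apolar_act_add_right)
qed

lemma apolar_act_Const: "apolar_act (Const c) F = Const c * F"
proof (induction F rule: mpoly_induct)
  case (add F k b)
  then show ?case
    by (simp add: apolar_act_add_right distrib_left)
      (simp add: Const_def apolar_act_single mult_single diff_coeff_def)
qed simp

lemma apolar_act_Var: "apolar_act (Var v) F = partial_deriv v F"
proof -
  have "diff_coeff (Poly_Mapping.single v 1) k = of_nat (Poly_Mapping.lookup k v)" for k
  proof -
    have "diff_coeff (Poly_Mapping.single v 1) k =
        (\<Prod>w\<in>UNIV. if w = v then of_nat (Poly_Mapping.lookup k w) else 1)"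
      unfolding diff_coeff_def by (intro prod.cong refl) (auto simp: lookup_single)
    then show ?thesis by simp
  qed
  then show ?thesis
    by (simp add: apolar_act_def partial_deriv_def Var_def mult_ac)
qed


section \<open>Projective space over the complex numbers\<close>

text \<open>A projective point is a one-dimensional linear subspace of \<^typ>\<open>complex ^ 'v\<close>. The point
  spanned by \<open>a\<close> corresponds to the linear form with coefficient vector \<open>a\<close>.\<close>

type_synonym 'v ppoint = "(complex ^ 'v) set"

definition proj_space :: "'v::finite ppoint set" where
  "proj_space = {p. vec.subspace p \<and> vec.dim p = 1}"

text \<open>For homogeneous polynomials, vanishing on the whole subspace is the same as vanishing at one
  representative.\<close>

definition vanishes_at :: "'v::finite mpoly \<Rightarrow> 'v ppoint \<Rightarrow> bool" where
  "vanishes_at g p \<longleftrightarrow> (\<forall>a\<in>p. eval_at g a = 0)"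

definition zero_locus :: "'v::finite mpoly set \<Rightarrow> 'v ppoint set" where
  "zero_locus G = {p \<in> proj_space. \<forall>g\<in>G. vanishes_at g p}"

definition vanishing_ideal :: "'v::finite ppoint set \<Rightarrow> 'v mpoly set" where
  "vanishing_ideal X = ideal_gen {g. (\<exists>d. homogeneous d g) \<and> (\<forall>p\<in>X. vanishes_at g p)}"

definition hilbert_fun :: "'v::finite ppoint set \<Rightarrow> nat \<Rightarrow> nat" where
  "hilbert_fun X i = cdim {p :: 'v mpoly. homogeneous i p} -
                     cdim {p \<in> vanishing_ideal X. homogeneous i p}"

definition proj_span :: "'v::finite ppoint set \<Rightarrow> 'v ppoint set" where
  "proj_span A = {p \<in> proj_space. p \<subseteq> vec.span (\<Union>A)}"

definition proj_line :: "'v::finite ppoint set \<Rightarrow> bool" where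
  "proj_line l \<longleftrightarrow> (\<exists>U. vec.subspace U \<and> vec.dim U = 2 \<and> l = {p \<in> proj_space. p \<subseteq> U})"

definition linear_general_position :: "'v::finite ppoint set \<Rightarrow> bool" where
  "linear_general_position A \<longleftrightarrow> (\<forall>B\<subseteq>A. vec.dim (\<Union>B) = min (card B) CARD('v))"


section \<open>Waring rank, Waring locus and forbidden locus\<close>

definition waring_rank :: "'v::finite mpoly \<Rightarrow> nat" where
  "waring_rank F = (LEAST r. \<exists>\<alpha> L. (\<forall>i<r. homogeneous 1 (L i)) \<and>
     F = (\<Sum>i<r. Const (\<alpha> i) * L i ^ total_degree F))"

definition apolar_set :: "'v::finite mpoly \<Rightarrow> 'v ppoint set \<Rightarrow> bool" where
  "apolar_set F X \<longleftrightarrow> finite X \<and> X \<subseteq> proj_space \<and> vanishing_ideal X \<subseteq> perp F"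

definition minimal_apolar_set :: "'v::finite mpoly \<Rightarrow> 'v ppoint set \<Rightarrow> bool" where
  "minimal_apolar_set F X \<longleftrightarrow> apolar_set F X \<and> card X = waring_rank F"

definition waring_locus :: "'v::finite mpoly \<Rightarrow> 'v ppoint set" where
  "waring_locus F = \<Union>{X. minimal_apolar_set F X}"

definition forbidden_locus :: "'v::finite mpoly \<Rightarrow> 'v ppoint set" where
  "forbidden_locus F = proj_space - waring_locus F"


section \<open>Two groups of variables\<close>

datatype 'n var = VX1 | VX2 | VY 'n

instance var :: (finite) finite
proof
  have "(UNIV :: 'a var set) = {VX1, VX2} \<union> range VY"
    by (auto intro: var.exhaust)
  then show "finite (UNIV :: 'a var set)"
    by (metis finite.emptyI finite.insertI finite_UnI finite finite_imageI)
qed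

abbreviation X1 :: "'n var mpoly" where "X1 \<equiv> Var VX1"
abbreviation X2 :: "'n var mpoly" where "X2 \<equiv> Var VX2"
abbreviation Y :: "'n \<Rightarrow> 'n var mpoly" where "Y i \<equiv> Var (VY i)"

text \<open>Up to the factor 2 these are the dual variables to \<open>u = x1 + i x2\<close> and
  \<open>v = x1 - i x2\<close>, the coordinates in which \<open>x1^2 + x2^2\<close> becomes the product \<open>u v\<close>. Their
  squares annihilate \<open>x1^2 + x2^2\<close>, while \<open>X1^2\<close> and \<open>X2^2\<close> do not.\<close>

definition Z1 :: "'n var mpoly" where "Z1 = X1 - Const \<i> * X2"
definition Z2 :: "'n var mpoly" where "Z2 = X1 + Const \<i> * X2"

text \<open>The linear maps inducing the two projections. A point lying in the centre of a projection
  is mapped to the zero subspace, which is not an element of \<^const>\<open>proj_space\<close>.\<close>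

definition drop_x :: "complex ^ ('n::finite var) \<Rightarrow> complex ^ 'n var" where
  "drop_x a = (\<chi> v. case v of VX1 \<Rightarrow> 0 | VX2 \<Rightarrow> 0 | VY i \<Rightarrow> a $ VY i)"

definition drop_y :: "complex ^ ('n::finite var) \<Rightarrow> complex ^ 'n var" where
  "drop_y a = (\<chi> v. case v of VX1 \<Rightarrow> a $ VX1 | VX2 \<Rightarrow> a $ VX2 | VY i \<Rightarrow> 0)"

definition proj_to_y :: "'n::finite var ppoint \<Rightarrow> 'n var ppoint" where
  "proj_to_y p = drop_x ` p"

definition proj_to_x :: "'n::finite var ppoint \<Rightarrow> 'n var ppoint" where
  "proj_to_x p = drop_y ` p"

definition act_y :: "complex ^ 'n ^ 'n \<Rightarrow> complex ^ ('n::finite var) \<Rightarrow> complex ^ 'n var" where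
  "act_y \<sigma> a = (\<chi> v. case v of VX1 \<Rightarrow> a $ VX1 | VX2 \<Rightarrow> a $ VX2
     | VY i \<Rightarrow> (\<sigma> *v (\<chi> j. a $ VY j)) $ i)"

definition act_y_point :: "complex ^ 'n ^ 'n \<Rightarrow> 'n::finite var ppoint \<Rightarrow> 'n var ppoint" where
  "act_y_point \<sigma> p = act_y \<sigma> ` p"

text \<open>The index \<open>1\<close> of an index type \<open>1 < 2 < \<dots> < n\<close>.\<close>

definition fst_idx :: "'n::{finite,linorder}" where
  "fst_idx = Min UNIV"

end

theory Submission
  imports Defs
begin

text \<open>
  In the isotropic coordinates dual to \<open>Z1\<close> and \<open>Z2\<close> the form is, up to a factor, \<open>u v (y_1^2 + \<dots> + y_n^2)\<close>.
  It is annihilated by \<open>Z1^2\<close>, by \<open>Z2^2\<close> and by all products of three linear forms in the \<open>Y j\<close>, while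
  \<open>Z1 Z2 m m'\<close>, with linear forms \<open>m\<close>, \<open>m'\<close> in the \<open>Y j\<close>, acts as a multiple of the bilinear
  pairing \<open>bdot m m'\<close>. Everything follows from these pairings.

  Lower bound (\<open>apolar_vecs_card\<close>). Let \<open>t\<close> be a general linear form in the \<open>Y j\<close>. If a cubic
  \<open>t^2 a + t Z1 b + t Z2 c + Z1 Z2 d\<close>, with linear forms \<open>a, b, c, d\<close> in the \<open>Y j\<close>, vanishes at the points
  of an apolar set off the line \<open>Y = 0\<close>, then multiplying it by the \<open>Y j\<close> gives quartics in the ideal
  of the set, and the pairings yield \<open>d = 0\<close>. Dividing by \<open>t\<close> and multiplying by \<open>Z2 Y j\<close>, \<open>Z1 Y j\<close> and
  finally \<open>Z1 Z2 Y j\<close> yields \<open>b = c = 0\<close> and \<open>a = 0\<close>. So a space of cubics of dimension \<open>4 n\<close> embeds into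
  the functions on the points, and there are at least \<open>4 n\<close> of them.

  Structure of minimal sets (\<open>apolar_set_structure\<close>). If there are exactly \<open>4 n\<close> points, these cubics
  interpolate all functions, and the same multiplications show that on the points, normalised by
  \<open>t = 1\<close>, the products \<open>m m'\<close> and the squares \<open>Z1^2\<close>, \<open>Z2^2\<close> agree with linear forms in the \<open>Y j\<close>. The linear
  forms thus become an algebra of functions of dimension \<open>n\<close>, so there are \<open>n\<close> different \<open>y\<close>-parts, with a
  basis of dual linear forms. Apolarity translates products that vanish into orthogonality, so the
  \<open>y\<close>-parts are proportional to an orthonormal basis \<open>f i\<close>. Over each of them \<open>Z1^2\<close> and \<open>Z2^2\<close> are
  constant, leaving at most four points, hence by counting exactly four. The minimal apolar sets
  therefore consist of the points with coordinates \<open>(Z1, Z2, y) = (\<plusminus> a i, \<plusminus> b i, f i)\<close>, where the \<open>a i\<close>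
  and \<open>b i\<close> are nonzero and the sum of the \<open>(a i)^2\<close> as well as that of the \<open>(b i)^2\<close> vanishes.

  Conversely each such configuration is apolar, because summing the fourth powers of the linear forms
  with weights \<open>\<plusminus> 1 / (12 (a i) (b i))\<close> gives the quartic (\<open>quartic_decomposition\<close>); this proves the upper
  bound. The forbidden locus (\<open>forbidden_locus_quartic\<close>) is what no configuration reaches, as every
  vector of square 1 belongs to an orthonormal basis. The two projections and the Hilbert function
  are read off the coordinates. For the ideal (\<open>vanishing_ideal_config\<close>), the orthogonal matrix with
  rows \<open>f i\<close> moves the \<open>y\<close>-parts to the coordinate vectors; modulo the given quadrics every form has
  a normal form in the monomials \<open>Y i ^ k\<close> times \<open>1\<close>, \<open>Z1\<close>, \<open>Z2\<close> or \<open>Z1 Z2\<close>, and a normal form vanishing at the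
  \<open>4 n\<close> points is zero.
\<close>

section \<open>Evaluation, homogeneity and differentiation\<close>

definition monom_at :: "('v::finite \<Rightarrow>\<^sub>0 nat) \<Rightarrow> complex ^ 'v \<Rightarrow> complex" where
  "monom_at m a = (\<Prod>v\<in>UNIV. (a $ v) ^ Poly_Mapping.lookup m v)"

lemma monom_at_add: "monom_at (m + k) a = monom_at m a * monom_at k a"
  by (simp add: monom_at_def lookup_add power_add prod.distrib)

lemma monom_at_0 [simp]: "monom_at 0 a = 1"
  by (simp add: monom_at_def)

lemma monom_at_single: "monom_at (Poly_Mapping.single v k) a = (a $ v) ^ k"
proof -
  have "monom_at (Poly_Mapping.single v k) a = (\<Prod>w\<in>UNIV. if w = v then (a $ w) ^ k else 1)"
    unfolding monom_at_def by (intro prod.cong refl) (auto simp: lookup_single)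
  then show ?thesis by simp
qed

lemma eval_at_superset:
  assumes "finite A" "Poly_Mapping.keys p \<subseteq> A"
  shows "eval_at p a = (\<Sum>m\<in>A. Poly_Mapping.lookup p m * monom_at m a)"
  unfolding eval_at_def monom_at_def[symmetric]
  by (intro sum.mono_neutral_left) (use assms in \<open>auto simp: in_keys_iff\<close>)

lemma eval_at_single: "eval_at (Poly_Mapping.single m c) a = c * monom_at m a"
  by (subst eval_at_superset[where A = "{m}"]) auto

lemma eval_at_0 [simp]: "eval_at 0 a = 0"
  by (simp add: eval_at_def)

lemma eval_at_add: "eval_at (p + q) a = eval_at p a + eval_at q a"
  using Poly_Mapping.keys_add[of p q]
  by (subst (1 2 3) eval_at_superset[where A = "Poly_Mapping.keys p \<union> Poly_Mapping.keys q"])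
    (auto simp: lookup_add algebra_simps sum.distrib)

lemma eval_at_mult: "eval_at (p * q) a = eval_at p a * eval_at q a"
proof (induction p rule: mpoly_induct)
  case (add p m c)
  have "eval_at (Poly_Mapping.single m c * q) a = eval_at (Poly_Mapping.single m c) a * eval_at q a"
  proof (induction q rule: mpoly_induct)
    case (add q k d)
    then show ?case
      by (simp add: distrib_left eval_at_add eval_at_single mult_single monom_at_add algebra_simps)
  qed simp
  with add show ?case by (simp add: distrib_right eval_at_add)
qed simp

lemma eval_at_Const [simp]: "eval_at (Const c) a = c"
  by (simp add: Const_def eval_at_single)

lemma Const_0 [simp]: "Const 0 = 0"
  and Const_1 [simp]: "Const 1 = 1"
  by (simp_all add: Const_def)

lemma Const_add: "Const (a + b) = Const a + Const b"
  by (simp add: Const_def single_add)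

lemma Const_diff: "Const (a - b) = Const a - Const b"
  by (simp add: Const_def single_diff)

lemma Const_uminus: "Const (- a) = - Const a"
  by (simp add: Const_def single_uminus)

lemma Const_mult: "Const (a * b) = Const a * Const b"
  by (simp add: Const_def mult_single)

lemma Const_power: "Const (a ^ k) = Const a ^ k"
  by (induction k) (simp_all add: Const_mult)

lemma Const_sum: "Const (sum f A) = (\<Sum>i\<in>A. Const (f i))"
  by (induction A rule: infinite_finite_induct) (simp_all add: Const_add)

lemma Const_numeral: "Const (numeral w) = numeral w"
  by (simp add: Const_def)

lemma Const_eq_0_iff [simp]: "(Const c :: 'v mpoly) = 0 \<longleftrightarrow> c = 0"
proof
  assume "(Const c :: 'v mpoly) = 0"
  then have "Poly_Mapping.lookup (Const c :: 'v mpoly) 0 = 0" by simp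
  then show "c = 0" by (simp add: Const_def)
qed simp

lemma eval_at_Var [simp]: "eval_at (Var v) a = a $ v"
  by (simp add: Var_def eval_at_single monom_at_single)

lemma eval_at_1 [simp]: "eval_at 1 a = 1"
  using eval_at_Const[of 1 a] by (simp only: Const_1)

lemma eval_at_uminus: "eval_at (- p) a = - eval_at p a"
  using eval_at_add[of p "- p" a] by (simp add: add_eq_0_iff)

lemma eval_at_diff: "eval_at (p - q) a = eval_at p a - eval_at q a"
  using eval_at_add[of p "- q" a] by (simp add: eval_at_uminus)

lemma eval_at_power: "eval_at (p ^ k) a = eval_at p a ^ k"
  by (induction k) (simp_all add: eval_at_mult)

lemma eval_at_sum: "eval_at (sum f A) a = (\<Sum>i\<in>A. eval_at (f i) a)"
  by (induction A rule: infinite_finite_induct) (simp_all add: eval_at_add)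

lemmas eval_at_simps =
  eval_at_add eval_at_mult eval_at_diff eval_at_uminus eval_at_power eval_at_sum

lemma mdeg_add: "mdeg (m + k) = mdeg m + mdeg k"
  by (simp add: mdeg_def lookup_add sum.distrib)

lemma mdeg_single: "mdeg (Poly_Mapping.single v k) = k"
proof -
  have "mdeg (Poly_Mapping.single v k) = (\<Sum>w\<in>UNIV. if w = v then k else 0)"
    unfolding mdeg_def by (intro sum.cong refl) (auto simp: lookup_single)
  then show ?thesis by simp
qed

lemma mdeg_0 [simp]: "mdeg 0 = 0"
  by (simp add: mdeg_def)

lemma mdeg_eq_0_iff: "mdeg m = 0 \<longleftrightarrow> m = 0"
  by (auto simp: mdeg_def intro: poly_mapping_eqI)

lemma homogeneous_0 [simp]: "homogeneous d 0"
  by (simp add: homogeneous_def)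

lemma homogeneous_add: "homogeneous d p \<Longrightarrow> homogeneous d q \<Longrightarrow> homogeneous d (p + q)"
  using Poly_Mapping.keys_add[of p q] by (auto simp: homogeneous_def)

lemma homogeneous_uminus: "homogeneous d p \<Longrightarrow> homogeneous d (- p)"
  by (simp add: homogeneous_def in_keys_iff)

lemma homogeneous_diff: "homogeneous d p \<Longrightarrow> homogeneous d q \<Longrightarrow> homogeneous d (p - q)"
  using homogeneous_add[of d p "- q"] homogeneous_uminus[of d q] by simp

lemma homogeneous_mult: "homogeneous d p \<Longrightarrow> homogeneous e q \<Longrightarrow> homogeneous (d + e) (p * q)"
  using keys_mult[of p q] unfolding homogeneous_def by (force simp: mdeg_add)

lemma homogeneous_1 [simp]: "homogeneous 0 1"
  by (simp add: homogeneous_def)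

lemma homogeneous_Const [simp]: "homogeneous 0 (Const c)"
  by (simp add: homogeneous_def Const_def)

lemma homogeneous_Var [simp]: "homogeneous (Suc 0) (Var v)"
  by (simp add: homogeneous_def Var_def mdeg_single)

lemma homogeneous_Const_mult: "homogeneous d p \<Longrightarrow> homogeneous d (Const c * p)"
  using homogeneous_mult[of 0 "Const c" d p] by simp

lemma homogeneous_sum: "(\<And>i. i \<in> A \<Longrightarrow> homogeneous d (f i)) \<Longrightarrow> homogeneous d (sum f A)"
  by (induction A rule: infinite_finite_induct) (simp_all add: homogeneous_add)

lemma homogeneous_power: "homogeneous d p \<Longrightarrow> homogeneous (k * d) (p ^ k)"
  by (induction k) (simp_all add: homogeneous_mult)

text \<open>Because of this scaling, vanishing of a form on a projective point is a condition on a single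
  representative.\<close>

lemma eval_at_scale:
  assumes "homogeneous d p"
  shows "eval_at p (c *s a) = c ^ d * eval_at p a"
proof -
  have "monom_at m (c *s a) = c ^ mdeg m * monom_at m a" for m
    by (simp add: monom_at_def mdeg_def power_mult_distrib prod.distrib power_sum)
  with assms show ?thesis
    by (simp add: eval_at_superset[of "Poly_Mapping.keys p"] homogeneous_def sum_distrib_left
        algebra_simps)
qed

lemma mpoly_sum_keys:
  "p = (\<Sum>m\<in>Poly_Mapping.keys p. Poly_Mapping.single m (Poly_Mapping.lookup p m))"
  by (rule poly_mapping_eqI) (auto simp: lookup_sum lookup_single when_def in_keys_iff)

lemma mdeg_SucE:
  assumes "mdeg m = Suc d"
  obtains v k where "m = Poly_Mapping.single v 1 + k" "mdeg k = d"
proof -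
  from assms obtain v where v: "Poly_Mapping.lookup m v > 0"
    by (metis gr0I mdeg_eq_0_iff nat.simps(3) poly_mapping_eqI lookup_zero)
  let ?k = "m - Poly_Mapping.single v 1"
  have eq: "m = Poly_Mapping.single v 1 + ?k"
    using v by (intro poly_mapping_eqI) (auto simp: lookup_add lookup_minus lookup_single when_def)
  then have "mdeg m = Suc (mdeg ?k)"
    by (metis mdeg_add mdeg_single plus_1_eq_Suc)
  with assms eq show thesis by (intro that[of v ?k]) auto
qed

text \<open>A monomial of positive degree is a variable times a monomial of smaller degree, so forms can
  be built up from constants one variable at a time.\<close>

lemma homogeneous_induct [consumes 1, case_names zero add Const mult]:
  fixes P :: "nat \<Rightarrow> 'v::finite mpoly \<Rightarrow> bool"
  assumes "homogeneous d p"
    and zero: "\<And>d. P d 0"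
    and add: "\<And>d p q. P d p \<Longrightarrow> P d q \<Longrightarrow> P d (p + q)"
    and Const: "\<And>c. P 0 (Const c)"
    and mult: "\<And>d p v. P d p \<Longrightarrow> P (Suc d) (Var v * p)"
  shows "P d p"
proof -
  have mono: "P d (Poly_Mapping.single m c)" if "mdeg m = d" for m c d
    using that
  proof (induction d arbitrary: m)
    case 0
    then show ?case using Const[of c] by (simp add: mdeg_eq_0_iff Const_def)
  next
    case (Suc d)
    from Suc.prems obtain v k where "m = Poly_Mapping.single v 1 + k" "mdeg k = d"
      by (rule mdeg_SucE)
    then show ?case
      using mult[OF Suc.IH[of k], of v] by (simp add: Var_def mult_single)
  qed
  have "P d (\<Sum>m\<in>M. Poly_Mapping.single m (Poly_Mapping.lookup p m))"
    if "finite M" "M \<subseteq> Poly_Mapping.keys p" for M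
    using that
  proof (induction M)
    case (insert m M)
    then show ?case using mono[of m d] assms(1) by (auto simp: homogeneous_def intro!: add)
  qed (simp add: zero)
  from this[of "Poly_Mapping.keys p"] show ?thesis
    using mpoly_sum_keys[of p] by simp
qed

lemma partial_deriv_superset:
  assumes "finite A" "Poly_Mapping.keys p \<subseteq> A"
  shows "partial_deriv v p = (\<Sum>k\<in>A. Poly_Mapping.single (k - Poly_Mapping.single v 1)
    (of_nat (Poly_Mapping.lookup k v) * Poly_Mapping.lookup p k))"
  unfolding partial_deriv_def
  by (intro sum.mono_neutral_left) (use assms in \<open>auto simp: in_keys_iff\<close>)

lemma partial_deriv_single:
  "partial_deriv v (Poly_Mapping.single k c) =
     Poly_Mapping.single (k - Poly_Mapping.single v 1) (of_nat (Poly_Mapping.lookup k v) * c)"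
  by (subst partial_deriv_superset[where A = "{k}"]) auto

lemma partial_deriv_add:
  fixes p :: "'v::finite mpoly"
  shows "partial_deriv v (p + q) = partial_deriv v p + partial_deriv v q"
  by (simp add: apolar_act_Var[symmetric] apolar_act_add_right)

lemma partial_deriv_diff:
  fixes p :: "'v::finite mpoly"
  shows "partial_deriv v (p - q) = partial_deriv v p - partial_deriv v q"
  using partial_deriv_add[of v "p - q" q] by simp

lemma partial_deriv_0 [simp]: "partial_deriv v 0 = 0"
  by (simp add: partial_deriv_def)

lemma partial_deriv_sum:
  fixes f :: "'a \<Rightarrow> 'v::finite mpoly"
  shows "partial_deriv v (sum f A) = (\<Sum>i\<in>A. partial_deriv v (f i))"
  by (induction A rule: infinite_finite_induct) (simp_all add: partial_deriv_add)

lemma partial_deriv_Const [simp]: "partial_deriv v (Const c) = 0"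
  by (simp add: Const_def partial_deriv_single)

lemma partial_deriv_mult:
  fixes p :: "'v::finite mpoly"
  shows "partial_deriv v (p * q) = partial_deriv v p * q + p * partial_deriv v q"
proof (induction p rule: mpoly_induct)
  case (add p m c)
  have mono: "partial_deriv v (Poly_Mapping.single m c * Poly_Mapping.single k d) =
      partial_deriv v (Poly_Mapping.single m c) * Poly_Mapping.single k d +
      Poly_Mapping.single m c * partial_deriv v (Poly_Mapping.single k d)" for k d
  proof -
    let ?s = "Poly_Mapping.single v (Suc 0) :: 'v \<Rightarrow>\<^sub>0 nat"
    have 1: "m - ?s + k = m + k - ?s" if "Poly_Mapping.lookup m v > 0"
      using that by (intro poly_mapping_eqI) (auto simp: lookup_add lookup_minus lookup_single when_def)
    have 2: "m + (k - ?s) = m + k - ?s" if "Poly_Mapping.lookup k v > 0"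
      using that by (intro poly_mapping_eqI) (auto simp: lookup_add lookup_minus lookup_single when_def)
    show ?thesis
      by (cases "Poly_Mapping.lookup m v = 0"; cases "Poly_Mapping.lookup k v = 0")
        (simp_all add: mult_single partial_deriv_single lookup_add 1 2 flip: single_add,
         simp_all add: algebra_simps)
  qed
  have "partial_deriv v (Poly_Mapping.single m c * q) =
      partial_deriv v (Poly_Mapping.single m c) * q +
      Poly_Mapping.single m c * partial_deriv v q"
  proof (induction q rule: mpoly_induct)
    case (add q k d)
    then show ?case using mono[of k d] by (simp add: distrib_left partial_deriv_add algebra_simps)
  qed simp
  with add show ?case by (simp add: distrib_right partial_deriv_add algebra_simps)
qed simp

lemma partial_deriv_Var: "partial_deriv v (Var w) = (if v = w then 1 else 0)"
  by (auto simp: Var_def partial_deriv_single lookup_single single_one when_def)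

lemma partial_deriv_1 [simp]: "partial_deriv v 1 = 0"
  using partial_deriv_Const[of v 1] by (simp only: Const_1)

lemma partial_deriv_power:
  fixes p :: "'v::finite mpoly"
  shows "partial_deriv v (p ^ k) = of_nat k * p ^ (k - 1) * partial_deriv v p"
proof (induction k)
  case (Suc k)
  then show ?case by (cases k) (simp_all add: partial_deriv_mult algebra_simps)
qed simp

lemma apolar_act_diff_left: "apolar_act (g - h) F = apolar_act g F - apolar_act h F"
  using apolar_act_add_left[of "g - h" h F] by simp

lemma apolar_act_Const_mult_right: "apolar_act g (Const c * F) = Const c * apolar_act g F"
  by (metis apolar_act_Const apolar_act_mult mult.commute)

lemma apolar_act_sum_right: "apolar_act g (sum f A) = (\<Sum>i\<in>A. apolar_act g (f i))"
  by (induction A rule: infinite_finite_induct) (simp_all add: apolar_act_add_right)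

lemma apolar_act_sum_left: "apolar_act (sum f A) F = (\<Sum>i\<in>A. apolar_act (f i) F)"
  by (induction A rule: infinite_finite_induct) (simp_all add: apolar_act_add_left)


section \<open>Powers of linear forms\<close>

definition lin :: "complex ^ 'v::finite \<Rightarrow> 'v mpoly" where
  "lin a = (\<Sum>v\<in>UNIV. Const (a $ v) * Var v)"

lemma homogeneous_lin [simp]: "homogeneous 1 (lin a)"
  unfolding lin_def by (intro homogeneous_sum homogeneous_Const_mult) simp

lemma homogeneous_1_imp_lin:
  assumes "homogeneous 1 L"
  obtains a where "L = lin a"
proof -
  \<comment> \<open>the induction builds degree 1 from degree 0, so constants are carried along\<close>
  have "\<exists>a. (d = 0 \<longrightarrow> (\<exists>c. p = Const c)) \<and> (d = 1 \<longrightarrow> p = lin a)"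
    if "homogeneous d p" for d and p :: "'a mpoly"
    using that
  proof (induction rule: homogeneous_induct)
    case (zero d)
    have "lin 0 = (0 :: 'a mpoly)" by (simp add: lin_def)
    then show ?case by (intro exI[of _ 0]) (auto intro!: exI[of _ 0])
  next
    case (add d p q)
    then obtain a b where "(d = 0 \<longrightarrow> (\<exists>c. p = Const c)) \<and> (d = 1 \<longrightarrow> p = lin a)"
      "(d = 0 \<longrightarrow> (\<exists>c. q = Const c)) \<and> (d = 1 \<longrightarrow> q = lin b)" by blast
    moreover have "lin (a + b) = lin a + lin b"
      by (simp add: lin_def Const_add distrib_right sum.distrib)
    ultimately show ?case
      by (cases "d = 0"; cases "d = 1") (simp_all, (metis Const_add)+)
  next
    case (Const c)
    then show ?case by auto
  next
    case (mult d p v)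
    show ?case
    proof (cases "d = 0")
      case True
      with mult obtain c where c: "p = Const c" by auto
      have "Const ((axis v c :: complex ^ 'a) $ w) * Var w = (if w = v then Const c * Var v else 0)" for w
        by (simp add: axis_def)
      then have "lin (axis v c) = Const c * Var v"
        by (simp add: lin_def)
      then show ?thesis
        using c True by (intro exI[of _ "axis v c"]) (simp add: mult.commute)
    qed simp
  qed
  from this[OF assms] show thesis using that by auto
qed

lemma partial_deriv_lin: "partial_deriv v (lin a) = Const (a $ v)"
proof -
  have "partial_deriv v (Const (a $ w) * Var w) = (if w = v then Const (a $ w) else 0)" for w
    by (simp add: partial_deriv_mult partial_deriv_Var)
  then show ?thesis by (simp add: lin_def partial_deriv_sum)
qed

text \<open>Differentiating a power of a linear form evaluates the operator at the corresponding point;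
  the falling factorial vanishes as soon as the order of the operator exceeds the exponent.\<close>

lemma apolar_act_lin_power:
  assumes "homogeneous e g"
  shows "apolar_act g (lin a ^ d) =
    Const ((\<Prod>j<e. of_nat d - of_nat j) * eval_at g a) * lin a ^ (d - e)"
  using assms
proof (induction rule: homogeneous_induct)
  case (add e p q)
  then show ?case
    by (simp add: apolar_act_add_left eval_at_add Const_add algebra_simps)
next
  case (mult e p v)
  have Ce: "Const (of_nat k) = of_nat k" for k
    by (induction k) (simp_all add: Const_add)
  have "apolar_act (Var v * p) (lin a ^ d) =
      Const ((\<Prod>j<e. of_nat d - of_nat j) * eval_at p a) *
      (Const (of_nat (d - e)) * Const (a $ v) * lin a ^ (d - Suc e))"
    unfolding apolar_act_mult mult apolar_act_Var partial_deriv_mult partial_deriv_power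
      partial_deriv_lin Ce by (simp add: mult_ac)
  also have "\<dots> = Const ((\<Prod>j<e. of_nat d - of_nat j) * of_nat (d - e) * (a $ v) * eval_at p a)
      * lin a ^ (d - Suc e)"
    by (simp add: Const_mult algebra_simps)
  also have "(\<Prod>j<e. of_nat d - of_nat j) * of_nat (d - e) =
      (\<Prod>j<Suc e. of_nat d - of_nat j :: complex)"
    by (cases "e \<le> d") (auto simp: of_nat_diff intro!: bexI[of _ d])
  finally show ?case by (simp add: eval_at_mult algebra_simps)
qed (simp_all add: apolar_act_Const)


section \<open>Bilinear duality\<close>

text \<open>The complex bilinear (not Hermitian) form preserved by complex orthogonal matrices.\<close>

definition bdot :: "complex ^ 'm::finite \<Rightarrow> complex ^ 'm \<Rightarrow> complex" where
  "bdot m y = (\<Sum>j\<in>UNIV. m $ j * y $ j)"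

lemma bdot_add_left: "bdot (m + m') y = bdot m y + bdot m' y"
  and bdot_add_right: "bdot y (m + m') = bdot y m + bdot y m'"
  and bdot_diff_left: "bdot (m - m') y = bdot m y - bdot m' y"
  and bdot_diff_right: "bdot y (m - m') = bdot y m - bdot y m'"
  and bdot_scale_left: "bdot (c *s m) y = c * bdot m y"
  and bdot_scale_right: "bdot m (c *s y) = c * bdot m y"
  and bdot_0_left [simp]: "bdot 0 y = 0"
  and bdot_0_right [simp]: "bdot y 0 = 0"
  by (simp_all add: bdot_def algebra_simps sum.distrib sum_subtractf sum_distrib_left)

lemma bdot_commute: "bdot m y = bdot y m"
  by (simp add: bdot_def mult.commute)

lemma bdot_sum_left: "bdot (sum f A) y = (\<Sum>i\<in>A. bdot (f i) y)"
  by (induction A rule: infinite_finite_induct) (simp_all add: bdot_add_left)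

lemma bdot_axis_left: "bdot (axis j c) y = c * y $ j"
proof -
  have "axis j c $ i * y $ i = (if i = j then c * y $ i else 0)" for i
    by (simp add: axis_def)
  then show ?thesis by (simp add: bdot_def)
qed

lemma bdot_axis_right: "bdot y (axis j c) = c * y $ j"
  by (simp add: bdot_commute[of y] bdot_axis_left)

lemma bdot_nondegenerate: "(\<And>m. bdot d m = 0) \<Longrightarrow> d = 0"
  using bdot_axis_right[of d _ 1] by (simp add: vec_eq_iff)

text \<open>The vectors span the whole space, since a vector outside their span would give rise to a
  nonzero functional killing all of them. This bounds the size of the family from below; in
  the case of equality the family is a basis, on which a functional may be prescribed freely.\<close>

lemma separating_family:
  fixes \<phi> :: "'s \<Rightarrow> complex ^ 'm::finite"
  assumes fin: "finite S" and sep: "\<And>c. (\<And>s. s \<in> S \<Longrightarrow> bdot c (\<phi> s) = 0) \<Longrightarrow> c = 0"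
  shows "CARD('m) \<le> card S"
    and "card S = CARD('m) \<Longrightarrow> \<exists>c. \<forall>s\<in>S. bdot c (\<phi> s) = f s"
proof -
  have ext: "\<exists>c. \<forall>x\<in>B. bdot c x = h x" if B: "vec.independent B" for B and h :: "complex ^ 'm \<Rightarrow> complex"
  proof -
    obtain g where g: "Vector_Spaces.linear (*s) (*s) g"
      and gB: "\<forall>x\<in>B. g x = (\<chi> i. h x :: complex ^ unit)"
      using vec.linear_independent_extend[OF B, of "\<lambda>x. \<chi> i. h x"] by blast
    let ?c = "\<chi> j. g (axis j 1) $ () :: complex ^ 'm"
    have "bdot ?c x = g x $ ()" for x
    proof -
      have "g x = g (\<Sum>j\<in>UNIV. (x $ j) *s axis j 1)"
        by (simp add: basis_expansion)
      also have "\<dots> = (\<Sum>j\<in>UNIV. (x $ j) *s g (axis j 1))"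
        by (simp add: vec.linear_sum[OF g] vec.linear_scale[OF g])
      finally show ?thesis by (simp add: bdot_def mult.commute)
    qed
    with gB show ?thesis by (intro exI[of _ ?c]) simp
  qed
  have span: "vec.span (\<phi> ` S) = UNIV"
  proof (rule ccontr)
    assume ne: "vec.span (\<phi> ` S) \<noteq> UNIV"
    obtain B where B: "B \<subseteq> \<phi> ` S" "vec.independent B" "\<phi> ` S \<subseteq> vec.span B"
      using vec.maximal_independent_subset[of "\<phi> ` S"] by blast
    then have spB: "vec.span B = vec.span (\<phi> ` S)"
      by (metis vec.span_eq vec.span_superset subset_trans)
    with ne obtain x where x: "x \<notin> vec.span B" by blast
    then have "x \<notin> B" using vec.span_base by blast
    with x have "vec.independent (insert x B)"
      using B(2) by (simp add: vec.independent_insert)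
    from ext[OF this, of "\<lambda>y. if y = x then 1 else 0"]
    obtain c where c: "\<forall>y\<in>insert x B. bdot c y = (if y = x then 1 else 0)" by blast
    have "bdot c y = 0" if "y \<in> vec.span B" for y
      using that
    proof (induction rule: vec.span_induct_alt)
      case (step k b y)
      then show ?case using c \<open>x \<notin> B\<close> by (auto simp: bdot_add_right bdot_scale_right)
    qed simp
    then have "c = 0" using B(3) by (intro sep) auto
    with c show False by simp
  qed
  show le: "CARD('m) \<le> card S"
    using vec.dim_le_card[of UNIV "\<phi> ` S"] span fin card_image_le[OF fin, of \<phi>]
    by (simp add: card_cart_basis)
  assume eq: "card S = CARD('m)"
  have "CARD('m) \<le> card (\<phi> ` S)"
    using vec.dim_le_card[of UNIV "\<phi> ` S"] span fin by (simp add: card_cart_basis)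
  then have card: "card (\<phi> ` S) = card S"
    using eq card_image_le[OF fin, of \<phi>] by simp
  then have inj: "inj_on \<phi> S" using fin eq_card_imp_inj_on by blast
  have "vec.independent (\<phi> ` S)"
    using vec.card_eq_dim[of "\<phi> ` S" UNIV] card eq span fin by (simp add: card_cart_basis)
  from ext[OF this, of "\<lambda>x. f (the_inv_into S \<phi> x)"]
  show "\<exists>c. \<forall>s\<in>S. bdot c (\<phi> s) = f s"
    by (auto simp: the_inv_into_f_f[OF inj])
qed

text \<open>The functional \<open>bdot (c i)\<close> vanishes on the span of the other vectors but not at \<open>u i\<close>.\<close>

lemma biorthogonal_independent:
  fixes u :: "'i \<Rightarrow> complex ^ 'm::finite"
  assumes bi: "\<And>i j. i \<in> I \<Longrightarrow> j \<in> I \<Longrightarrow> bdot (c i) (u j) = (if i = j then 1 else 0)"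
  shows "inj_on u I" and "vec.independent (u ` I)"
proof -
  show inj: "inj_on u I"
    by (rule inj_onI) (metis bi zero_neq_one)
  show "vec.independent (u ` I)"
    unfolding vec.dependent_def
  proof safe
    fix i assume i: "i \<in> I" and span: "u i \<in> vec.span (u ` I - {u i})"
    have "bdot (c i) y = 0" if "y \<in> vec.span (u ` I - {u i})" for y
      using that
    proof (induction rule: vec.span_induct_alt)
      case (step k b y)
      then obtain j where "j \<in> I" "b = u j" "j \<noteq> i" by auto
      with step i show ?case by (simp add: bdot_add_right bdot_scale_right bi)
    qed simp
    from this[OF span] bi[OF i i] show False by simp
  qed
qed

text \<open>A vector space over an infinite field is not a finite union of hyperplanes. If the functional
  \<open>t\<close> found for a smaller set fails at a new vector, it is perturbed along a coordinate that is
  nonzero there; only finitely many sizes of the perturbation are excluded.\<close>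

lemma ex_nonvanishing_functional:
  fixes S :: "(complex ^ 'm::finite) set"
  assumes "finite S" "0 \<notin> S"
  obtains t where "\<And>y. y \<in> S \<Longrightarrow> bdot t y \<noteq> 0"
proof -
  from assms have "\<exists>t. \<forall>y\<in>S. bdot t y \<noteq> 0"
  proof (induction S)
    case (insert x S)
    then obtain t where t: "\<forall>y\<in>S. bdot t y \<noteq> 0" by auto
    from insert have "x \<noteq> 0" by auto
    then obtain k where k: "x $ k \<noteq> 0" by (auto simp: vec_eq_iff)
    have "finite ((\<lambda>y. - bdot t y / y $ k) ` insert x S)" using insert by simp
    then obtain e where e: "e \<notin> (\<lambda>y. - bdot t y / y $ k) ` insert x S" "e \<noteq> 0"
      using ex_new_if_finite[of "insert 0 ((\<lambda>y. - bdot t y / y $ k) ` insert x S)"] infinite_UNIV_char_0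
      by blast
    have "bdot (t + axis k e) y \<noteq> 0" if y: "y \<in> insert x S" for y
    proof
      assume "bdot (t + axis k e) y = 0"
      then have *: "bdot t y + e * y $ k = 0" by (simp add: bdot_add_left bdot_axis_left)
      show False
      proof (cases "y $ k = 0")
        case True
        with * t y k show False by auto
      next
        case False
        then have "e = - bdot t y / y $ k" using * by (simp add: field_simps eq_neg_iff_add_eq_0)
        with e(1) y show False by blast
      qed
    qed
    then show ?case by blast
  qed simp
  then show thesis using that by blast
qed


section \<open>Adapted coordinates\<close>

lemma UNIV_var: "(UNIV :: 'n var set) = insert VX1 (insert VX2 (range VY))"
  by (auto intro: var.exhaust)

lemma sum_var: "(\<Sum>v\<in>UNIV. f v) = f VX1 + f VX2 + (\<Sum>j\<in>UNIV. f (VY j))"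
  for f :: "'n::finite var \<Rightarrow> 'a::comm_monoid_add"
  unfolding UNIV_var by (subst sum.insert sum.reindex; auto simp: inj_def add.assoc)+

lemma card_var: "CARD('n::finite var) = CARD('n) + 2"
  unfolding UNIV_var by (subst card_insert_disjoint card_image; auto simp: inj_def)+

text \<open>Points are described by the values of \<open>Z1\<close>, \<open>Z2\<close> and the \<open>Y j\<close>, in which the quadric
  \<open>X1^2 + X2^2\<close> is the product \<open>Z1 Z2\<close>.\<close>

definition pt :: "complex \<Rightarrow> complex \<Rightarrow> complex ^ 'n \<Rightarrow> complex ^ 'n::finite var" where
  "pt z w y = (\<chi> v. case v of VX1 \<Rightarrow> (z + w) / 2 | VX2 \<Rightarrow> \<i> * (z - w) / 2 | VY i \<Rightarrow> y $ i)"

definition zc :: "complex ^ 'n::finite var \<Rightarrow> complex" where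
  "zc a = a $ VX1 - \<i> * a $ VX2"

definition wc :: "complex ^ 'n::finite var \<Rightarrow> complex" where
  "wc a = a $ VX1 + \<i> * a $ VX2"

definition yc :: "complex ^ 'n::finite var \<Rightarrow> complex ^ 'n" where
  "yc a = (\<chi> j. a $ VY j)"

lemma zc_pt [simp]: "zc (pt z w y) = z"
  and wc_pt [simp]: "wc (pt z w y) = w"
  and yc_pt [simp]: "yc (pt z w y) = y"
  by (simp_all add: zc_def wc_def yc_def pt_def field_simps vec_eq_iff)

lemma pt_coords [simp]: "pt (zc a) (wc a) (yc a) = a"
  by (simp add: zc_def wc_def yc_def pt_def vec_eq_iff field_simps split: var.split)

lemma pt_eq_iff [simp]: "pt z w y = pt z' w' y' \<longleftrightarrow> z = z' \<and> w = w' \<and> y = y'"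
  by (metis zc_pt wc_pt yc_pt)

lemma point_eqI: "zc a = zc b \<Longrightarrow> wc a = wc b \<Longrightarrow> yc a = yc b \<Longrightarrow> a = b"
  by (metis pt_coords)

lemma zc_scale [simp]: "zc (c *s a) = c * zc a"
  and wc_scale [simp]: "wc (c *s a) = c * wc a"
  and yc_scale [simp]: "yc (c *s a) = c *s yc a"
  and zc_add [simp]: "zc (a + b) = zc a + zc b"
  and wc_add [simp]: "wc (a + b) = wc a + wc b"
  and yc_add [simp]: "yc (a + b) = yc a + yc b"
  and zc_0 [simp]: "zc 0 = 0"
  and wc_0 [simp]: "wc 0 = 0"
  and yc_0 [simp]: "yc 0 = 0"
  by (simp_all add: zc_def wc_def yc_def vec_eq_iff algebra_simps)

lemma scale_pt: "c *s pt z w y = pt (c * z) (c * w) (c *s y)"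
  by (rule point_eqI) simp_all

lemma add_pt: "pt z w y + pt z' w' y' = pt (z + z') (w + w') (y + y')"
  by (rule point_eqI) simp_all

lemma pt_eq_0_iff: "pt z w y = 0 \<longleftrightarrow> z = 0 \<and> w = 0 \<and> y = 0"
  by (metis pt_coords zc_0 wc_0 yc_0 zc_pt wc_pt yc_pt)

definition ylin :: "complex ^ 'n \<Rightarrow> 'n::finite var mpoly" where
  "ylin m = (\<Sum>j\<in>UNIV. Const (m $ j) * Y j)"

lemma eval_at_Z1 [simp]: "eval_at Z1 a = zc a"
  and eval_at_Z2 [simp]: "eval_at Z2 a = wc a"
  and eval_at_ylin [simp]: "eval_at (ylin m) a = bdot m (yc a)"
  by (simp_all add: Z1_def Z2_def zc_def wc_def ylin_def bdot_def yc_def eval_at_simps)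

lemma homogeneous_Z1 [simp]: "homogeneous (Suc 0) Z1"
  and homogeneous_Z2 [simp]: "homogeneous (Suc 0) Z2"
  and homogeneous_ylin [simp]: "homogeneous (Suc 0) (ylin m)"
  unfolding Z1_def Z2_def ylin_def
  by (intro homogeneous_add homogeneous_diff homogeneous_sum homogeneous_Const_mult homogeneous_Var)+

lemma homogeneous_mult1: "homogeneous d p \<Longrightarrow> homogeneous (Suc 0) q \<Longrightarrow> homogeneous (Suc d) (p * q)"
  using homogeneous_mult[of d p "Suc 0" q] by simp

lemma Const_ii_square: "Const \<i> * Const \<i> = -1"
  by (simp add: Const_uminus flip: Const_mult)

lemma Z1_Z2: "Z1 * Z2 = X1 ^ 2 + X2 ^ 2"
proof -
  have "Z1 * Z2 = X1 ^ 2 - (Const \<i> * Const \<i>) * X2 ^ 2"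
    by (simp add: Z1_def Z2_def algebra_simps power2_eq_square)
  then show ?thesis by (simp add: Const_ii_square)
qed


section \<open>The action on the quartic\<close>

definition quartic :: "'n::finite var mpoly" where
  "quartic = Z1 * Z2 * (\<Sum>i\<in>UNIV. Y i ^ 2)"

lemma act_Z1: "apolar_act Z1 p = partial_deriv VX1 p - Const \<i> * partial_deriv VX2 p"
  and act_Z2: "apolar_act Z2 p = partial_deriv VX1 p + Const \<i> * partial_deriv VX2 p"
  and act_ylin: "apolar_act (ylin m) p = (\<Sum>j\<in>UNIV. Const (m $ j) * partial_deriv (VY j) p)"
  by (simp_all add: Z1_def Z2_def ylin_def apolar_act_add_left apolar_act_diff_left
      apolar_act_sum_left apolar_act_mult apolar_act_Const apolar_act_Var)

lemma act_Z1_mult: "apolar_act Z1 (p * q) = apolar_act Z1 p * q + p * apolar_act Z1 q"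
  and act_Z2_mult: "apolar_act Z2 (p * q) = apolar_act Z2 p * q + p * apolar_act Z2 q"
  by (simp_all add: act_Z1 act_Z2 partial_deriv_mult algebra_simps)

lemma act_ylin_mult:
  "apolar_act (ylin m) (p * q) = apolar_act (ylin m) p * q + p * apolar_act (ylin m) q"
  unfolding act_ylin sum_distrib_right sum_distrib_left sum.distrib[symmetric]
  by (intro sum.cong refl) (simp add: partial_deriv_mult algebra_simps)

lemma act_Var:
  fixes m :: "complex ^ 'a::finite"
  shows "apolar_act Z1 (Y j) = 0" "apolar_act Z2 (Y j) = 0" "apolar_act (ylin m) (Y j) = Const (m $ j)"
proof -
  have "Const (m $ i) * (if VY i = VY j then 1 else 0) = (if i = j then Const (m $ i) else (0 :: 'a var mpoly))" for i
    by simp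
  then show "apolar_act (ylin m) (Y j) = Const (m $ j)"
    by (simp add: ylin_def apolar_act_sum_left apolar_act_mult apolar_act_Const apolar_act_Var
        partial_deriv_Var)
qed (simp_all add: Z1_def Z2_def apolar_act_add_left apolar_act_diff_left apolar_act_mult
    apolar_act_Const apolar_act_Var partial_deriv_Var)

lemma act_Const:
  "apolar_act Z1 (Const c) = 0" "apolar_act Z2 (Const c) = 0" "apolar_act (ylin m) (Const c) = 0"
  by (simp_all add: act_Z1 act_Z2 act_ylin)

lemma partial_deriv_Z:
  fixes v :: "'n::finite var"
  shows "partial_deriv v Z1 = (if v = VX1 then 1 else if v = VX2 then - Const \<i> else 0)"
  "partial_deriv v Z2 = (if v = VX1 then 1 else if v = VX2 then Const \<i> else 0)"
  by (simp_all add: Z1_def Z2_def partial_deriv_add partial_deriv_diff partial_deriv_mult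
      partial_deriv_Var)

lemma act_Z:
  "apolar_act Z1 Z1 = 0" "apolar_act Z1 Z2 = Const 2" "apolar_act Z2 Z1 = Const 2"
  "apolar_act Z2 Z2 = 0" "apolar_act (ylin m) Z1 = 0" "apolar_act (ylin m) Z2 = 0"
  by (simp_all add: act_Z1 act_Z2 act_ylin partial_deriv_Z Const_ii_square Const_numeral)

lemma act_ysquares:
  "apolar_act Z1 (\<Sum>i\<in>UNIV. Y i ^ 2) = 0" "apolar_act Z2 (\<Sum>i\<in>UNIV. Y i ^ 2) = 0"
  "apolar_act (ylin m) (\<Sum>i\<in>UNIV. Y i ^ 2) = 2 * ylin m"
proof -
  have "2 * ylin m = (\<Sum>i\<in>UNIV. 2 * (Const (m $ i) * Y i))"
    by (simp add: ylin_def sum_distrib_left)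
  also have "\<dots> = (\<Sum>i\<in>UNIV. apolar_act (ylin m) (Y i ^ 2))"
    by (intro sum.cong refl) (simp add: power2_eq_square act_ylin_mult act_Var algebra_simps)
  finally show "apolar_act (ylin m) (\<Sum>i\<in>UNIV. Y i ^ 2) = 2 * ylin m"
    by (simp add: apolar_act_sum_right)
qed (simp_all add: apolar_act_sum_right power2_eq_square act_Z1_mult act_Z2_mult act_Var)

lemma act_ylin_ylin:
  "apolar_act Z1 (ylin m) = 0" "apolar_act Z2 (ylin m) = 0"
  "apolar_act (ylin m) (ylin m') = Const (bdot m m')"
proof -
  show "apolar_act Z1 (ylin m) = 0" "apolar_act Z2 (ylin m) = 0"
    by (simp_all add: ylin_def apolar_act_sum_right apolar_act_Const_mult_right act_Var)
  show "apolar_act (ylin m) (ylin m') = Const (bdot m m')"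
    by (subst (2) ylin_def) (simp add: apolar_act_sum_right apolar_act_Const_mult_right
      act_Var bdot_def Const_sum Const_mult, simp add: mult.commute)
qed

lemmas act_simps = apolar_act_add_left apolar_act_add_right apolar_act_mult
  act_Z1_mult act_Z2_mult act_ylin_mult act_Const act_Z act_ysquares act_ylin_ylin

lemma act_numeral:
  "apolar_act Z1 (numeral k) = 0" "apolar_act Z2 (numeral k) = 0" "apolar_act (ylin m) (numeral k) = 0"
  by (simp_all add: act_Const flip: Const_numeral)

text \<open>Among the products of four of the linear forms \<open>Z1\<close>, \<open>Z2\<close>, \<open>ylin m\<close> only those of shape
  \<open>Z1 * Z2 * ylin m * ylin m'\<close> act nontrivially on the quartic: its degree is one in each of the
  two isotropic coordinates dual to \<open>Z1\<close> and \<open>Z2\<close> and two in the \<open>y\<close>-variables.\<close>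

lemma act_quartic_Z1_Z1: "apolar_act (g * (Z1 * Z1)) quartic = 0"
  and act_quartic_Z2_Z2: "apolar_act (g * (Z2 * Z2)) quartic = 0"
  and act_quartic_yyy: "apolar_act (g * (ylin a * (ylin b * ylin c))) quartic = 0"
  and act_quartic_Z1_Z2_y_y:
    "apolar_act (Z1 * (Z2 * (ylin a * ylin b))) quartic = Const (8 * bdot a b)"
  by (simp_all add: quartic_def act_simps act_numeral Const_mult Const_numeral bdot_commute)

lemma quartic_eq: "quartic = (X1 ^ 2 + X2 ^ 2) * (\<Sum>i\<in>UNIV. Y i ^ 2)"
  by (simp add: quartic_def Z1_Z2)

lemma quartic_nonzero: "quartic \<noteq> (0 :: 'n::finite var mpoly)"
proof
  assume 0: "quartic = (0 :: 'n var mpoly)"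
  define j :: 'n where "j = undefined"
  have "Const (8 * bdot (axis j 1) (axis j 1 :: complex ^ 'n)) = (0 :: 'n var mpoly)"
    unfolding act_quartic_Z1_Z2_y_y[symmetric] 0 by simp
  then show False by (simp add: bdot_axis_left)
qed

lemma homogeneous_quartic: "homogeneous 4 quartic"
proof -
  have "homogeneous 2 (Z1 * Z2)"
    using homogeneous_mult[OF homogeneous_Z1 homogeneous_Z2] by (simp add: numeral_2_eq_2)
  moreover have "homogeneous 2 (\<Sum>i\<in>UNIV. Y i ^ 2)"
    using homogeneous_power[OF homogeneous_Var, of 2] by (intro homogeneous_sum) simp
  ultimately show ?thesis
    unfolding quartic_def using homogeneous_mult by fastforce
qed

lemma total_degree_quartic: "total_degree (quartic :: 'n::finite var mpoly) = 4"
proof -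
  have "Poly_Mapping.keys (quartic :: 'n var mpoly) \<noteq> {}"
    using quartic_nonzero mpoly_sum_keys[of "quartic :: 'n var mpoly"] by auto
  moreover have "homogeneous 4 (quartic :: 'n var mpoly)" by (rule homogeneous_quartic)
  then have "mdeg ` Poly_Mapping.keys (quartic :: 'n var mpoly) =
      (\<lambda>_. 4) ` Poly_Mapping.keys (quartic :: 'n var mpoly)"
    by (intro image_cong) (auto simp: homogeneous_def)
  ultimately have "mdeg ` Poly_Mapping.keys (quartic :: 'n var mpoly) = {4}"
    by (simp add: image_constant_conv)
  then show ?thesis by (simp add: total_degree_def)
qed


section \<open>Cubics separating the points\<close>

text \<open>Apolarity enters the arguments about points only through quartics, whose action on the quartic
  has scalar values. In this form it holds for representatives of the points of an apolar set as
  well as for the coefficient vectors of a Waring decomposition.\<close>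

definition apolar_vecs :: "(complex ^ 'n::finite var) set \<Rightarrow> bool" where
  "apolar_vecs A \<longleftrightarrow>
     (\<forall>g. homogeneous 4 g \<and> (\<forall>a\<in>A. eval_at g a = 0) \<longrightarrow> apolar_act g quartic = 0)"

lemma apolar_vecsD:
  assumes "apolar_vecs A" "homogeneous (Suc (Suc (Suc (Suc 0)))) g" "\<And>a. a \<in> A \<Longrightarrow> eval_at g a = 0"
  shows "apolar_act g quartic = 0"
  using assms by (auto simp: apolar_vecs_def numeral_eq_Suc)

text \<open>If a linear form \<open>d\<close> in the \<open>Y j\<close> occurs as \<open>Z1 Z2 d\<close> in a cubic vanishing on the points
  off the line \<open>Y = 0\<close>, then multiplying with \<open>Y j\<close> gives a quartic vanishing on all points, and
  apolarity reads off the coefficient of \<open>d\<close>. Dividing by \<open>ylin t\<close> and repeating the argument with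
  the multipliers \<open>Z2 Y j\<close> and \<open>Z1 Y j\<close> removes the terms \<open>b\<close> and \<open>c\<close>. The extra term \<open>P\<close> does not
  interfere as long as it is annihilated by the multipliers that occur.\<close>

lemma cubic_vanishing:
  fixes a b c d t :: "complex ^ 'n::finite"
  assumes A: "apolar_vecs A" and t: "\<And>x. x \<in> A \<Longrightarrow> yc x \<noteq> 0 \<Longrightarrow> bdot t (yc x) \<noteq> 0"
    and P: "homogeneous (Suc (Suc 0)) P"
      "\<And>m. apolar_act (P * (Z1 * ylin m)) quartic = 0"
      "\<And>m. apolar_act (P * (Z2 * ylin m)) quartic = 0"
      "\<And>m. apolar_act (P * (ylin t * ylin m)) quartic = 0"
    and G: "\<And>x. x \<in> A \<Longrightarrow> yc x \<noteq> 0 \<Longrightarrow>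
      bdot t (yc x) ^ 2 * bdot a (yc x) + bdot t (yc x) * zc x * bdot b (yc x) +
      bdot t (yc x) * wc x * bdot c (yc x) + zc x * wc x * bdot d (yc x) +
      bdot t (yc x) * eval_at P x = 0"
  shows "d = 0" "b = 0" "c = 0"
    and "\<And>x. x \<in> A \<Longrightarrow> yc x \<noteq> 0 \<Longrightarrow> bdot t (yc x) * bdot a (yc x) + eval_at P x = 0"
proof -
  have hom: "homogeneous (Suc (Suc (Suc (Suc 0)))) (p * q)"
    if "homogeneous (Suc (Suc 0)) p" "homogeneous (Suc (Suc 0)) q" for p q :: "'n var mpoly"
    using homogeneous_mult[OF that] by simp
  note hs = homogeneous_add homogeneous_mult1 homogeneous_Z1 homogeneous_Z2 homogeneous_ylin hom P(1)
  have "bdot d m = 0" for m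
  proof -
    let ?g = "ylin a * ylin m * (ylin t * ylin t) + ylin t * Z1 * (ylin b * ylin m) +
      ylin t * Z2 * (ylin c * ylin m) + Z1 * Z2 * (ylin d * ylin m) + P * (ylin t * ylin m)"
    have "apolar_act ?g quartic = 0"
    proof (rule apolar_vecsD[OF A])
      fix x assume x: "x \<in> A"
      show "eval_at ?g x = 0"
      proof (cases "yc x = 0")
        case False
        have "eval_at ?g x = (bdot t (yc x) ^ 2 * bdot a (yc x) + bdot t (yc x) * zc x * bdot b (yc x) +
          bdot t (yc x) * wc x * bdot c (yc x) + zc x * wc x * bdot d (yc x) +
          bdot t (yc x) * eval_at P x) * bdot m (yc x)"
          by (simp add: eval_at_simps algebra_simps power2_eq_square)
        then show ?thesis using G[OF x False] by simp
      qed (simp add: eval_at_simps)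
    qed (intro hs)
    moreover have "apolar_act (ylin a * ylin m * (ylin t * ylin t)) quartic = 0"
      using act_quartic_yyy[of "ylin a" m t t] by (simp add: mult.assoc)
    moreover have "apolar_act (ylin t * Z1 * (ylin b * ylin m)) quartic = 0"
      using act_quartic_yyy[of Z1 t b m] by (simp add: mult_ac)
    moreover have "apolar_act (ylin t * Z2 * (ylin c * ylin m)) quartic = 0"
      using act_quartic_yyy[of Z2 t c m] by (simp add: mult_ac)
    ultimately have "apolar_act (Z1 * Z2 * (ylin d * ylin m)) quartic = 0"
      by (simp only: apolar_act_add_left P(4) add_0_left add_0_right)
    then show ?thesis using act_quartic_Z1_Z2_y_y[of d m] by (simp add: mult.assoc)
  qed
  then show d: "d = 0" by (rule bdot_nondegenerate)
  have G': "bdot t (yc x) * bdot a (yc x) + zc x * bdot b (yc x) + wc x * bdot c (yc x) + eval_at P x = 0"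
    if x: "x \<in> A" "yc x \<noteq> 0" for x
  proof -
    have "bdot t (yc x) * (bdot t (yc x) * bdot a (yc x) + zc x * bdot b (yc x) +
        wc x * bdot c (yc x) + eval_at P x) = 0"
      using G[OF x] by (simp add: d algebra_simps power2_eq_square)
    with t[OF x] show ?thesis by simp
  qed
  let ?h = "ylin t * ylin a + Z1 * ylin b + Z2 * ylin c + P"
  have h: "eval_at ?h x = 0" if "x \<in> A" "yc x \<noteq> 0" for x
    using G'[OF that] by (simp add: eval_at_simps)
  have act: "apolar_act (?h * (l * ylin m)) quartic = 0"
    if l: "l = Z1 \<or> l = Z2" for l m
  proof (rule apolar_vecsD[OF A])
    fix x assume "x \<in> A"
    then show "eval_at (?h * (l * ylin m)) x = 0"
      using h[of x] by (cases "yc x = 0") (simp_all add: eval_at_mult)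
  qed (use l in \<open>auto intro!: hs\<close>)
  have "bdot b m = 0" for m
  proof -
    have "?h * (Z2 * ylin m) = Z2 * (ylin t * (ylin a * ylin m)) + Z1 * (Z2 * (ylin b * ylin m)) +
        ylin c * ylin m * (Z2 * Z2) + P * (Z2 * ylin m)"
      by (simp add: algebra_simps)
    then show ?thesis
      using act[of Z2 m] act_quartic_yyy[of Z2 t a m] act_quartic_Z2_Z2[of "ylin c * ylin m"]
        act_quartic_Z1_Z2_y_y[of b m] P(3)[of m] by (simp add: apolar_act_add_left)
  qed
  then show "b = 0" by (rule bdot_nondegenerate)
  have "bdot c m = 0" for m
  proof -
    have "?h * (Z1 * ylin m) = Z1 * (ylin t * (ylin a * ylin m)) + Z1 * (Z2 * (ylin c * ylin m)) +
        ylin b * ylin m * (Z1 * Z1) + P * (Z1 * ylin m)"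
      by (simp add: algebra_simps)
    then show ?thesis
      using act[of Z1 m] act_quartic_yyy[of Z1 t a m] act_quartic_Z1_Z1[of "ylin b * ylin m"]
        act_quartic_Z1_Z2_y_y[of c m] P(2)[of m] by (simp add: apolar_act_add_left)
  qed
  then show "c = 0" by (rule bdot_nondegenerate)
  with \<open>b = 0\<close> G' show "\<And>x. x \<in> A \<Longrightarrow> yc x \<noteq> 0 \<Longrightarrow> bdot t (yc x) * bdot a (yc x) + eval_at P x = 0"
    by simp
qed

text \<open>Multiplying \<open>ylin a\<close> with \<open>Z1 Z2 Y j\<close> gives quartics vanishing on all points, which read off
  the coefficients of \<open>a\<close>.\<close>

lemma ylin_separates:
  assumes A: "apolar_vecs A" and a: "\<And>x. x \<in> A \<Longrightarrow> bdot a (yc x) = 0"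
  shows "a = 0"
proof (rule bdot_nondegenerate)
  fix m
  have "apolar_act (Z1 * (Z2 * (ylin a * ylin m))) quartic = 0"
  proof (rule apolar_vecsD[OF A])
    show "homogeneous (Suc (Suc (Suc (Suc 0)))) (Z1 * (Z2 * (ylin a * ylin m)))"
      using homogeneous_mult1[OF homogeneous_mult1[OF homogeneous_mult1[OF homogeneous_Z1 homogeneous_Z2]
            homogeneous_ylin] homogeneous_ylin] by (simp add: mult.assoc)
  qed (use a in \<open>simp add: eval_at_simps\<close>)
  then show "bdot a m = 0" by (simp add: act_quartic_Z1_Z2_y_y)
qed

text \<open>The \<open>4 n\<close> cubics are \<open>t^2 Y j\<close>, \<open>t Z1 Y j\<close>, \<open>t Z2 Y j\<close> and \<open>Z1 Z2 Y j\<close>, where the linear form \<open>t\<close> in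
  the \<open>Y j\<close> homogenises the four products \<open>1\<close>, \<open>Z1\<close>, \<open>Z2\<close>, \<open>Z1 Z2\<close>. Collecting the values of all of
  them at a point in one vector turns a cubic in their span into a linear functional.\<close>

definition cubic_vals :: "complex ^ 'n \<Rightarrow> complex ^ 'n::finite var \<Rightarrow> complex ^ ('n \<times> bool \<times> bool)" where
  "cubic_vals t x = (\<chi> k. case k of (j, e, e') \<Rightarrow> yc x $ j * (if e then zc x else bdot t (yc x)) *
     (if e' then wc x else bdot t (yc x)))"


lemma sum_signs:
  fixes f :: "'n::finite \<times> bool \<times> bool \<Rightarrow> 'a::comm_monoid_add"
  shows "(\<Sum>k\<in>UNIV. f k) = (\<Sum>j\<in>UNIV. f (j, False, False) + f (j, False, True) +
    f (j, True, False) + f (j, True, True))"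
proof -
  have "(\<Sum>k\<in>UNIV. f k) = (\<Sum>j\<in>UNIV. \<Sum>e\<in>UNIV. \<Sum>e'\<in>UNIV. f (j, e, e'))"
    by (simp add: sum.cartesian_product UNIV_Times_UNIV case_prod_unfold)
  then show ?thesis by (simp add: UNIV_bool add_ac)
qed

definition block :: "complex ^ ('n \<times> bool \<times> bool) \<Rightarrow> bool \<Rightarrow> bool \<Rightarrow> complex ^ 'n::finite" where
  "block c e e' = (\<chi> j. c $ (j, e, e'))"

lemma bdot_cubic_vals:
  "bdot c (cubic_vals t x) =
     bdot t (yc x) ^ 2 * bdot (block c False False) (yc x) +
     bdot t (yc x) * zc x * bdot (block c True False) (yc x) +
     bdot t (yc x) * wc x * bdot (block c False True) (yc x) +
     zc x * wc x * bdot (block c True True) (yc x)"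
  by (simp add: bdot_def[of c] sum_signs cubic_vals_def block_def bdot_def[of "vec_lambda _"]
      sum_distrib_left power2_eq_square algebra_simps flip: sum.distrib)

lemma block_eq_0:
  assumes "\<And>e e'. block c e e' = 0"
  shows "c = 0"
  using assms by (auto simp: block_def vec_eq_iff)

lemma cubic_vals_separating:
  fixes A :: "(complex ^ 'n::finite var) set"
  assumes A: "apolar_vecs A" and t: "\<And>x. x \<in> A \<Longrightarrow> yc x \<noteq> 0 \<Longrightarrow> bdot t (yc x) \<noteq> 0"
    and c: "\<And>x. x \<in> A \<Longrightarrow> yc x \<noteq> 0 \<Longrightarrow> bdot c (cubic_vals t x) = 0"
  shows "c = 0"
proof -
  note van = cubic_vanishing[OF A t, where P = 0 and a = "block c False False"
      and b = "block c True False" and c = "block c False True" and d = "block c True True"]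
  have 0: "block c True True = 0" "block c True False = 0" "block c False True = 0"
    by (rule van; use c in \<open>simp add: bdot_cubic_vals\<close>)+
  have "bdot t (yc x) * bdot (block c False False) (yc x) + eval_at 0 x = 0" if "x \<in> A" "yc x \<noteq> 0" for x
    by (rule van(4)) (use c that in \<open>simp_all add: bdot_cubic_vals\<close>)
  then have "bdot (block c False False) (yc x) = 0" if "x \<in> A" for x
    using t that by (cases "yc x = 0") auto
  then have "block c False False = 0" by (rule ylin_separates[OF A])
  with 0 show ?thesis by (intro block_eq_0) (metis (full_types))
qed

text \<open>The lower bound for the rank. Points on the line \<open>Y = 0\<close> do not count, because every
  multiplier used in the separation argument contains some \<open>Y j\<close>.\<close>

theorem apolar_vecs_card:
  fixes A :: "(complex ^ 'n::finite var) set"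
  assumes A: "apolar_vecs A" "finite A"
  shows "4 * CARD('n) \<le> card {x \<in> A. yc x \<noteq> 0}"
proof -
  obtain t where "\<And>y. y \<in> yc ` A - {0} \<Longrightarrow> bdot t y \<noteq> 0"
    using ex_nonvanishing_functional[of "yc ` A - {0}"] A(2) by auto
  then have t: "bdot t (yc x) \<noteq> 0" if "x \<in> A" "yc x \<noteq> 0" for x using that by simp
  have "CARD('n \<times> bool \<times> bool) \<le> card {x \<in> A. yc x \<noteq> 0}"
    by (rule separating_family(1)[where \<phi> = "cubic_vals t"])
      (use A(2) t in \<open>auto intro!: cubic_vals_separating[OF A(1), of t]\<close>)
  then show ?thesis by simp
qed

text \<open>With the minimal number of points the cubics interpolate every function on them, in particular
  the values of \<open>P\<close>. The interpolating cubic and \<open>ylin t * P\<close> agree on the points, so the vanishing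
  argument leaves only the term \<open>t^2 Y j\<close>: on points normalised by \<open>ylin t = 1\<close> the quadric \<open>P\<close> has
  the values of a linear form in the \<open>Y j\<close>. Multiplying the difference by \<open>Z1 Z2\<close> then relates this
  linear form to \<open>P\<close> through the action on the quartic.\<close>

lemma quadric_reduction:
  fixes A :: "(complex ^ 'n::finite var) set"
  assumes A: "apolar_vecs A" "finite A" "card A = 4 * CARD('n)"
    and t: "\<And>x. x \<in> A \<Longrightarrow> bdot t (yc x) = 1"
    and P: "homogeneous (Suc (Suc 0)) P"
      "\<And>m. apolar_act (P * (Z1 * ylin m)) quartic = 0"
      "\<And>m. apolar_act (P * (Z2 * ylin m)) quartic = 0"
      "\<And>m. apolar_act (P * (ylin t * ylin m)) quartic = 0"
  obtains m where "\<And>x. x \<in> A \<Longrightarrow> eval_at P x = bdot m (yc x)"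
    and "apolar_act (Z1 * (Z2 * P)) quartic = Const (8 * bdot t m)"
proof -
  have t': "bdot t (yc x) \<noteq> 0" if "x \<in> A" for x using t[OF that] by simp
  have nz: "yc x \<noteq> 0" if "x \<in> A" for x using t'[OF that] by auto
  have "\<exists>c. \<forall>x\<in>A. bdot c (cubic_vals t x) = - eval_at P x"
    by (rule separating_family(2))
      (use A t' in \<open>auto intro!: cubic_vals_separating[OF A(1)]\<close>)
  then obtain c where c: "\<And>x. x \<in> A \<Longrightarrow> bdot c (cubic_vals t x) = - eval_at P x" by blast
  have red: "bdot t (yc x) * bdot (block c False False) (yc x) + eval_at P x = 0" if "x \<in> A" for x
    by (rule cubic_vanishing(4)[OF A(1) _ P, where b = "block c True False" and
          c = "block c False True" and d = "block c True True"])
      (use c t t' nz that in \<open>simp_all add: bdot_cubic_vals add_ac\<close>)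
  let ?m = "(-1) *s block c False False"
  show thesis
  proof
    show ev: "eval_at P x = bdot ?m (yc x)" if "x \<in> A" for x
      using red[OF that] t[OF that] by (simp only: bdot_scale_left) (simp add: eq_neg_iff_add_eq_0 add.commute)
    have hs: "homogeneous (Suc (Suc 0)) (ylin t * ylin ?m)" "homogeneous (Suc (Suc 0)) (Z1 * Z2)"
      by (intro homogeneous_mult1 homogeneous_ylin homogeneous_Z1 homogeneous_Z2)+
    have "apolar_act (Z1 * Z2 * (P - ylin t * ylin ?m)) quartic = 0"
    proof (rule apolar_vecsD[OF A(1)])
      show "homogeneous (Suc (Suc (Suc (Suc 0)))) (Z1 * Z2 * (P - ylin t * ylin ?m))"
        using homogeneous_mult[OF hs(2) homogeneous_diff[OF P(1) hs(1)]] by simp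
    qed (use ev t in \<open>simp add: eval_at_simps\<close>)
    then show "apolar_act (Z1 * (Z2 * P)) quartic = Const (8 * bdot t ?m)"
      by (simp add: right_diff_distrib mult.assoc apolar_act_diff_left act_quartic_Z1_Z2_y_y)
  qed
qed


section \<open>Projective points and their representatives\<close>

lemma proj_spaceE:
  assumes "p \<in> proj_space"
  obtains a where "a \<noteq> 0" "p = vec.span {a}"
proof -
  from assms have p: "vec.subspace p" "vec.dim p = 1" by (auto simp: proj_space_def)
  obtain B where B: "B \<subseteq> p" "vec.independent B" "p \<subseteq> vec.span B" "card B = vec.dim p"
    using vec.basis_exists[of p] by blast
  with p(2) obtain a where a: "B = {a}" by (auto simp: card_Suc_eq)
  have "vec.span B = p" using B p(1) by (metis subset_antisym vec.span_minimal)
  moreover have "a \<noteq> 0" using B(2) a vec.dependent_zero[of B] by auto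
  ultimately show thesis using a that by auto
qed

lemma span_in_proj_space [simp]: "vec.span {a} \<in> proj_space \<longleftrightarrow> a \<noteq> 0"
proof -
  have "vec.dim {a} = (if a = 0 then 0 else 1)"
    by (auto simp: vec.dim_eq_card_independent vec.dim_insert)
  then show ?thesis by (simp add: proj_space_def vec.subspace_span)
qed

lemma mem_span_singleton: "b \<in> vec.span {a} \<longleftrightarrow> (\<exists>c. b = c *s a)"
  by (auto simp: vec.span_singleton)

lemma span_scale: "c \<noteq> 0 \<Longrightarrow> vec.span {c *s a} = vec.span {a}"
proof -
  assume c: "c \<noteq> 0"
  have "k *s a \<in> range (\<lambda>k. k *s (c *s a))" for k
    using c by (intro image_eqI[of _ _ "k / c"]) (simp_all add: vec.scale_scale)
  then show ?thesis by (auto simp: vec.span_singleton vec.scale_scale)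
qed

lemma span_singleton_eq_iff:
  assumes "b \<noteq> 0"
  shows "vec.span {a} = vec.span {b} \<longleftrightarrow> (\<exists>c. c \<noteq> 0 \<and> b = c *s a)"
proof
  assume "vec.span {a} = vec.span {b}"
  then have "b \<in> vec.span {a}" by (simp add: vec.span_base)
  with assms show "\<exists>c. c \<noteq> 0 \<and> b = c *s a" by (auto simp: mem_span_singleton)
qed (auto simp: span_scale)

lemma vanishes_at_span:
  assumes "homogeneous d g"
  shows "vanishes_at g (vec.span {a}) \<longleftrightarrow> eval_at g a = 0"
proof
  show "vanishes_at g (vec.span {a}) \<Longrightarrow> eval_at g a = 0"
    by (simp add: vanishes_at_def vec.span_base)
qed (auto simp: vanishes_at_def vec.span_singleton eval_at_scale[OF assms])

lemma apolar_vecs_of_apolar_set: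
  assumes "apolar_set quartic ((\<lambda>a. vec.span {a}) ` A)"
  shows "apolar_vecs A"
  unfolding apolar_vecs_def
proof safe
  fix g assume g: "homogeneous 4 g" "\<forall>a\<in>A. eval_at g a = 0"
  then have "g \<in> vanishing_ideal ((\<lambda>a. vec.span {a}) ` A)"
    unfolding vanishing_ideal_def ideal_gen_def
    by (intro module.span_base[OF module_mpoly]) (auto simp: vanishes_at_span)
  with assms show "apolar_act g quartic = 0" by (auto simp: apolar_set_def perp_def)
qed

lemma apolar_set_representatives:
  fixes X :: "'n::finite var ppoint set"
  assumes "apolar_set quartic X"
  obtains A where "X = (\<lambda>a. vec.span {a}) ` A" "finite A" "card A = card X" "apolar_vecs A"
proof -
  have "\<forall>p\<in>X. \<exists>a. p = vec.span {a}"
    using assms proj_spaceE unfolding apolar_set_def by (metis subsetD)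
  then obtain r where r: "\<forall>p\<in>X. p = vec.span {r p}" by (rule bchoice[THEN exE])
  have X: "X = (\<lambda>a. vec.span {a}) ` (r ` X)" using r by (auto simp: image_image)
  have "inj_on r X" using r by (metis inj_onI)
  then have "card (r ` X) = card X" by (rule card_image)
  moreover have "finite (r ` X)" using assms by (simp add: apolar_set_def)
  moreover have "apolar_vecs (r ` X)"
    by (rule apolar_vecs_of_apolar_set) (use assms X in simp)
  ultimately show thesis using X that by blast
qed

text \<open>The lower bound is attained, so no point lies on the line \<open>Y = 0\<close>, and a general linear form \<open>t\<close>
  in the \<open>Y j\<close> can be normalised to 1 on all points.\<close>

lemma apolar_set_normalised:
  fixes X :: "'n::finite var ppoint set"
  assumes X: "apolar_set quartic X" "card X = 4 * CARD('n)"
  obtains A t where "X = (\<lambda>a. vec.span {a}) ` A" "finite A" "card A = 4 * CARD('n)" "apolar_vecs A"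
    and "\<And>a. a \<in> A \<Longrightarrow> bdot t (yc a) = 1"
proof -
  obtain A where A: "X = (\<lambda>a. vec.span {a}) ` A" "finite A" "card A = card X" "apolar_vecs A"
    using apolar_set_representatives[OF X(1)] by blast
  have "{x \<in> A. yc x \<noteq> 0} = A"
    using apolar_vecs_card[OF A(4,2)] A X by (intro card_seteq) auto
  then have "0 \<notin> yc ` A" by auto
  then obtain t where t: "\<And>y. y \<in> yc ` A \<Longrightarrow> bdot t y \<noteq> 0"
    using ex_nonvanishing_functional[of "yc ` A"] A(2) by auto
  define s where "s a = (1 / bdot t (yc a)) *s a" for a
  have "vec.span {s a} = vec.span {a}" if "a \<in> A" for a
    using t that by (simp add: s_def span_scale)
  then have XA: "X = (\<lambda>a. vec.span {a}) ` (s ` A)" using A(1) by (simp add: image_image)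
  have fin: "finite (s ` A)" using A(2) by simp
  have "card X \<le> card (s ` A)" unfolding XA by (rule card_image_le[OF fin])
  moreover have "card (s ` A) \<le> card A" using A(2) by (rule card_image_le)
  ultimately have "card (s ` A) = 4 * CARD('n)" using A X by simp
  moreover have "apolar_vecs (s ` A)"
    using X(1) XA by (intro apolar_vecs_of_apolar_set) simp
  moreover have "bdot t (yc a) = 1" if "a \<in> s ` A" for a
    using that t by (auto simp: s_def bdot_scale_right)
  ultimately show thesis using XA fin that by blast
qed


section \<open>The shape of minimal apolar sets\<close>

definition orthonormal :: "('n::finite \<Rightarrow> complex ^ 'n) \<Rightarrow> bool" where
  "orthonormal f \<longleftrightarrow> (\<forall>i j. bdot (f i) (f j) = (if i = j then 1 else 0))"

definition sg :: "bool \<Rightarrow> complex" where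
  "sg e = (if e then 1 else -1)"

lemma sg_simps [simp]: "sg True = 1" "sg False = -1" "sg e * sg e = 1" "sg e \<noteq> 0" "sg e ^ 2 = 1"
  by (simp_all add: sg_def)

lemma sg_eq_iff: "sg e = sg e' \<longleftrightarrow> e = e'"
  by (simp add: sg_def)

lemma square_eq_imp_sg:
  assumes "x ^ 2 = c ^ 2"
  shows "\<exists>e. x = sg e * c"
proof -
  have "x = sg True * c \<or> x = sg False * c" using assms by (simp add: power2_eq_iff)
  then show ?thesis by blast
qed

text \<open>The representatives are scaled so that the \<open>y\<close>-part has square 1. With this scaling the
  conditions on \<open>a\<close> and \<open>b\<close> below are the same for all indices.\<close>

definition config_vec :: "('n \<Rightarrow> complex ^ 'n) \<Rightarrow> ('n \<Rightarrow> complex) \<Rightarrow> ('n \<Rightarrow> complex) \<Rightarrow>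
    'n::finite \<times> bool \<times> bool \<Rightarrow> complex ^ 'n var" where
  "config_vec f a b k = (case k of (i, e, e') \<Rightarrow> pt (sg e * a i) (sg e' * b i) (f i))"

definition config :: "('n \<Rightarrow> complex ^ 'n) \<Rightarrow> ('n \<Rightarrow> complex) \<Rightarrow> ('n \<Rightarrow> complex) \<Rightarrow>
    'n::finite var ppoint set" where
  "config f a b = range (\<lambda>k. vec.span {config_vec f a b k})"

definition admissible :: "('n::finite \<Rightarrow> complex ^ 'n) \<Rightarrow> ('n \<Rightarrow> complex) \<Rightarrow> ('n \<Rightarrow> complex) \<Rightarrow> bool" where
  "admissible f a b \<longleftrightarrow> orthonormal f \<and> (\<forall>i. a i \<noteq> 0 \<and> b i \<noteq> 0) \<and>
     (\<Sum>i\<in>UNIV. a i ^ 2) = 0 \<and> (\<Sum>i\<in>UNIV. b i ^ 2) = 0"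

text \<open>For each \<open>w \<noteq> v\<close> some linear form is 1 at \<open>v\<close> and 0 at \<open>w\<close>: a difference of a coordinate and a
  multiple of \<open>t\<close>, suitably scaled. The product of these forms over \<open>W\<close> is again linear on \<open>V\<close>.\<close>

lemma dual_functional:
  fixes V :: "(complex ^ 'm::finite) set"
  assumes t: "\<And>v. v \<in> V \<Longrightarrow> bdot t v = 1"
    and mult: "\<And>m m'. \<exists>m''. \<forall>v\<in>V. bdot m v * bdot m' v = bdot m'' v"
    and "finite W" "W \<subseteq> V" "v \<in> V" "v \<notin> W"
  shows "\<exists>e. bdot e v = 1 \<and> (\<forall>w\<in>W. bdot e w = 0)"
  using assms(3,4,6)
proof (induction W)
  case empty
  then show ?case using t[OF \<open>v \<in> V\<close>] by auto
next
  case (insert w W)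
  then obtain e where e: "bdot e v = 1" "\<forall>w\<in>W. bdot e w = 0" by auto
  from insert obtain k where k: "v $ k \<noteq> w $ k" by (auto simp: vec_eq_iff)
  define m where "m = (1 / (v $ k - w $ k)) *s (axis k 1 - (w $ k) *s t)"
  have m: "bdot m v = 1" "bdot m w = 0"
    unfolding m_def bdot_scale_left bdot_diff_left bdot_axis_left
    using k t[of v] t[of w] \<open>v \<in> V\<close> insert.prems by simp_all
  obtain m'' where m'': "\<forall>v\<in>V. bdot e v * bdot m v = bdot m'' v" using mult by blast
  have "bdot m'' v = 1" using m'' m e \<open>v \<in> V\<close> by (metis mult_1)
  moreover have "bdot m'' w = 0" using m'' m insert.prems by (metis insert_subset mult_zero_right)
  moreover have "bdot m'' w' = 0" if "w' \<in> W" for w'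
    using m'' e insert.prems that by (metis insert_subset mult_zero_left subsetD)
  ultimately show ?case by blast
qed

text \<open>Since quadrics reduce to linear forms on the points, the \<open>y\<close>-parts \<open>v i\<close> are \<open>n\<close> in number and
  carry dual linear forms \<open>e i\<close>. The product \<open>e i * e j\<close> of two of them vanishes on the points, so
  apolarity makes the \<open>e i\<close> pairwise orthogonal, and rescaling gives an orthonormal basis. As \<open>Z1^2\<close>
  and \<open>Z2^2\<close> also reduce to linear forms in the \<open>Y j\<close>, at most four points lie over each \<open>v i\<close>, hence
  exactly four by counting.\<close>

theorem apolar_set_structure:
  fixes X :: "'n::finite var ppoint set"
  assumes X: "apolar_set quartic X" "card X = 4 * CARD('n)"
  obtains f a b where "admissible f a b" "X = config f a b"
proof -
  obtain A t where A: "X = (\<lambda>a. vec.span {a}) ` A" "finite A" "card A = 4 * CARD('n)" "apolar_vecs A"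
    and t: "\<And>a. a \<in> A \<Longrightarrow> bdot t (yc a) = 1"
    using apolar_set_normalised[OF X] by blast
  note reduction = quadric_reduction[OF A(4,2,3) t]
  have mult: "\<exists>m. (\<forall>x\<in>A. bdot m1 (yc x) * bdot m2 (yc x) = bdot m (yc x)) \<and> bdot m1 m2 = bdot t m"
    for m1 m2
  proof -
    have "homogeneous (Suc (Suc 0)) (ylin m1 * ylin m2)"
      by (intro homogeneous_mult1 homogeneous_ylin)
    moreover have "apolar_act (ylin m1 * ylin m2 * (Z1 * ylin m)) quartic = 0"
      "apolar_act (ylin m1 * ylin m2 * (Z2 * ylin m)) quartic = 0"
      "apolar_act (ylin m1 * ylin m2 * (ylin t * ylin m)) quartic = 0" for m
      using act_quartic_yyy[of Z1 m1 m2 m] act_quartic_yyy[of Z2 m1 m2 m]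
        act_quartic_yyy[of "ylin m1" m2 t m] by (simp_all add: mult_ac)
    ultimately obtain m where m: "\<And>x. x \<in> A \<Longrightarrow> eval_at (ylin m1 * ylin m2) x = bdot m (yc x)"
      "apolar_act (Z1 * (Z2 * (ylin m1 * ylin m2))) quartic = Const (8 * bdot t m)"
      using reduction by blast
    have "Const (8 * bdot m1 m2 - 8 * bdot t m) = (0 :: 'n var mpoly)"
      using m(2) by (simp add: act_quartic_Z1_Z2_y_y Const_diff)
    then have "bdot m1 m2 = bdot t m" by simp
    with m(1) show ?thesis by (auto simp: eval_at_mult)
  qed
  have square: "\<exists>m. (\<forall>x\<in>A. eval_at Z x ^ 2 = bdot m (yc x)) \<and> bdot t m = 0"
    if Z: "Z = Z1 \<or> Z = Z2" for Z
  proof -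
    have "homogeneous (Suc (Suc 0)) (Z * Z)"
      using Z by (auto intro!: homogeneous_mult1)
    moreover have 0: "apolar_act (Z * Z * g) quartic = 0" for g
      using Z act_quartic_Z1_Z1[of g] act_quartic_Z2_Z2[of g] by (auto simp: mult_ac)
    ultimately obtain m where m: "\<And>x. x \<in> A \<Longrightarrow> eval_at (Z * Z) x = bdot m (yc x)"
      "apolar_act (Z1 * (Z2 * (Z * Z))) quartic = Const (8 * bdot t m)"
      using reduction[of "Z * Z"] by blast
    have "Const (8 * bdot t m) = (0 :: 'n var mpoly)"
      using m(2) 0[of "Z1 * Z2"] by (simp add: mult_ac)
    then have "bdot t m = 0" by simp
    with m(1) show ?thesis by (auto simp: eval_at_mult power2_eq_square)
  qed
  \<comment> \<open>the linear forms dual to the set of \<open>y\<close>-parts are at once independent and separating\<close>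
  define V where "V = yc ` A"
  have finV: "finite V" using A(2) by (simp add: V_def)
  have sep: "m = 0" if "\<And>v. v \<in> V \<Longrightarrow> bdot m v = 0" for m
    by (rule ylin_separates[OF A(4)]) (use that in \<open>simp add: V_def\<close>)
  have "\<exists>e. bdot e v = 1 \<and> (\<forall>w\<in>V - {v}. bdot e w = 0)" if "v \<in> V" for v
  proof (rule dual_functional[where V = V and t = t])
    show "\<exists>m''. \<forall>v\<in>V. bdot m v * bdot m' v = bdot m'' v" for m m'
      using mult[of m m'] by (auto simp: V_def)
  qed (use that finV t in \<open>auto simp: V_def\<close>)
  then obtain e0 where e0: "\<And>v. v \<in> V \<Longrightarrow> bdot (e0 v) v = 1"
    "\<And>v w. v \<in> V \<Longrightarrow> w \<in> V \<Longrightarrow> w \<noteq> v \<Longrightarrow> bdot (e0 v) w = 0" by (metis Diff_iff singletonD)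
  have "card V = CARD('n)"
  proof (rule antisym)
    show "CARD('n) \<le> card V"
      by (rule separating_family(1)[where \<phi> = "\<lambda>v. v"]) (use finV sep in auto)
    have "vec.independent ((\<lambda>v. v) ` V)"
      by (rule biorthogonal_independent(2)[where c = e0]) (use e0 in auto)
    then show "card V \<le> CARD('n)"
      using vec.independent_card_le_dim[of V UNIV] by (simp add: card_cart_basis)
  qed
  then obtain v where v: "bij_betw v (UNIV :: 'n set) V"
    using finite_same_card_bij[of "UNIV :: 'n set" V] finV by auto
  have vV: "v i \<in> V" for i using v by (auto simp: bij_betw_def)
  have Vv: "\<exists>i. w = v i" if "w \<in> V" for w using v that by (auto simp: bij_betw_def)
  have v_inj: "v i = v j \<longleftrightarrow> i = j" for i j using v by (auto simp: bij_betw_def inj_def)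
  define E where "E i = e0 (v i)" for i
  have Ev: "bdot (E i) (v j) = (if i = j then 1 else 0)" for i j
    using e0 vV by (auto simp: E_def v_inj)
  have sepv: "m = 0" if "\<And>i. bdot m (v i) = 0" for m
    by (rule sep) (use that Vv in auto)
  have expand: "m = (\<Sum>i\<in>UNIV. bdot m (v i) *s E i)" for m
  proof -
    have "bdot (m - (\<Sum>i\<in>UNIV. bdot m (v i) *s E i)) (v j) = 0" for j
      by (simp add: bdot_diff_left bdot_sum_left bdot_scale_left Ev if_distrib cong: if_cong)
    then show ?thesis using sepv by fastforce
  qed
  have sepE: "x = 0" if "\<And>i. bdot (E i) x = 0" for x
  proof (rule bdot_nondegenerate)
    show "bdot x m = 0" for m
      by (subst bdot_commute, subst expand) (simp add: bdot_sum_left bdot_scale_left that)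
  qed
  have orth: "bdot (E i) (E j) = 0" if "i \<noteq> j" for i j
  proof -
    obtain m where m: "\<forall>x\<in>A. bdot (E i) (yc x) * bdot (E j) (yc x) = bdot m (yc x)"
      "bdot (E i) (E j) = bdot t m" using mult by blast
    have "m = 0"
    proof (rule sepv)
      fix k
      obtain x where "x \<in> A" "v k = yc x" using vV[of k] by (auto simp: V_def)
      with m(1) Ev[of i k] Ev[of j k] that show "bdot m (v k) = 0" by (auto split: if_splits)
    qed
    with m(2) show ?thesis by simp
  qed
  \<comment> \<open>the dual basis is orthogonal, hence proportional to the basis itself\<close>
  define d where "d i = bdot (E i) (E i)" for i
  have Ed: "E i = d i *s v i" for i
  proof -
    have "E i - d i *s v i = 0"
      by (rule sepE) (use orth in \<open>auto simp: bdot_diff_right bdot_scale_right Ev d_def\<close>)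
    then show ?thesis by simp
  qed
  have d: "d i \<noteq> 0" for i
    using Ed[of i] Ev[of i i] by auto
  have vv: "d i * bdot (v i) (v j) = (if i = j then 1 else 0)" for i j
    using Ev[of i j] by (simp add: Ed bdot_scale_left)
  have tv: "bdot t (v i) = 1" for i using vV[of i] t by (auto simp: V_def)
  have t_sum: "t = (\<Sum>i\<in>UNIV. E i)"
    using expand[of t] unfolding tv vec.scale_one .
  obtain m1 m2 where m1: "\<And>x. x \<in> A \<Longrightarrow> zc x ^ 2 = bdot m1 (yc x)" "bdot t m1 = 0"
    and m2: "\<And>x. x \<in> A \<Longrightarrow> wc x ^ 2 = bdot m2 (yc x)" "bdot t m2 = 0"
    using square[of Z1] square[of Z2] by auto
  define \<alpha> \<beta> where "\<alpha> i = csqrt (bdot m1 (v i))" and "\<beta> i = csqrt (bdot m2 (v i))" for i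
  \<comment> \<open>\<open>A\<close> has as many elements as the index type of \<open>h\<close>, so \<open>A \<subseteq> range h\<close> forces equality and
    injectivity, and this excludes zeros among the square roots\<close>
  define h where "h = (\<lambda>(i, e, e'). pt (sg e * \<alpha> i) (sg e' * \<beta> i) (v i))"
  have "A \<subseteq> range h"
  proof
    fix x assume x: "x \<in> A"
    obtain i where i: "yc x = v i" using Vv[of "yc x"] x by (auto simp: V_def)
    have "zc x ^ 2 = \<alpha> i ^ 2" "wc x ^ 2 = \<beta> i ^ 2"
      using m1(1)[OF x] m2(1)[OF x] by (simp_all add: i \<alpha>_def \<beta>_def)
    then obtain e e' where "zc x = sg e * \<alpha> i" "wc x = sg e' * \<beta> i"
      using square_eq_imp_sg by blast
    then have "x = h (i, e, e')" using i by (intro point_eqI) (simp_all add: h_def)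
    then show "x \<in> range h" by blast
  qed
  moreover have le: "card (range h) \<le> 4 * CARD('n)"
    using card_image_le[of "UNIV :: ('n \<times> bool \<times> bool) set" h] by simp
  ultimately have Ah: "A = range h"
    using A(3) by (intro card_seteq) auto
  then have "card (range h) = card (UNIV :: ('n \<times> bool \<times> bool) set)" using A(3) by simp
  then have "inj h" by (intro eq_card_imp_inj_on) auto
  have "\<alpha> i \<noteq> 0" for i
  proof
    assume "\<alpha> i = 0"
    then have "h (i, True, True) = h (i, False, True)" by (simp add: h_def)
    with \<open>inj h\<close> show False by (auto dest: injD)
  qed
  moreover have "\<beta> i \<noteq> 0" for i
  proof
    assume "\<beta> i = 0"
    then have "h (i, True, True) = h (i, True, False)" by (simp add: h_def)
    with \<open>inj h\<close> show False by (auto dest: injD)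
  qed
  moreover
  \<comment> \<open>scaling \<open>v i\<close> to square 1 multiplies the squares of \<open>\<alpha> i\<close> and \<open>\<beta> i\<close> by \<open>d i\<close>\<close>
  have sq: "(\<Sum>i\<in>UNIV. (csqrt (d i) * csqrt (bdot m (v i))) ^ 2) = bdot t m" for m
    by (simp add: t_sum power_mult_distrib bdot_sum_left Ed bdot_scale_left bdot_commute[of m])
  then have "(\<Sum>i\<in>UNIV. (csqrt (d i) * \<alpha> i) ^ 2) = 0" "(\<Sum>i\<in>UNIV. (csqrt (d i) * \<beta> i) ^ 2) = 0"
    using m1(2) m2(2) by (simp_all add: \<alpha>_def \<beta>_def)
  moreover have "orthonormal (\<lambda>i. csqrt (d i) *s v i)"
    unfolding orthonormal_def
  proof (intro allI)
    fix i j
    show "bdot (csqrt (d i) *s v i) (csqrt (d j) *s v j) = (if i = j then 1 else 0)"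
    proof (cases "i = j")
      case True
      have "csqrt (d j) * (csqrt (d j) * bdot (v j) (v j)) = d j * bdot (v j) (v j)"
        by (metis mult.assoc power2_csqrt power2_eq_square)
      with vv[of j j] True show ?thesis by (simp add: bdot_scale_left bdot_scale_right)
    next
      case False
      with vv[of i j] d show ?thesis by (simp add: bdot_scale_left bdot_scale_right)
    qed
  qed
  ultimately have "admissible (\<lambda>i. csqrt (d i) *s v i) (\<lambda>i. csqrt (d i) * \<alpha> i) (\<lambda>i. csqrt (d i) * \<beta> i)"
    using d by (simp add: admissible_def)
  moreover have "X = config (\<lambda>i. csqrt (d i) *s v i) (\<lambda>i. csqrt (d i) * \<alpha> i) (\<lambda>i. csqrt (d i) * \<beta> i)"
  proof -
    have "vec.span {config_vec (\<lambda>i. csqrt (d i) *s v i) (\<lambda>i. csqrt (d i) * \<alpha> i)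
        (\<lambda>i. csqrt (d i) * \<beta> i) k} = vec.span {h k}" for k
    proof -
      obtain i e e' where k: "k = (i, e, e')" by (cases k)
      have "config_vec (\<lambda>i. csqrt (d i) *s v i) (\<lambda>i. csqrt (d i) * \<alpha> i)
          (\<lambda>i. csqrt (d i) * \<beta> i) k = csqrt (d i) *s h k"
        by (simp add: k config_vec_def h_def scale_pt mult_ac)
      then show ?thesis using d by (simp add: span_scale)
    qed
    then show ?thesis unfolding A(1) config_def Ah by (simp add: image_image)
  qed
  ultimately show thesis by (rule that)
qed


section \<open>Waring decompositions and the rank\<close>

text \<open>A right inverse of a square matrix is also a left inverse, so orthonormal rows imply
  orthonormal columns.\<close>

lemma orthonormal_columns:
  assumes "orthonormal f"
  shows "(\<Sum>i\<in>UNIV. f i $ j * f i $ k) = (if j = k then 1 else 0)"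
    and "orthogonal_matrix (\<chi> i. f i)"
proof -
  let ?M = "\<chi> i. f i"
  have 1: "?M ** transpose ?M = mat 1"
    using assms by (simp add: orthonormal_def bdot_def matrix_matrix_mult_def transpose_def mat_def vec_eq_iff)
  then have 2: "transpose ?M ** ?M = mat 1" by (simp add: matrix_left_right_inverse)
  from 1 2 show "orthogonal_matrix ?M" by (simp add: orthogonal_matrix_def)
  from 2 show "(\<Sum>i\<in>UNIV. f i $ j * f i $ k) = (if j = k then 1 else 0)"
    by (simp add: matrix_matrix_mult_def transpose_def mat_def vec_eq_iff)
qed

lemma sum_ylin_squares:
  assumes "orthonormal f"
  shows "(\<Sum>i\<in>UNIV. ylin (f i) ^ 2) = (\<Sum>j\<in>UNIV. Y j ^ 2)"
proof -
  have "(\<Sum>i\<in>UNIV. ylin (f i) ^ 2) =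
      (\<Sum>i\<in>UNIV. \<Sum>j\<in>UNIV. \<Sum>k\<in>UNIV. Const (f i $ j * f i $ k) * (Y j * Y k))"
    by (simp add: ylin_def power2_eq_square sum_product Const_mult mult_ac)
  also have "\<dots> = (\<Sum>j\<in>UNIV. \<Sum>k\<in>UNIV. \<Sum>i\<in>UNIV. Const (f i $ j * f i $ k) * (Y j * Y k))"
    by (subst sum.swap, rule sum.cong[OF refl], subst sum.swap, rule refl)
  also have "\<dots> = (\<Sum>j\<in>UNIV. \<Sum>k\<in>UNIV. Const (\<Sum>i\<in>UNIV. f i $ j * f i $ k) * (Y j * Y k))"
    by (simp add: Const_sum sum_distrib_right)
  also have "\<dots> = (\<Sum>j\<in>UNIV. \<Sum>k\<in>UNIV. if j = k then Y j * Y k else 0)"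
    by (intro sum.cong refl) (simp add: orthonormal_columns[OF assms])
  also have "\<dots> = (\<Sum>j\<in>UNIV. Y j ^ 2)"
    by (simp add: power2_eq_square)
  finally show ?thesis .
qed

lemma lin_pt: "lin (pt z w y) = Const (z / 2) * Z2 + Const (w / 2) * Z1 + ylin y"
proof -
  have 1: "Const ((z + w) / 2) = Const (z / 2) + Const (w / 2)"
    by (simp add: add_divide_distrib flip: Const_add)
  have 2: "Const (\<i> * (z - w) / 2) = Const \<i> * Const (z / 2) - Const \<i> * Const (w / 2)"
    by (simp add: algebra_simps diff_divide_distrib flip: Const_mult Const_diff)
  have 3: "lin (pt z w y) = Const ((z + w) / 2) * X1 + Const (\<i> * (z - w) / 2) * X2 + ylin y"
    by (simp add: lin_def sum_var pt_def ylin_def)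
  show ?thesis
    unfolding 1 2 3 Z1_def Z2_def by (simp add: algebra_simps)
qed

lemma fourth_power_polarisation:
  fixes p r m :: "'a::comm_ring_1"
  shows "(p + r + m) ^ 4 - (p - r + m) ^ 4 - (- p + r + m) ^ 4 + (- p - r + m) ^ 4 =
    48 * (p * r * m ^ 2) + 16 * (p ^ 3 * r) + 16 * (p * r ^ 3)"
  by (simp add: power4_eq_xxxx power3_eq_cube power2_eq_square algebra_simps)

definition weight :: "('n \<Rightarrow> complex) \<Rightarrow> ('n \<Rightarrow> complex) \<Rightarrow> 'n \<times> bool \<times> bool \<Rightarrow> complex" where
  "weight a b k = (case k of (i, e, e') \<Rightarrow> sg e * sg e' / (12 * a i * b i))"

text \<open>Summing over the signs leaves the terms of the fourth power that are odd in both \<open>Z1\<close> and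
  \<open>Z2\<close>. The unwanted \<open>Z1 Z2^3\<close> and \<open>Z1^3 Z2\<close> cancel since the squares of the \<open>a i\<close> and of the
  \<open>b i\<close> add up to zero.\<close>

theorem quartic_decomposition:
  assumes adm: "admissible f a b"
  shows "quartic = (\<Sum>k\<in>UNIV. Const (weight a b k) * lin (config_vec f a b k) ^ 4)"
proof -
  have f: "orthonormal f" and nz: "a i \<noteq> 0" "b i \<noteq> 0"
    and sq: "(\<Sum>i\<in>UNIV. a i ^ 2) = 0" "(\<Sum>i\<in>UNIV. b i ^ 2) = 0" for i
    using adm by (auto simp: admissible_def)
  define G where "G i = (\<Sum>e\<in>UNIV. \<Sum>e'\<in>UNIV. Const (weight a b (i, e, e')) *
    lin (config_vec f a b (i, e, e')) ^ 4)" for i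
  have G: "G i = Z1 * Z2 * ylin (f i) ^ 2 + Const (a i ^ 2) * (Const (1/12) * (Z2 ^ 3 * Z1)) +
      Const (b i ^ 2) * (Const (1/12) * (Z2 * Z1 ^ 3))" for i
  proof -
    define c where "c = 1 / (12 * a i * b i)"
    let ?p = "Const (a i / 2) * Z2" and ?r = "Const (b i / 2) * Z1" and ?m = "ylin (f i)"
    have "G i = Const c * ((?p + ?r + ?m) ^ 4 - (?p - ?r + ?m) ^ 4 - (- ?p + ?r + ?m) ^ 4
        + (- ?p - ?r + ?m) ^ 4)"
      by (simp add: G_def UNIV_bool weight_def config_vec_def lin_pt c_def Const_uminus
          right_diff_distrib distrib_left)
    also have "\<dots> = Const c * (48 * (?p * ?r * ?m ^ 2) + 16 * (?p ^ 3 * ?r) + 16 * (?p * ?r ^ 3))"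
      by (simp only: fourth_power_polarisation)
    also have "\<dots> = Const c * Const 48 * Const (a i / 2) * Const (b i / 2) * (Z1 * Z2 * ?m ^ 2) +
        Const c * Const 16 * Const (a i / 2) ^ 3 * Const (b i / 2) * (Z2 ^ 3 * Z1) +
        Const c * Const 16 * Const (a i / 2) * Const (b i / 2) ^ 3 * (Z2 * Z1 ^ 3)"
      by (simp add: Const_numeral power_mult_distrib algebra_simps)
    also have "\<dots> = Const (c * 48 * (a i / 2) * (b i / 2)) * (Z1 * Z2 * ?m ^ 2) +
        Const (c * 16 * (a i / 2) ^ 3 * (b i / 2)) * (Z2 ^ 3 * Z1) +
        Const (c * 16 * (a i / 2) * (b i / 2) ^ 3) * (Z2 * Z1 ^ 3)"
      by (simp only: Const_mult Const_power)
    also have "c * 48 * (a i / 2) * (b i / 2) = 1"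
      using nz by (simp add: c_def)
    also have "c * 16 * (a i / 2) ^ 3 * (b i / 2) = a i ^ 2 * (1/12)"
      using nz by (simp add: c_def power3_eq_cube power2_eq_square)
    also have "c * 16 * (a i / 2) * (b i / 2) ^ 3 = b i ^ 2 * (1/12)"
      using nz by (simp add: c_def power3_eq_cube power2_eq_square)
    finally show ?thesis by (simp only: Const_mult Const_1 mult_1_left mult.assoc)
  qed
  have "(\<Sum>k\<in>UNIV. Const (weight a b k) * lin (config_vec f a b k) ^ 4) = (\<Sum>i\<in>UNIV. G i)"
    unfolding G_def sum.cartesian_product UNIV_Times_UNIV by (simp add: case_prod_unfold)
  also have "\<dots> = Z1 * Z2 * (\<Sum>i\<in>UNIV. ylin (f i) ^ 2) +
      Const (\<Sum>i\<in>UNIV. a i ^ 2) * (Const (1/12) * (Z2 ^ 3 * Z1)) +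
      Const (\<Sum>i\<in>UNIV. b i ^ 2) * (Const (1/12) * (Z2 * Z1 ^ 3))"
    by (simp add: G sum.distrib sum_distrib_left sum_distrib_right Const_sum)
  also have "\<dots> = quartic"
    by (simp add: sq sum_ylin_squares[OF f] quartic_def)
  finally show ?thesis ..
qed

lemma config_vec_nonzero:
  assumes "admissible f a b"
  shows "config_vec f a b k \<noteq> 0"
  using assms by (cases k) (auto simp: config_vec_def admissible_def pt_eq_0_iff)

lemma orthonormal_scale_eq:
  assumes "orthonormal f" "f j = c *s f i" "c \<noteq> 0"
  shows "i = j" "c = 1"
proof -
  have "bdot (f i) (f j) = c"
    unfolding assms(2) using assms(1) by (simp add: bdot_scale_right orthonormal_def)
  moreover have "bdot (f i) (f j) = (if i = j then 1 else 0)"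
    using assms(1) by (simp add: orthonormal_def)
  ultimately show "i = j" "c = 1" using assms(3) by (auto split: if_splits)
qed

lemma config_inj:
  assumes adm: "admissible f a b"
  shows "inj (\<lambda>k. vec.span {config_vec f a b k})"
proof (rule injI)
  fix k l assume "vec.span {config_vec f a b k} = vec.span {config_vec f a b l}"
  then obtain c where c: "c \<noteq> 0" "config_vec f a b l = c *s config_vec f a b k"
    using span_singleton_eq_iff[OF config_vec_nonzero[OF adm]] by blast
  obtain i e e' j d d' where kl: "k = (i, e, e')" "l = (j, d, d')" by (cases k, cases l)
  from c have "f j = c *s f i" by (simp add: kl config_vec_def scale_pt)
  with c adm have "i = j" "c = 1" using orthonormal_scale_eq by (auto simp: admissible_def)
  with c adm show "k = l" by (simp add: kl config_vec_def admissible_def sg_eq_iff)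
qed

lemma card_config:
  fixes f :: "'n::finite \<Rightarrow> complex ^ 'n"
  assumes "admissible f a b"
  shows "card (config f a b) = 4 * CARD('n)"
  using card_image[OF config_inj[OF assms]] by (simp add: config_def)

lemma subspace_perp: "module.subspace (*) (perp F)"
  unfolding module.subspace_def[OF module_mpoly] perp_def
  by (auto simp: apolar_act_add_left apolar_act_mult)

text \<open>The easy half of the apolarity lemma: an operator vanishing at the points of a decomposition
  kills every power in it.\<close>

lemma apolar_act_power_sum:
  assumes F: "F = (\<Sum>k\<in>K. Const (w k) * lin (c k) ^ d)"
    and g: "homogeneous e g" "\<And>k. k \<in> K \<Longrightarrow> eval_at g (c k) = 0"
  shows "apolar_act g F = 0"
  by (simp add: F apolar_act_sum_right apolar_act_Const_mult_right apolar_act_lin_power[OF g(1)] g(2))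

theorem apolar_set_config:
  assumes adm: "admissible f a b"
  shows "apolar_set quartic (config f a b)"
proof -
  have "vanishing_ideal (config f a b) \<subseteq> perp quartic"
    unfolding vanishing_ideal_def ideal_gen_def
  proof (rule module.span_minimal[OF module_mpoly _ subspace_perp], safe)
    fix g d assume g: "homogeneous d g" "\<forall>p\<in>config f a b. vanishes_at g p"
    then have "eval_at g (config_vec f a b k) = 0" for k
      by (cases k) (simp add: config_def vanishes_at_span)
    then show "g \<in> perp quartic"
      unfolding perp_def by (auto intro: apolar_act_power_sum[OF quartic_decomposition[OF adm] g(1)])
  qed
  then show ?thesis
    by (auto simp: apolar_set_def config_def config_vec_nonzero[OF adm])
qed

text \<open>A vector \<open>u\<close> of square 1 is the image of \<open>axis i 1\<close> or of its negative under the reflection in the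
  difference of the two vectors, provided that this difference is not isotropic. The sign \<open>\<eta>\<close> is chosen
  accordingly, and the images of the remaining coordinate vectors complete the basis.\<close>

lemma ex_orthonormal_through:
  fixes u :: "complex ^ 'n::finite"
  assumes u: "bdot u u = 1"
  obtains f where "orthonormal f" "f i = u"
proof -
  define \<eta> :: complex where "\<eta> = (if u $ i = 1 then -1 else 1)"
  have \<eta>: "\<eta> * \<eta> = 1" "\<eta> * u $ i \<noteq> 1" by (auto simp: \<eta>_def)
  define r where "r = u - \<eta> *s axis i 1"
  have bii: "bdot (axis j 1) (axis k 1) = (if j = k then 1 else (0::complex))" for j k :: 'n
    by (simp add: bdot_axis_left) (simp add: axis_def)
  have ru: "bdot r u = 1 - \<eta> * u $ i"
    by (simp add: r_def bdot_diff_left bdot_scale_left bdot_axis_left u)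
  have rr: "bdot r r = 2 * (1 - \<eta> * u $ i)"
    using \<eta>(1) by (simp add: r_def bdot_diff_left bdot_diff_right bdot_scale_left bdot_scale_right
        bdot_axis_left bdot_axis_right u algebra_simps)
  define c where "c = 2 / bdot r r"
  have "bdot r r \<noteq> 0" using \<eta>(2) by (simp add: rr)
  then have c: "c * bdot r r = 2" by (simp add: c_def)
  define refl where "refl x = x - (c * bdot r x) *s r" for x
  have iso: "bdot (refl x) (refl y) = bdot x y" for x y
  proof -
    have "bdot (refl x) (refl y) = bdot x y - 2 * (c * bdot r x * bdot r y)
        + (c * bdot r r) * (c * bdot r x * bdot r y)"
      by (simp add: refl_def bdot_diff_left bdot_diff_right bdot_scale_left bdot_scale_right
          bdot_commute[of x r] algebra_simps)
    then show ?thesis by (simp add: c)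
  qed
  have ri: "bdot r (\<eta> *s axis i 1) = - (1 - \<eta> * u $ i)"
    using \<eta>(1) by (simp add: r_def bdot_diff_left bdot_scale_left bdot_scale_right
        bdot_axis_left bdot_axis_right algebra_simps)
  have "2 * (c * (1 - \<eta> * u $ i)) = 2 * 1"
    using c by (simp only: rr mult_ac mult_1_left)
  then have cu: "c * (1 - \<eta> * u $ i) = 1"
    by (metis mult_cancel_left zero_neq_numeral)
  have "c * bdot r (\<eta> *s axis i 1) = -1"
    unfolding ri using cu by (simp only: mult_minus_right)
  then have "refl (\<eta> *s axis i 1) = u" by (simp add: refl_def r_def)
  moreover define f where "f j = refl ((if j = i then \<eta> else 1) *s axis j 1)" for j
  have "orthonormal f"
    by (auto simp: orthonormal_def f_def iso bdot_scale_left bdot_scale_right bii \<eta>(1))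
  ultimately show thesis using that[of f] by (simp add: f_def)
qed

text \<open>The other \<open>n - 1\<close> squares get the common value \<open>- z^2 / (n - 1)\<close>; this is where a second
  index is needed.\<close>

lemma ex_admissible_through:
  fixes u :: "complex ^ 'n::finite"
  assumes n: "CARD('n) \<ge> 2" and u: "bdot u u = 1" and z: "z \<noteq> 0" "w \<noteq> 0"
  obtains f a b where "admissible f a b" "f i = u" "a i = z" "b i = w"
proof -
  obtain f where f: "orthonormal f" "f i = u" using ex_orthonormal_through[OF u] by blast
  have N: "of_nat (CARD('n) - 1) \<noteq> (0 :: complex)" using n by (simp del: of_nat_diff)
  have zero: "(\<Sum>j\<in>UNIV. (if j = i then z else csqrt (- z\<^sup>2 / of_nat (CARD('n) - 1)))\<^sup>2) = 0" for z
  proof -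
    have "(\<Sum>j\<in>UNIV. (if j = i then z else csqrt (- z\<^sup>2 / of_nat (CARD('n) - 1)))\<^sup>2) =
        z\<^sup>2 + (\<Sum>j\<in>UNIV - {i}. - z\<^sup>2 / of_nat (CARD('n) - 1))"
      by (subst sum.remove[of UNIV i]) auto
    also have "\<dots> = 0" using N by (simp add: card_Diff_singleton del: of_nat_diff)
    finally show ?thesis .
  qed
  have "admissible f (\<lambda>j. if j = i then z else csqrt (- z\<^sup>2 / of_nat (CARD('n) - 1)))
      (\<lambda>j. if j = i then w else csqrt (- w\<^sup>2 / of_nat (CARD('n) - 1)))"
    using f z N by (auto simp: admissible_def zero simp del: of_nat_diff)
  then show thesis using f that by simp
qed

theorem waring_rank_quartic:
  assumes n: "CARD('n::finite) \<ge> 2"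
  shows "waring_rank (quartic :: 'n var mpoly) = 4 * CARD('n)"
  unfolding waring_rank_def total_degree_quartic
proof (rule Least_equality)
  define i :: 'n where "i = undefined"
  have "bdot (axis i 1 :: complex ^ 'n) (axis i 1) = 1"
    by (simp add: bdot_axis_left)
  then obtain f a b where adm: "admissible (f :: 'n \<Rightarrow> complex ^ 'n) a b"
    using ex_admissible_through[OF n _ one_neq_zero one_neq_zero] by metis
  obtain h where h: "bij_betw h {..<4 * CARD('n)} (UNIV :: ('n \<times> bool \<times> bool) set)"
    using finite_same_card_bij[of "{..<4 * CARD('n)}" "UNIV :: ('n \<times> bool \<times> bool) set"] by auto
  have "(quartic :: 'n var mpoly) =
      (\<Sum>i<4 * CARD('n). Const (weight a b (h i)) * lin (config_vec f a b (h i)) ^ 4)"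
    unfolding quartic_decomposition[OF adm] by (rule sum.reindex_bij_betw[OF h, symmetric])
  then show "\<exists>\<alpha> L. (\<forall>i<4 * CARD('n). homogeneous 1 (L i)) \<and>
      (quartic :: 'n var mpoly) = (\<Sum>i<4 * CARD('n). Const (\<alpha> i) * L i ^ 4)"
    by (intro exI[of _ "\<lambda>i. weight a b (h i)"] exI[of _ "\<lambda>i. lin (config_vec f a b (h i))"])
      (simp only: homogeneous_lin simp_thms)
  show "4 * CARD('n) \<le> r"
    if "\<exists>\<alpha> L. (\<forall>i<r. homogeneous 1 (L i)) \<and> (quartic :: 'n var mpoly) = (\<Sum>i<r. Const (\<alpha> i) * L i ^ 4)"
    for r
  proof -
    from that obtain \<alpha> L where L: "\<forall>i<r. homogeneous 1 (L i)"
      and F: "(quartic :: 'n var mpoly) = (\<Sum>i<r. Const (\<alpha> i) * L i ^ 4)" by blast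
    have "\<forall>i\<in>{..<r}. \<exists>c. L i = lin c" using L homogeneous_1_imp_lin by (metis lessThan_iff)
    then obtain c where c: "\<forall>i\<in>{..<r}. L i = lin (c i)" by (rule bchoice[THEN exE])
    have F': "(quartic :: 'n var mpoly) = (\<Sum>i<r. Const (\<alpha> i) * lin (c i) ^ 4)"
      unfolding F using c by (intro sum.cong) auto
    have "apolar_vecs (c ` {..<r})"
      unfolding apolar_vecs_def using apolar_act_power_sum[OF F'] by blast
    then have "4 * CARD('n) \<le> card {x \<in> c ` {..<r}. yc x \<noteq> 0}"
      by (rule apolar_vecs_card) simp
    also have "\<dots> \<le> card (c ` {..<r})" by (intro card_mono) auto
    also have "\<dots> \<le> r" using card_image_le[of "{..<r}" c] by simp
    finally show ?thesis .
  qed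
qed

lemma minimal_apolar_set_iff:
  assumes n: "CARD('n::finite) \<ge> 2"
  shows "minimal_apolar_set (quartic :: 'n var mpoly) X \<longleftrightarrow>
    (\<exists>f a b. admissible f a b \<and> X = config f a b)"
  unfolding minimal_apolar_set_def waring_rank_quartic[OF n]
  by (metis apolar_set_structure apolar_set_config card_config)

lemma zero_locus_singleton:
  assumes "homogeneous d g"
  shows "vec.span {x} \<in> zero_locus {g} \<longleftrightarrow> x \<noteq> 0 \<and> eval_at g x = 0"
  by (simp add: zero_locus_def vanishes_at_span[OF assms])

text \<open>A vector \<open>y\<close> of nonzero square can be scaled to square 1 and completed to an orthonormal basis,
  and nonzero values of \<open>Z1\<close> and \<open>Z2\<close> can be prescribed at one index. Conversely both conditions hold
  at every point of a configuration.\<close>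

lemma mem_waring_locus:
  fixes x :: "complex ^ 'n::finite var"
  assumes n: "CARD('n) \<ge> 2" and x: "x \<noteq> 0"
  shows "vec.span {x} \<in> waring_locus quartic \<longleftrightarrow> zc x * wc x \<noteq> 0 \<and> bdot (yc x) (yc x) \<noteq> 0"
proof
  assume "vec.span {x} \<in> waring_locus quartic"
  then obtain f a b where adm: "admissible f a b" and "vec.span {x} \<in> config f a b"
    by (auto simp: waring_locus_def minimal_apolar_set_iff[OF n])
  then obtain k where "vec.span {config_vec f a b k} = vec.span {x}" by (auto simp: config_def)
  then obtain c where c: "c \<noteq> 0" "x = c *s config_vec f a b k"
    using span_singleton_eq_iff[OF x] by blast
  then show "zc x * wc x \<noteq> 0 \<and> bdot (yc x) (yc x) \<noteq> 0"
    using adm by (cases k) (simp add: config_vec_def scale_pt bdot_scale_left bdot_scale_right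
        admissible_def orthonormal_def)
next
  assume nz: "zc x * wc x \<noteq> 0 \<and> bdot (yc x) (yc x) \<noteq> 0"
  define c where "c = 1 / csqrt (bdot (yc x) (yc x))"
  have c: "c \<noteq> 0" "c * c * bdot (yc x) (yc x) = 1"
    using nz by (simp_all add: c_def power_divide flip: power2_eq_square)
  obtain i :: 'n where True by simp
  obtain f a b where adm: "admissible f a b" and fi: "f i = c *s yc x" "a i = c * zc x" "b i = c * wc x"
    by (rule ex_admissible_through[OF n, of "c *s yc x" "c * zc x" "c * wc x" i])
      (use nz c in \<open>auto simp: bdot_scale_left bdot_scale_right mult.assoc\<close>)
  have "c *s x = config_vec f a b (i, True, True)"
    by (rule point_eqI) (simp_all add: config_vec_def fi)
  then have "vec.span {x} = vec.span {config_vec f a b (i, True, True)}"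
    using span_scale[OF c(1), of x] by simp
  then have "vec.span {x} \<in> config f a b" by (auto simp: config_def)
  with adm show "vec.span {x} \<in> waring_locus quartic"
    by (auto simp: waring_locus_def minimal_apolar_set_iff[OF n])
qed

theorem forbidden_locus_quartic:
  assumes n: "CARD('n::finite) \<ge> 2"
  shows "forbidden_locus (quartic :: 'n var mpoly) =
    zero_locus {X1 ^ 2 + X2 ^ 2} \<union> zero_locus {\<Sum>i\<in>UNIV. Y i ^ 2}"
proof -
  have h: "homogeneous (2 * Suc 0) (X1 ^ 2 + X2 ^ 2 :: 'n var mpoly)"
    "homogeneous (2 * Suc 0) (\<Sum>i\<in>UNIV. Y i ^ 2 :: 'n var mpoly)"
    by (intro homogeneous_add homogeneous_sum homogeneous_power homogeneous_Var)+
  have e1: "eval_at (X1 ^ 2 + X2 ^ 2) x = zc x * wc x" for x :: "complex ^ 'n var"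
    by (simp add: eval_at_mult flip: Z1_Z2)
  have e2: "eval_at (\<Sum>i\<in>UNIV. Y i ^ 2) x = bdot (yc x) (yc x)" for x :: "complex ^ 'n var"
    by (simp add: eval_at_simps bdot_def yc_def power2_eq_square)
  have "p \<in> forbidden_locus (quartic :: 'n var mpoly) \<longleftrightarrow>
    p \<in> zero_locus {X1 ^ 2 + X2 ^ 2} \<union> zero_locus {\<Sum>i\<in>UNIV. Y i ^ 2}" for p
  proof (cases "p \<in> proj_space")
    case True
    then obtain x where "x \<noteq> 0" "p = vec.span {x}" by (rule proj_spaceE)
    then show ?thesis
      using mem_waring_locus[OF n, of x]
      by (auto simp: forbidden_locus_def zero_locus_singleton[OF h(1)] zero_locus_singleton[OF h(2)]
          e1 e2)
  qed (auto simp: forbidden_locus_def zero_locus_def)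
  then show ?thesis by blast
qed


section \<open>The ideal of a minimal apolar set\<close>

lemma ideal_gen_base: "g \<in> B \<Longrightarrow> g \<in> ideal_gen B"
  unfolding ideal_gen_def by (rule module.span_base[OF module_mpoly])

lemma ideal_gen_0: "0 \<in> ideal_gen B"
  unfolding ideal_gen_def by (rule module.span_zero[OF module_mpoly])

lemma ideal_gen_add: "g \<in> ideal_gen B \<Longrightarrow> h \<in> ideal_gen B \<Longrightarrow> g + h \<in> ideal_gen B"
  unfolding ideal_gen_def by (rule module.span_add[OF module_mpoly])

lemma ideal_gen_mult: "g \<in> ideal_gen B \<Longrightarrow> h * g \<in> ideal_gen B"
  unfolding ideal_gen_def by (rule module.span_scale[OF module_mpoly])

lemma ideal_gen_subsetI: "B \<subseteq> ideal_gen C \<Longrightarrow> ideal_gen B \<subseteq> ideal_gen C"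
  unfolding ideal_gen_def
  by (rule module.span_minimal[OF module_mpoly _ module.subspace_span[OF module_mpoly]])

lemma eval_at_ideal_gen:
  assumes "g \<in> ideal_gen B" and B: "\<And>h. h \<in> B \<Longrightarrow> eval_at h x = 0"
  shows "eval_at g x = 0"
proof -
  have "module.subspace (*) {h. eval_at h x = 0}"
    unfolding module.subspace_def[OF module_mpoly] by (simp add: eval_at_simps)
  from module.span_minimal[OF module_mpoly _ this, of B] assms show ?thesis
    unfolding ideal_gen_def by auto
qed

definition config_quadrics :: "('n::{finite,linorder} \<Rightarrow> complex) \<Rightarrow> ('n \<Rightarrow> complex) \<Rightarrow> 'n var mpoly set" where
  "config_quadrics \<alpha> \<beta> = {Y i * Y j | i j. i < j} \<union>
     {Z1 ^ 2 + (\<Sum>i\<in>UNIV - {fst_idx}. Const (\<alpha> i) * (Y fst_idx ^ 2 - Y i ^ 2)),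
      Z2 ^ 2 + (\<Sum>i\<in>UNIV - {fst_idx}. Const (\<beta> i) * (Y fst_idx ^ 2 - Y i ^ 2))}"

text \<open>Since the coefficients add up to zero, the distinguished index can be treated like the
  others.\<close>

lemma config_quadric_eq:
  fixes \<alpha> :: "'n::{finite,linorder} \<Rightarrow> complex"
  assumes "(\<Sum>i\<in>UNIV. \<alpha> i) = 0"
  shows "p + (\<Sum>i\<in>UNIV - {fst_idx}. Const (\<alpha> i) * (Y fst_idx ^ 2 - Y i ^ 2)) =
    p - (\<Sum>i\<in>UNIV. Const (\<alpha> i) * Y i ^ 2)"
proof -
  have "(\<Sum>i\<in>UNIV - {fst_idx}. \<alpha> i) = - \<alpha> fst_idx"
    using assms by (simp add: sum.remove[of UNIV fst_idx] eq_neg_iff_add_eq_0 add.commute)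
  then have "(\<Sum>i\<in>UNIV - {fst_idx}. Const (\<alpha> i) * Y fst_idx ^ 2) =
      (- Const (\<alpha> fst_idx) * Y fst_idx ^ 2 :: 'n var mpoly)"
    by (simp add: Const_uminus flip: sum_distrib_right Const_sum)
  then show ?thesis
    by (simp add: right_diff_distrib sum_subtractf sum.remove[of UNIV fst_idx "\<lambda>i. Const (\<alpha> i) * Y i ^ 2"])
qed

definition bn :: "bool \<Rightarrow> nat" where
  "bn e = (if e then 1 else 0)"

lemma bn_simps [simp]: "bn True = 1" "bn False = 0"
  by (simp_all add: bn_def)

text \<open>Modulo the quadrics every form of degree \<open>d\<close> is a combination of the monomials
  \<open>Y i ^ (d - e - e') * Z1 ^ e * Z2 ^ e'\<close> with \<open>e, e' \<le> 1\<close>. If the exponent of \<open>Y i\<close> is 0, this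
  monomial is listed once for each \<open>i\<close>.\<close>

definition normal_monom :: "nat \<Rightarrow> 'n \<times> bool \<times> bool \<Rightarrow> 'n::finite var mpoly" where
  "normal_monom d k = (case k of (i, e, e') \<Rightarrow>
     if bn e + bn e' \<le> d then Y i ^ (d - (bn e + bn e')) * (Z1 ^ bn e * Z2 ^ bn e') else 0)"

definition reducible :: "'n::finite var mpoly set \<Rightarrow> nat \<Rightarrow> 'n var mpoly \<Rightarrow> bool" where
  "reducible J d g \<longleftrightarrow> (\<exists>c. g - (\<Sum>k\<in>UNIV. Const (c k) * normal_monom d k) \<in> J)"

context
  fixes \<alpha> \<beta> :: "'n::{finite,linorder} \<Rightarrow> complex" and J :: "'n var mpoly set"
  defines "J \<equiv> ideal_gen (config_quadrics \<alpha> \<beta>)"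
begin

lemma reducible_add:
  assumes "reducible J d g" "reducible J d h"
  shows "reducible J d (g + h)"
proof -
  from assms obtain c c' where "g - (\<Sum>k\<in>UNIV. Const (c k) * normal_monom d k) \<in> J"
    "h - (\<Sum>k\<in>UNIV. Const (c' k) * normal_monom d k) \<in> J" by (auto simp: reducible_def)
  from ideal_gen_add[OF this[unfolded J_def]] show ?thesis
    unfolding reducible_def
    by (intro exI[of _ "\<lambda>k. c k + c' k"])
      (simp add: Const_add distrib_right sum.distrib J_def algebra_simps)
qed

lemma reducible_Const_mult:
  assumes "reducible J d g"
  shows "reducible J d (Const r * g)"
proof -
  from assms obtain c where "g - (\<Sum>k\<in>UNIV. Const (c k) * normal_monom d k) \<in> J"
    by (auto simp: reducible_def)
  from ideal_gen_mult[OF this[unfolded J_def], of "Const r"] show ?thesis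
    unfolding reducible_def
    by (intro exI[of _ "\<lambda>k. r * c k"])
      (simp add: Const_mult right_diff_distrib sum_distrib_left J_def mult.assoc)
qed

lemma reducible_ideal: "g \<in> J \<Longrightarrow> reducible J d g"
  unfolding reducible_def by (intro exI[of _ "\<lambda>_. 0"]) simp

lemma reducible_0: "reducible J d 0"
  by (rule reducible_ideal) (simp add: J_def ideal_gen_0)

lemma reducible_cong: "g - h \<in> J \<Longrightarrow> reducible J d h \<Longrightarrow> reducible J d g"
  using reducible_add[OF reducible_ideal[of "g - h" d], of h] by simp

lemma reducible_sum: "(\<And>i. i \<in> A \<Longrightarrow> reducible J d (f i)) \<Longrightarrow> reducible J d (sum f A)"
  by (induction A rule: infinite_finite_induct) (simp_all add: reducible_0 reducible_add)

lemma reducible_normal_monom: "reducible J d (normal_monom d k)"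
proof -
  have "Const (if l = k then 1 else 0) * normal_monom d l = (if l = k then normal_monom d l else 0)" for l
    by simp
  then have "(\<Sum>l\<in>UNIV. Const (if l = k then 1 else 0) * normal_monom d l) = normal_monom d k"
    by (simp del: Const_0)
  then show ?thesis
    unfolding reducible_def J_def
    by (intro exI[of _ "\<lambda>l. if l = k then 1 else 0"]) (simp add: ideal_gen_0)
qed

lemma reducible_mult:
  assumes g: "reducible J d g" and l: "\<And>k. reducible J (Suc d) (l * normal_monom d k)"
  shows "reducible J (Suc d) (l * g)"
proof -
  from g obtain c where c: "g - (\<Sum>k\<in>UNIV. Const (c k) * normal_monom d k) \<in> J"
    by (auto simp: reducible_def)
  have "l * g - (\<Sum>k\<in>UNIV. Const (c k) * (l * normal_monom d k)) \<in> J"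
    using ideal_gen_mult[OF c[unfolded J_def], of l]
    by (simp add: J_def right_diff_distrib sum_distrib_left mult_ac)
  then show ?thesis
    by (rule reducible_cong) (intro reducible_sum reducible_Const_mult l)
qed

lemma YY_in_ideal:
  assumes "i \<noteq> j"
  shows "Y i * Y j * h \<in> J"
proof -
  have "Y i * Y j \<in> config_quadrics \<alpha> \<beta>"
    using assms unfolding config_quadrics_def by (cases i j rule: linorder_cases) (auto simp: mult.commute)
  from ideal_gen_mult[OF ideal_gen_base[OF this], of h] show ?thesis
    by (simp add: J_def mult_ac)
qed

lemma reducible_Y_mult: "reducible J (Suc d) (Y j * normal_monom d k)"
proof -
  obtain i e e' where k: "k = (i, e, e')" by (cases k)
  show ?thesis
  proof (cases "bn e + bn e' \<le> d")
    case True
    then obtain r where r: "d = r + (bn e + bn e')" using le_Suc_ex by (metis add.commute)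
    show ?thesis
    proof (cases "i = j \<or> r = 0")
      case True
      have "Suc r + (bn e + bn e') = Suc d" by (simp add: r)
      then have "Y j * normal_monom d k = normal_monom (Suc d) (j, e, e')"
        using True by (auto simp: k normal_monom_def r Suc_diff_le mult.assoc)
      then show ?thesis by (simp add: reducible_normal_monom)
    next
      case False
      then obtain r' where "r = Suc r'" by (cases r) auto
      then have "Y j * normal_monom d k = Y i * Y j * (Y i ^ r' * (Z1 ^ bn e * Z2 ^ bn e'))"
        by (simp add: k normal_monom_def r mult_ac)
      then show ?thesis using False by (simp add: reducible_ideal YY_in_ideal)
    qed
  qed (simp add: k normal_monom_def reducible_0)
qed

lemma reducible_YY_power:
  assumes "e = e0 \<and> e' = e0' \<and> D = r + 2 + (bn e + bn e')"
  shows "reducible J D (Y l ^ 2 * (Y i ^ r * (Z1 ^ bn e * Z2 ^ bn e')))"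
proof (cases "l = i \<or> r = 0")
  case True
  then have "Y l ^ 2 * (Y i ^ r * (Z1 ^ bn e * Z2 ^ bn e')) = normal_monom D (l, e, e')"
    using assms by (auto simp: normal_monom_def power2_eq_square mult.assoc)
  then show ?thesis by (simp add: reducible_normal_monom)
next
  case False
  then obtain r' where "r = Suc r'" by (cases r) auto
  then have "Y l ^ 2 * (Y i ^ r * (Z1 ^ bn e * Z2 ^ bn e')) =
      Y l * Y i * (Y l * (Y i ^ r' * (Z1 ^ bn e * Z2 ^ bn e')))"
    by (simp add: power2_eq_square mult_ac)
  then show ?thesis using False by (simp add: reducible_ideal YY_in_ideal)
qed

lemma reducible_Z_square:
  assumes "Z ^ 2 - (\<Sum>l\<in>UNIV. Const (\<gamma> l) * Y l ^ 2) \<in> J"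
    and D: "D = r + 2 + (bn e + bn e')"
  shows "reducible J D (Z ^ 2 * (Y i ^ r * (Z1 ^ bn e * Z2 ^ bn e')))"
proof -
  let ?h = "Y i ^ r * (Z1 ^ bn e * Z2 ^ bn e')"
  have "Z ^ 2 * ?h - (\<Sum>l\<in>UNIV. Const (\<gamma> l) * (Y l ^ 2 * ?h)) \<in> J"
    using ideal_gen_mult[OF assms(1)[unfolded J_def], of ?h]
    by (simp add: J_def right_diff_distrib sum_distrib_left mult_ac)
  then show ?thesis
    by (rule reducible_cong)
      (intro reducible_sum reducible_Const_mult reducible_YY_power[OF conjI[OF refl conjI[OF refl D]]])
qed

context
  assumes sums: "(\<Sum>i\<in>UNIV. \<alpha> i) = 0" "(\<Sum>i\<in>UNIV. \<beta> i) = 0"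
begin

lemma Z_squares_in_ideal:
  "Z1 ^ 2 - (\<Sum>i\<in>UNIV. Const (\<alpha> i) * Y i ^ 2) \<in> J"
  "Z2 ^ 2 - (\<Sum>i\<in>UNIV. Const (\<beta> i) * Y i ^ 2) \<in> J"
  unfolding J_def config_quadrics_def config_quadric_eq[OF sums(1)] config_quadric_eq[OF sums(2)]
  by (rule ideal_gen_base, simp)+

lemma reducible_Z1_mult: "reducible J (Suc d) (Z1 * normal_monom d k)"
proof -
  obtain i e e' where k: "k = (i, e, e')" by (cases k)
  show ?thesis
  proof (cases "bn e + bn e' \<le> d")
    case True
    then obtain r where r: "d = r + (bn e + bn e')" using le_Suc_ex by (metis add.commute)
    show ?thesis
    proof (cases e)
      case True
      have "Z1 * normal_monom d k = Z1 ^ 2 * (Y i ^ r * (Z1 ^ bn False * Z2 ^ bn e'))"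
        using True by (simp add: k r normal_monom_def power2_eq_square mult_ac)
      then show ?thesis
        using reducible_Z_square[OF Z_squares_in_ideal(1), of "Suc d" r False e'] True
        by (simp add: r)
    next
      case False
      then have "Z1 * normal_monom d k = normal_monom (Suc d) (i, True, e')"
        by (simp add: k r normal_monom_def mult_ac)
      then show ?thesis by (simp add: reducible_normal_monom)
    qed
  qed (simp add: k normal_monom_def reducible_0)
qed

lemma reducible_Z2_mult: "reducible J (Suc d) (Z2 * normal_monom d k)"
proof -
  obtain i e e' where k: "k = (i, e, e')" by (cases k)
  show ?thesis
  proof (cases "bn e + bn e' \<le> d")
    case True
    then obtain r where r: "d = r + (bn e + bn e')" using le_Suc_ex by (metis add.commute)
    show ?thesis
    proof (cases e')
      case True
      have "Z2 * normal_monom d k = Z2 ^ 2 * (Y i ^ r * (Z1 ^ bn e * Z2 ^ bn False))"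
        using True by (simp add: k r normal_monom_def power2_eq_square mult_ac)
      then show ?thesis
        using reducible_Z_square[OF Z_squares_in_ideal(2), of "Suc d" r e False] True
        by (simp add: r)
    next
      case False
      then have "Z2 * normal_monom d k = normal_monom (Suc d) (i, e, True)"
        by (simp add: k r normal_monom_def mult_ac)
      then show ?thesis by (simp add: reducible_normal_monom)
    qed
  qed (simp add: k normal_monom_def reducible_0)
qed

lemma homogeneous_reducible:
  assumes "homogeneous d g"
  shows "reducible J d g"
  using assms
proof (induction rule: homogeneous_induct)
  case (Const c)
  have "Const c = Const c * normal_monom 0 (undefined, False, False)"
    by (simp add: normal_monom_def)
  then show ?case by (metis reducible_Const_mult reducible_normal_monom)
next
  case (mult d p v)
  have Z: "reducible J (Suc d) (Z1 * p)" "reducible J (Suc d) (Z2 * p)"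
    by (rule reducible_mult[OF mult]; rule reducible_Z1_mult reducible_Z2_mult)+
  have half: "Const (1/2) + Const (1/2) = (1 :: 'n var mpoly)"
    by (simp flip: Const_add)
  have ii: "Const (\<i>/2) = Const (1/2) * (Const \<i> :: 'n var mpoly)"
    by (simp flip: Const_mult)
  show ?case
  proof (cases v)
    case VX1
    have "Const (1/2) * (Z1 * p) + Const (1/2) * (Z2 * p) = (Const (1/2) + Const (1/2)) * X1 * p"
      by (simp add: Z1_def Z2_def algebra_simps)
    also have "\<dots> = X1 * p" by (simp only: half) simp
    finally have "X1 * p = Const (1/2) * (Z1 * p) + Const (1/2) * (Z2 * p)" ..
    then show ?thesis using VX1 Z by (simp add: reducible_add reducible_Const_mult)
  next
    case VX2
    have "Const (\<i>/2) * (Z1 * p) + Const (- (\<i>/2)) * (Z2 * p) =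
        - (Const (1/2) + Const (1/2)) * (Const \<i> * Const \<i>) * X2 * p"
      by (simp only: Const_uminus ii Z1_def Z2_def) (simp add: algebra_simps)
    also have "\<dots> = X2 * p" by (simp only: half Const_ii_square) simp
    finally have "X2 * p = Const (\<i>/2) * (Z1 * p) + Const (- (\<i>/2)) * (Z2 * p)" ..
    then show ?thesis using VX2 Z by (simp only: reducible_add reducible_Const_mult)
  next
    case (VY j)
    then show ?thesis using reducible_mult[OF mult] reducible_Y_mult by simp
  qed
qed (simp_all add: reducible_0 reducible_add)

end

end

text \<open>A normal form vanishing at the four points over each coordinate vector is zero: comparing the
  four choices of signs separates the parts multiplied by 1, \<open>Z1\<close>, \<open>Z2\<close> and \<open>Z1 Z2\<close>, and
  the points with different \<open>i\<close> separate the powers of different \<open>Y i\<close>.\<close>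

lemma normal_form_vanishing:
  fixes c :: "'n::finite \<times> bool \<times> bool \<Rightarrow> complex"
  assumes nz: "\<And>i. a i \<noteq> 0" "\<And>i. b i \<noteq> 0"
    and van: "\<And>k. eval_at (\<Sum>k\<in>UNIV. Const (c k) * normal_monom d k)
      (config_vec (\<lambda>i. axis i 1) a b k) = 0"
  shows "(\<Sum>k\<in>UNIV. Const (c k) * normal_monom d k) = 0"
proof -
  define S where "S e e' = (\<Sum>j\<in>UNIV. Const (c (j, e, e')) * normal_monom d (j, e, e'))" for e e'
  define T where "T e e' i = (if bn e + bn e' \<le> d
    then \<Sum>j\<in>UNIV. c (j, e, e') * (axis i 1 $ j) ^ (d - (bn e + bn e')) else 0)" for e e' i
  have split: "(\<Sum>k\<in>UNIV. Const (c k) * normal_monom d k) =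
      S False False + S False True + S True False + S True True"
    by (simp add: sum_signs S_def sum.distrib)
  have evS: "eval_at (S e e') (config_vec (\<lambda>i. axis i 1) a b (i, s, s')) =
      T e e' i * ((sg s * a i) ^ bn e * (sg s' * b i) ^ bn e')" for e e' i s s'
  proof -
    have Y: "(config_vec (\<lambda>i. axis i 1) a b (i, s, s')) $ VY j = axis i 1 $ j" for j
      by (simp add: config_vec_def pt_def)
    have Z: "zc (config_vec (\<lambda>i. axis i 1) a b (i, s, s')) = sg s * a i"
      "wc (config_vec (\<lambda>i. axis i 1) a b (i, s, s')) = sg s' * b i"
      by (simp_all add: config_vec_def)
    show ?thesis
      by (simp add: S_def T_def normal_monom_def eval_at_simps Y Z sum_distrib_right mult.assoc)
  qed
  have T0: "T e e' i = 0" for e e' i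
  proof -
    have lin4: "p = 0 \<and> q = 0 \<and> r = 0 \<and> s = 0"
      if "p + q + r + s = 0" "p - q + r - s = 0" "p + q - r - s = 0" "p - q - r + s = 0"
      for p q r s :: complex
    proof -
      have "4 * p = (p + q + r + s) + (p - q + r - s) + (p + q - r - s) + (p - q - r + s)"
        "4 * q = (p + q + r + s) - (p - q + r - s) + (p + q - r - s) - (p - q - r + s)"
        "4 * r = (p + q + r + s) + (p - q + r - s) - (p + q - r - s) - (p - q - r + s)"
        "4 * s = (p + q + r + s) - (p - q + r - s) - (p + q - r - s) + (p - q - r + s)"
        by simp_all
      then show ?thesis unfolding that by simp
    qed
    have eq: "T False False i + T False True i * (sg s' * b i) + T True False i * (sg s * a i) +
        T True True i * ((sg s * a i) * (sg s' * b i)) = 0" for s s'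
      using van[of "(i, s, s')"] by (simp add: split eval_at_add evS)
    have "T False False i = 0 \<and> T False True i * b i = 0 \<and> T True False i * a i = 0 \<and>
        T True True i * (a i * b i) = 0"
      by (rule lin4) (use eq[of True True] eq[of False True] eq[of True False] eq[of False False]
        in simp_all)
    with nz show ?thesis by (cases e; cases e') auto
  qed
  have "S e e' = 0" for e e'
  proof (cases "bn e + bn e' < d")
    case True
    have "c (i, e, e') = T e e' i" for i
    proof -
      have "c (j, e, e') * axis i 1 $ j ^ (d - (bn e + bn e')) = (if j = i then c (j, e, e') else 0)" for j
        using True by (simp add: axis_def)
      then show ?thesis using True by (simp add: T_def)
    qed
    then show ?thesis by (simp add: S_def T0)
  next
    case False
    show ?thesis
    proof (cases "bn e + bn e' = d")
      case True
      then have "S e e' = Const (T e e' undefined) * (Z1 ^ bn e * Z2 ^ bn e')"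
        by (simp add: S_def T_def normal_monom_def Const_sum sum_distrib_right)
      then show ?thesis by (simp add: T0)
    next
      case neq: False
      then show ?thesis using False by (simp add: S_def normal_monom_def)
    qed
  qed
  then show ?thesis by (simp add: split)
qed

text \<open>A form vanishing on the points differs from its normal form by an element of the ideal of
  quadrics, which also vanishes on the points; hence so does the normal form, which must be zero.\<close>

theorem vanishing_ideal_config_axis:
  fixes a b :: "'n::{finite,linorder} \<Rightarrow> complex"
  assumes adm: "admissible (\<lambda>i. axis i 1) a b"
  shows "vanishing_ideal (config (\<lambda>i. axis i 1) a b) = ideal_gen (config_quadrics (\<lambda>i. a i ^ 2) (\<lambda>i. b i ^ 2))"
proof -
  let ?C = "config_quadrics (\<lambda>i. a i ^ 2) (\<lambda>i. b i ^ 2)"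
  have nz: "a i \<noteq> 0" "b i \<noteq> 0" and sums: "(\<Sum>i\<in>UNIV. a i ^ 2) = 0" "(\<Sum>i\<in>UNIV. b i ^ 2) = 0" for i
    using adm by (auto simp: admissible_def)
  have van: "eval_at g (config_vec (\<lambda>i. axis i 1) a b k) = 0" if "g \<in> ?C" for g k
  proof -
    obtain i e e' where k: "k = (i, e, e')" by (cases k)
    have Y: "(config_vec (\<lambda>i. axis i 1) a b k) $ VY j = (if j = i then 1 else 0)" for j
      by (simp add: k config_vec_def pt_def axis_def)
    have Z: "zc (config_vec (\<lambda>i. axis i 1) a b k) = sg e * a i"
      "wc (config_vec (\<lambda>i. axis i 1) a b k) = sg e' * b i"
      by (simp_all add: k config_vec_def)
    have sq: "(\<Sum>j\<in>UNIV. \<gamma> j * (if j = i then 1 else 0)\<^sup>2) = \<gamma> i" for \<gamma> :: "'n \<Rightarrow> complex"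
    proof -
      have "\<gamma> j * (if j = i then 1 else 0)\<^sup>2 = (if j = i then \<gamma> j else 0)" for j by simp
      then show ?thesis by simp
    qed
    show ?thesis
      using that unfolding config_quadrics_def config_quadric_eq[OF sums(1)] config_quadric_eq[OF sums(2)]
      by (auto simp: eval_at_simps Y Z sq power_mult_distrib)
  qed
  have hom: "\<exists>d. homogeneous d g" if "g \<in> ?C" for g
  proof (intro exI)
    show "homogeneous (2 * Suc 0) g"
      using that unfolding config_quadrics_def
      by (auto intro!: homogeneous_mult1 homogeneous_add homogeneous_diff homogeneous_sum
          homogeneous_Const_mult homogeneous_power[where d = "Suc 0", simplified] simp: numeral_2_eq_2)
  qed
  show ?thesis
  proof
    show "vanishing_ideal (config (\<lambda>i. axis i 1) a b) \<subseteq> ideal_gen ?C"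
      unfolding vanishing_ideal_def
    proof (rule ideal_gen_subsetI, safe)
      fix g d assume g: "homogeneous d g" "\<forall>p\<in>config (\<lambda>i. axis i 1) a b. vanishes_at g p"
      have g0: "eval_at g (config_vec (\<lambda>i. axis i 1) a b k) = 0" for k
        using g by (cases k) (simp add: config_def vanishes_at_span)
      obtain c where c: "g - (\<Sum>k\<in>UNIV. Const (c k) * normal_monom d k) \<in> ideal_gen ?C"
        using homogeneous_reducible[OF sums g(1)] by (auto simp: reducible_def)
      have "(\<Sum>k\<in>UNIV. Const (c k) * normal_monom d k) = 0"
      proof (rule normal_form_vanishing[where a = a and b = b, OF nz])
        fix k
        have "eval_at (g - (\<Sum>k\<in>UNIV. Const (c k) * normal_monom d k))
            (config_vec (\<lambda>i. axis i 1) a b k) = 0"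
          by (rule eval_at_ideal_gen[OF c van])
        then show "eval_at (\<Sum>k\<in>UNIV. Const (c k) * normal_monom d k)
            (config_vec (\<lambda>i. axis i 1) a b k) = 0"
          by (simp add: eval_at_diff g0)
      qed
      with c show "g \<in> ideal_gen ?C" by simp
    qed
    show "ideal_gen ?C \<subseteq> vanishing_ideal (config (\<lambda>i. axis i 1) a b)"
      unfolding vanishing_ideal_def
    proof (rule ideal_gen_subsetI, rule subsetI, rule ideal_gen_base)
      fix g assume "g \<in> ?C"
      with hom van show "g \<in> {g. (\<exists>d. homogeneous d g) \<and>
          (\<forall>p\<in>config (\<lambda>i. axis i 1) a b. vanishes_at g p)}"
        by (auto simp: config_def) (metis vanishes_at_span)
    qed
  qed
qed

lemma image_span_singleton:
  assumes "\<And>c x. h (c *s x) = c *s h x"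
  shows "h ` vec.span {x} = vec.span {h x}"
  by (simp add: vec.span_singleton image_image assms)

lemma act_y_pt: "act_y \<sigma> (pt z w y) = pt z w (\<sigma> *v y)"
  by (simp add: act_y_def pt_def vec_eq_iff split: var.split)

lemma act_y_point_span: "act_y_point \<sigma> (vec.span {x}) = vec.span {act_y \<sigma> x}"
  unfolding act_y_point_def
proof (rule image_span_singleton)
  fix c x
  have "act_y \<sigma> (c *s pt z w y) = c *s act_y \<sigma> (pt z w y)" for z w y
    by (simp add: act_y_pt scale_pt vec.scale)
  from this[of "zc x" "wc x" "yc x"] show "act_y \<sigma> (c *s x) = c *s act_y \<sigma> x" by simp
qed

lemma act_y_config:
  assumes "orthonormal f"
  shows "act_y_point (\<chi> i. f i) ` config f a b = config (\<lambda>i. axis i 1) a b"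
proof -
  have "(\<chi> i. f i) *v f j = axis j 1" for j
    using assms by (auto simp: matrix_vector_mult_def orthonormal_def bdot_def vec_eq_iff axis_def)
  then have "act_y (\<chi> i. f i) (config_vec f a b k) = config_vec (\<lambda>i. axis i 1) a b k" for k
    by (cases k) (simp add: config_vec_def act_y_pt)
  then show ?thesis by (simp add: config_def image_image act_y_point_span)
qed

lemma admissible_axis:
  assumes "admissible f a b"
  shows "admissible (\<lambda>i. axis i 1) a b"
  using assms by (simp add: admissible_def orthonormal_def bdot_axis_left) (simp add: axis_def)

text \<open>The matrix with rows \<open>f i\<close> moves the configuration to the coordinate vectors, and the
  coefficients of the quadrics are the squares of the \<open>a i\<close> and \<open>b i\<close>. Their sums over all
  indices but the first are nonzero, being the negatives of the first ones.\<close>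

theorem vanishing_ideal_config:
  fixes f :: "'n::{finite,linorder} \<Rightarrow> (complex, 'n) vec"
  assumes adm: "admissible f a b"
  shows "\<exists>\<sigma> \<alpha> \<beta>. orthogonal_matrix \<sigma> \<and> (\<forall>i. i \<noteq> fst_idx \<longrightarrow> \<alpha> i \<noteq> 0 \<and> \<beta> i \<noteq> 0) \<and>
    (\<Sum>i\<in>UNIV - {fst_idx}. \<alpha> i) \<noteq> 0 \<and> (\<Sum>i\<in>UNIV - {fst_idx}. \<beta> i) \<noteq> 0 \<and>
    vanishing_ideal (act_y_point \<sigma> ` config f a b) = ideal_gen (config_quadrics \<alpha> \<beta>)"
proof (intro exI conjI)
  have f: "orthonormal f" and nz: "a i \<noteq> 0" "b i \<noteq> 0"
    and sums: "(\<Sum>i\<in>UNIV. a i ^ 2) = 0" "(\<Sum>i\<in>UNIV. b i ^ 2) = 0" for i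
    using adm by (auto simp: admissible_def)
  show "orthogonal_matrix (\<chi> i. f i)" by (rule orthonormal_columns(2)[OF f])
  show "vanishing_ideal (act_y_point (\<chi> i. f i) ` config f a b) =
      ideal_gen (config_quadrics (\<lambda>i. a i ^ 2) (\<lambda>i. b i ^ 2))"
    unfolding act_y_config[OF f] by (rule vanishing_ideal_config_axis[OF admissible_axis[OF adm]])
  show "(\<Sum>i\<in>UNIV - {fst_idx}. a i ^ 2) \<noteq> 0" "(\<Sum>i\<in>UNIV - {fst_idx}. b i ^ 2) \<noteq> 0"
    using sums nz[of fst_idx] by (auto simp: sum.remove[of UNIV fst_idx])
  show "\<forall>i. i \<noteq> fst_idx \<longrightarrow> a i ^ 2 \<noteq> 0 \<and> b i ^ 2 \<noteq> 0" using nz by simp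
qed


section \<open>Hilbert functions\<close>

text \<open>Imposing the conditions one after the other, each lowers the dimension by exactly one: \<open>p i\<close>
  satisfies the conditions imposed before and spans a complement of the kernel of \<open>l i\<close>.\<close>

lemma cdim_linear_conditions:
  fixes l :: "'i \<Rightarrow> 'v mpoly \<Rightarrow> complex"
  assumes H: "module.subspace (\<lambda>c p. Const c * p) H" "finite G" "H \<subseteq> module.span (\<lambda>c p. Const c * p) G"
    and l: "\<And>i p q. l i (p + q) = l i p + l i q" "\<And>i c p. l i (Const c * p) = c * l i p"
    and I: "finite I" "\<And>i. i \<in> I \<Longrightarrow> p i \<in> H" "\<And>i j. i \<in> I \<Longrightarrow> j \<in> I \<Longrightarrow> l i (p j) = (if i = j then 1 else 0)"
  shows "cdim H = cdim {h \<in> H. \<forall>i\<in>I. l i h = 0} + card I"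
proof -
  interpret vs: vector_space "\<lambda>c (p :: 'v mpoly). Const c * p" by (rule vector_space_mpoly)
  have l0: "l i 0 = 0" for i using l(2)[of i 0 0] by simp
  have "J \<subseteq> I \<Longrightarrow> vs.dim H = vs.dim {h \<in> H. \<forall>i\<in>J. l i h = 0} + card J" if "finite J" for J
    using that
  proof (induction J)
    case (insert i J)
    define K K' where "K = {h \<in> H. \<forall>i\<in>J. l i h = 0}" and "K' = {h \<in> H. \<forall>i\<in>insert i J. l i h = 0}"
    obtain B where B: "B \<subseteq> K'" "vs.independent B" "K' \<subseteq> vs.span B" "card B = vs.dim K'"
      using vs.basis_exists[of K'] by blast
    have sub: "vs.subspace K'"
      using H(1) by (auto simp: K'_def vs.subspace_def l l0)
    have spanB: "vs.span B = K'"
      using B sub by (metis subset_antisym vs.span_minimal)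
    have "B \<subseteq> vs.span G" using B(1) H(3) by (auto simp: K'_def)
    then have finB: "finite B" using vs.independent_span_bound[OF H(2) B(2)] by simp
    have pi: "p i \<in> K" "l i (p i) = 1"
      using insert I(2,3) by (auto simp: K_def)
    then have notin: "p i \<notin> vs.span B" unfolding spanB by (auto simp: K'_def)
    then have ind: "vs.independent (insert (p i) B)"
      using B(2) by (simp add: vs.independent_insert)
    have "K \<subseteq> vs.span (insert (p i) B)"
    proof
      fix h assume h: "h \<in> K"
      define h' where "h' = h + Const (- l i h) * p i"
      have "h' \<in> H"
        unfolding h'_def using H(1) h pi(1)
        by (intro vs.subspace_add vs.subspace_scale) (auto simp: K_def)
      moreover have "l j h' = l j h + - l i h * l j (p i)" for j
        by (simp only: h'_def l)
      then have "l j h' = 0" if "j \<in> insert i J" for j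
        using that h pi by (auto simp: K_def)
      moreover have "h' = h - Const (l i h) * p i" by (simp add: h'_def Const_uminus)
      ultimately have "h - Const (l i h) * p i \<in> K'" by (simp add: K'_def)
      then show "h \<in> vs.span (insert (p i) B)"
        unfolding vs.span_breakdown_eq spanB by blast
    qed
    moreover have "insert (p i) B \<subseteq> K" using pi(1) B(1) by (auto simp: K_def K'_def)
    ultimately have "vs.dim K = card (insert (p i) B)"
      using ind by (metis vs.basis_card_eq_dim)
    also have "\<dots> = Suc (vs.dim K')"
      using finB notin vs.span_base B(4) by (metis card_insert_disjoint)
    finally show ?case using insert by (simp add: K_def K'_def)
  qed simp
  from this[OF I(1)] show ?thesis by simp
qed

primrec monoms :: "nat \<Rightarrow> 'v::finite mpoly set" where
  "monoms 0 = {1}"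
| "monoms (Suc d) = (\<lambda>(v, p). Var v * p) ` (UNIV \<times> monoms d)"

lemma finite_monoms: "finite (monoms d)"
  by (induction d) auto

lemma homogeneous_span_monoms:
  fixes p :: "'v::finite mpoly"
  assumes "homogeneous d p"
  shows "p \<in> module.span (\<lambda>c p. Const c * p) (monoms d)"
proof -
  interpret vs: vector_space "\<lambda>c (p :: 'v mpoly). Const c * p" by (rule vector_space_mpoly)
  show ?thesis
    using assms
  proof (induction rule: homogeneous_induct)
    case (zero d)
    then show ?case by (rule vs.span_zero)
  next
    case (add d p q)
    then show ?case by (rule vs.span_add)
  next
    case (Const c)
    have "Const c * 1 \<in> vs.span (monoms 0)" by (intro vs.span_scale vs.span_base) simp
    then show ?case by simp
  next
    case (mult d p v)
    then show ?case
    proof (induction rule: vs.span_induct_alt)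
      case base
      then show ?case by (simp add: vs.span_zero)
    next
      case (step c x y)
      have "Var v * x \<in> vs.span (monoms (Suc d))"
        using step by (intro vs.span_base) auto
      then have "Const c * (Var v * x) + Var v * y \<in> vs.span (monoms (Suc d))"
        using step by (intro vs.span_add vs.span_scale)
      then show ?case by (simp add: algebra_simps)
    qed
  qed
qed

text \<open>The set \<open>I\<close> need not index all points, since in low degree some of the evaluations may
  determine the others.\<close>

lemma hilbert_fun_representatives:
  fixes q :: "'i \<Rightarrow> complex ^ 'v::finite"
  assumes I: "finite I" "\<And>i. i \<in> I \<Longrightarrow> homogeneous d (p i)"
    "\<And>i j. i \<in> I \<Longrightarrow> j \<in> I \<Longrightarrow> eval_at (p j) (q i) = (if i = j then 1 else 0)"
    and KI: "\<And>h k. homogeneous d h \<Longrightarrow> \<forall>i\<in>I. eval_at h (q i) = 0 \<Longrightarrow> eval_at h (q k) = 0"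
  shows "hilbert_fun (range (\<lambda>k. vec.span {q k})) d = card I"
proof -
  have "{h \<in> vanishing_ideal (range (\<lambda>k. vec.span {q k})). homogeneous d h} =
      {h \<in> {p. homogeneous d p}. \<forall>i\<in>I. eval_at h (q i) = 0}" (is "?L = ?R")
  proof safe
    fix h i assume h: "h \<in> vanishing_ideal (range (\<lambda>k. vec.span {q k}))" "i \<in> I"
    show "eval_at h (q i) = 0"
      by (rule eval_at_ideal_gen[OF h(1)[unfolded vanishing_ideal_def]]) (auto simp: vanishes_at_span)
  next
    fix h assume "homogeneous d h" "\<forall>i\<in>I. eval_at h (q i) = 0"
    then show "h \<in> vanishing_ideal (range (\<lambda>k. vec.span {q k}))"
      unfolding vanishing_ideal_def
      by (intro ideal_gen_base) (auto simp: vanishes_at_span KI)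
  qed
  moreover have "cdim {p :: 'v mpoly. homogeneous d p} = cdim ?R + card I"
  proof (rule cdim_linear_conditions[where G = "monoms d" and p = p])
    interpret vs: vector_space "\<lambda>c (p :: 'v mpoly). Const c * p" by (rule vector_space_mpoly)
    show "vs.subspace {p :: 'v mpoly. homogeneous d p}"
      by (auto simp: vs.subspace_def homogeneous_add homogeneous_Const_mult)
  qed (use I in \<open>auto simp: finite_monoms homogeneous_span_monoms eval_at_add eval_at_mult\<close>)
  ultimately show ?thesis by (simp add: hilbert_fun_def)
qed


section \<open>The projections\<close>

lemma drop_x_pt: "drop_x (pt z w y) = pt 0 0 y"
  and drop_y_pt: "drop_y (pt z w y) = pt z w 0"
  by (simp_all add: drop_x_def drop_y_def pt_def vec_eq_iff split: var.split)

lemma proj_to_y_span: "proj_to_y (vec.span {x}) = vec.span {pt 0 0 (yc x)}"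
proof -
  have eq: "drop_x x = pt 0 0 (yc x)" for x :: "complex ^ 'a var"
    using drop_x_pt[of "zc x" "wc x" "yc x"] by simp
  show ?thesis
    unfolding proj_to_y_def eq[symmetric]
    by (rule image_span_singleton) (simp add: eq scale_pt)
qed

lemma proj_to_x_span: "proj_to_x (vec.span {x}) = vec.span {pt (zc x) (wc x) 0}"
proof -
  have eq: "drop_y x = pt (zc x) (wc x) 0" for x :: "complex ^ 'a var"
    using drop_y_pt[of "zc x" "wc x" "yc x"] by simp
  show ?thesis
    unfolding proj_to_x_def eq[symmetric]
    by (rule image_span_singleton) (simp add: eq scale_pt)
qed

lemma span_mem_zero_locus_Vars:
  "vec.span {x} \<in> zero_locus (Var ` V) \<longleftrightarrow> x \<noteq> 0 \<and> (\<forall>v\<in>V. x $ v = 0)"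
  by (auto simp: zero_locus_def vanishes_at_span[OF homogeneous_Var])

lemma span_mem_line_at_infinity:
  fixes x :: "complex ^ 'n::finite var"
  shows "vec.span {x} \<in> zero_locus (range Y) \<longleftrightarrow> x \<noteq> 0 \<and> yc x = 0"
proof -
  have "range (Y :: 'n \<Rightarrow> _) = Var ` range VY" by auto
  then show ?thesis by (simp add: span_mem_zero_locus_Vars yc_def vec_eq_iff)
qed

context
  fixes f :: "'n::finite \<Rightarrow> complex ^ 'n" and a b :: "'n \<Rightarrow> complex"
  assumes adm: "admissible f a b"
begin

lemma orthonormal_f: "orthonormal f" and a_nz: "a i \<noteq> 0" and b_nz: "b i \<noteq> 0"
  using adm by (auto simp: admissible_def)

lemma f_nz: "f i \<noteq> 0"
proof
  assume "f i = 0"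
  then have "bdot (f i) (f i) = 0" by simp
  with orthonormal_f show False by (simp add: orthonormal_def)
qed

definition base_point :: "'n \<Rightarrow> 'n var ppoint" where
  "base_point i = vec.span {pt 0 0 (f i)}"

lemma base_point_eq_iff: "base_point i = base_point j \<longleftrightarrow> i = j"
proof
  assume "base_point i = base_point j"
  then obtain c where c: "c \<noteq> 0" "pt 0 0 (f j) = c *s pt 0 0 (f i)"
    unfolding base_point_def by (subst (asm) span_singleton_eq_iff) (auto simp: pt_eq_0_iff f_nz)
  then show "i = j" using orthonormal_scale_eq(1)[OF orthonormal_f, of j c i] by (simp add: scale_pt)
qed simp

lemma proj_to_y_config_vec: "proj_to_y (vec.span {config_vec f a b (i, e, e')}) = base_point i"
  by (simp add: proj_to_y_span config_vec_def base_point_def)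

lemma proj_to_y_config: "proj_to_y ` config f a b = range base_point"
proof
  show "range base_point \<subseteq> proj_to_y ` config f a b"
  proof safe
    fix i
    have "base_point i = proj_to_y (vec.span {config_vec f a b (i, True, True)})"
      by (simp add: proj_to_y_config_vec)
    then show "base_point i \<in> proj_to_y ` config f a b" by (auto simp: config_def)
  qed
  show "proj_to_y ` config f a b \<subseteq> range base_point"
    by (auto simp: config_def proj_to_y_config_vec)
qed

lemma base_points_subset: "range base_point \<subseteq> zero_locus {X1, X2}"
proof safe
  fix i
  have "{X1, X2} = Var ` {VX1, VX2 :: 'n var}" by simp
  then show "base_point i \<in> zero_locus {X1, X2}"
    unfolding base_point_def
    by (simp only: span_mem_zero_locus_Vars) (simp add: pt_eq_0_iff f_nz, simp add: pt_def)
qed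

lemma card_base_points: "card (range base_point) = CARD('n)"
  by (intro card_image injI) (simp add: base_point_eq_iff)

lemma bdot_pt_f: "bdot (pt 0 0 (f i)) (pt 0 0 (f j)) = (if i = j then 1 else 0)"
  using orthonormal_f by (simp add: bdot_def sum_var orthonormal_def) (simp add: pt_def)

lemma base_points_general_position: "linear_general_position (range base_point)"
  unfolding linear_general_position_def
proof safe
  fix B assume "B \<subseteq> range base_point"
  then obtain I where I: "B = base_point ` I" by (auto simp: subset_image_iff)
  let ?q = "\<lambda>i. pt 0 0 (f i)"
  note bi = biorthogonal_independent[of I ?q ?q, OF bdot_pt_f]
  have "vec.span (?q ` I) = vec.span (\<Union>B)"
    unfolding vec.span_eq
  proof
    show "?q ` I \<subseteq> vec.span (\<Union>B)"
      unfolding I base_point_def by (auto intro!: vec.span_base)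
    have "vec.span {?q i} \<subseteq> vec.span (?q ` I)" if "i \<in> I" for i
      using that by (intro vec.span_mono) auto
    then show "\<Union>B \<subseteq> vec.span (?q ` I)" unfolding I base_point_def by blast
  qed
  from vec.dim_eq_card[OF this bi(2)] have "vec.dim (\<Union>B) = card I"
    using card_image[OF bi(1)] by simp
  moreover have "card B = card I"
    unfolding I by (intro card_image inj_onI) (simp add: base_point_eq_iff)
  moreover have "card I \<le> CARD('n)" by (intro card_mono) auto
  ultimately show "vec.dim (\<Union>B) = min (card B) CARD('n var)"
    by (simp add: card_var)
qed

lemma hilbert_fun_base_points: "hilbert_fun (range base_point) d = (if d = 0 then 1 else CARD('n))"
proof (cases "d = 0")
  case True
  have const: "eval_at h x = eval_at h 0" if "homogeneous 0 h" for h :: "'n var mpoly" and x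
    using eval_at_scale[OF that, of 0 x] by simp
  have "hilbert_fun (range base_point) 0 = card {undefined :: 'n}"
    unfolding base_point_def
    by (rule hilbert_fun_representatives[where p = "\<lambda>_. 1"]) (auto, metis const)
  then show ?thesis using True by simp
next
  case False
  have "hilbert_fun (range base_point) d = card (UNIV :: 'n set)"
    unfolding base_point_def
  proof (rule hilbert_fun_representatives[where p = "\<lambda>i. ylin (f i) ^ d"])
    show "homogeneous d (ylin (f i) ^ d)" for i
      using homogeneous_power[OF homogeneous_ylin, of d] by simp
    show "eval_at (ylin (f j) ^ d) (pt 0 0 (f i)) = (if i = j then 1 else 0)" for i j
      using orthonormal_f False by (auto simp: eval_at_power orthonormal_def)
  qed auto
  then show ?thesis using False by simp
qed

text \<open>The span is cut out by a condition on the \<open>y\<close>-part alone, because the line \<open>Y = 0\<close> contributes all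
  values of \<open>Z1\<close> and \<open>Z2\<close>.\<close>

lemma span_base_point_line:
  "vec.span (\<Union>(insert (base_point i) (zero_locus (range Y)))) = {x. \<exists>c. yc x = c *s f i}"
proof
  have sub: "vec.subspace {x :: complex ^ 'n var. \<exists>c. yc x = c *s f i}"
    unfolding vec.subspace_def
  proof (intro conjI ballI allI)
    show "0 \<in> {x. \<exists>c. yc x = c *s f i}" by (auto intro: exI[of _ 0])
  next
    fix x y :: "complex ^ 'n var"
    assume "x \<in> {x. \<exists>c. yc x = c *s f i}" "y \<in> {x. \<exists>c. yc x = c *s f i}"
    then obtain c d where "yc x = c *s f i" "yc y = d *s f i" by blast
    then have "yc (x + y) = (c + d) *s f i" by (simp add: vec.scale_left_distrib)
    then show "x + y \<in> {x. \<exists>c. yc x = c *s f i}" by blast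
  next
    fix k and x :: "complex ^ 'n var"
    assume "x \<in> {x. \<exists>c. yc x = c *s f i}"
    then obtain c where "yc x = c *s f i" by blast
    then have "yc (k *s x) = (k * c) *s f i" by (simp add: vec.scale_scale)
    then show "k *s x \<in> {x. \<exists>c. yc x = c *s f i}" by blast
  qed
  show "vec.span (\<Union>(insert (base_point i) (zero_locus (range Y)))) \<subseteq> {x. \<exists>c. yc x = c *s f i}"
  proof (rule vec.span_minimal[OF _ sub], safe)
    fix x and p :: "'n var ppoint"
    assume x: "x \<in> p" and p: "p \<in> zero_locus (range Y)"
    from p have "p \<in> proj_space" by (simp add: zero_locus_def)
    then obtain y where y: "p = vec.span {y}" by (rule proj_spaceE)
    with p have "yc y = 0" by (simp add: span_mem_line_at_infinity)
    with x y have "yc x = 0 *s f i" by (auto simp: mem_span_singleton)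
    then show "\<exists>c. yc x = c *s f i" by blast
  qed (auto simp: base_point_def mem_span_singleton)
  show "{x. \<exists>c. yc x = c *s f i} \<subseteq> vec.span (\<Union>(insert (base_point i) (zero_locus (range Y))))"
  proof safe
    fix x c assume x: "yc x = c *s f i"
    have 1: "pt 0 0 (yc x) \<in> \<Union>(insert (base_point i) (zero_locus (range Y)))"
      by (auto simp: x base_point_def mem_span_singleton scale_pt)
    have 2: "pt (zc x) (wc x) 0 \<in> \<Union>(insert (base_point i) (zero_locus (range Y)))"
    proof (cases "pt (zc x) (wc x) (0 :: complex ^ 'n) = 0")
      case True
      then show ?thesis by (simp add: base_point_def vec.span_zero)
    next
      case False
      then have "vec.span {pt (zc x) (wc x) (0 :: complex ^ 'n)} \<in> zero_locus (range Y)"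
        by (simp add: span_mem_line_at_infinity)
      then show ?thesis using vec.span_base[of "pt (zc x) (wc x) 0" "{pt (zc x) (wc x) 0}"] by auto
    qed
    have "x = pt (zc x) (wc x) 0 + pt 0 0 (yc x)" by (simp add: add_pt)
    also have "\<dots> \<in> vec.span (\<Union>(insert (base_point i) (zero_locus (range Y))))"
      by (intro vec.span_add vec.span_base 1 2)
    finally show "x \<in> vec.span (\<Union>(insert (base_point i) (zero_locus (range Y))))" .
  qed
qed

lemma config_inter_span:
  "config f a b \<inter> proj_span (insert (base_point i) (zero_locus (range Y))) =
     (\<lambda>k. vec.span {config_vec f a b k}) ` ({i} \<times> UNIV)"
proof -
  have "vec.span {config_vec f a b (j, e, e')} \<in>
      proj_span (insert (base_point i) (zero_locus (range Y))) \<longleftrightarrow> j = i" for j e e'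
  proof -
    have sub: "vec.span {x} \<subseteq> vec.span U \<longleftrightarrow> x \<in> vec.span U" for x :: "complex ^ 'n var" and U
      using vec.span_base[of x "{x}"] vec.span_minimal[of "{x}" "vec.span U"] by auto
    have "vec.span {config_vec f a b (j, e, e')} \<in>
      proj_span (insert (base_point i) (zero_locus (range Y))) \<longleftrightarrow> (\<exists>c. f j = c *s f i)"
      unfolding proj_span_def mem_Collect_eq span_in_proj_space sub
      unfolding span_base_point_line by (simp add: config_vec_def pt_eq_0_iff f_nz)
    also have "\<dots> \<longleftrightarrow> j = i"
    proof
      assume "\<exists>c. f j = c *s f i"
      then obtain c where c: "f j = c *s f i" by blast
      then have "c \<noteq> 0" using f_nz[of j] by auto
      then show "j = i" using orthonormal_scale_eq(1)[OF orthonormal_f c] by simp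
    qed (auto intro: exI[of _ 1])
    finally show ?thesis .
  qed
  then show ?thesis by (auto simp: config_def)
qed

lemma card_config_inter_span:
  "card (config f a b \<inter> proj_span (insert (base_point i) (zero_locus (range Y)))) = 4"
proof -
  have "card ((\<lambda>k. vec.span {config_vec f a b k}) ` ({i} \<times> UNIV)) = card ({i} \<times> (UNIV :: (bool \<times> bool) set))"
    by (rule card_image[OF inj_on_subset[OF config_inj[OF adm]]]) simp
  then show ?thesis by (simp add: config_inter_span)
qed

text \<open>Changing the signs of \<open>Z1\<close> and \<open>Z2\<close> together moves a point along a line through the base point, so
  the four points lie in pairs on two such lines.\<close>

lemma config_two_lines:
  "\<exists>l1 l2. proj_line l1 \<and> proj_line l2 \<and> l1 \<noteq> l2 \<and> base_point i \<in> l1 \<and> base_point i \<in> l2 \<and>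
     config f a b \<inter> proj_span (insert (base_point i) (zero_locus (range Y))) \<subseteq> l1 \<union> l2"
proof -
  define U where "U s = vec.span {pt 0 0 (f i), pt (a i) (s * b i) 0}" for s
  define l where "l s = {p \<in> proj_space. p \<subseteq> U s}" for s
  have mem_U: "x \<in> U s \<longleftrightarrow> (\<exists>c d. x = pt (d * a i) (d * (s * b i)) (c *s f i))" for x s
  proof -
    have "x \<in> U s \<longleftrightarrow> (\<exists>c d. x = c *s pt 0 0 (f i) + d *s pt (a i) (s * b i) 0)"
      unfolding U_def vec.span_breakdown_eq[of x "pt 0 0 (f i)"] mem_span_singleton
      by (simp add: diff_eq_eq add.commute)
    then show ?thesis by (simp add: scale_pt add_pt)
  qed
  have span_U: "vec.span {x} \<subseteq> U s" if "x \<in> U s" for x s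
    using that unfolding U_def by (intro vec.span_minimal) auto
  have line: "proj_line (l s)" for s
  proof -
    have "pt 0 0 (f i) \<notin> vec.span {pt (a i) (s * b i) 0}"
      by (auto simp: mem_span_singleton scale_pt f_nz)
    moreover from this have "pt 0 0 (f i) \<noteq> pt (a i) (s * b i) 0"
      by (metis insertI1 vec.span_base)
    ultimately have "vec.independent {pt 0 0 (f i), pt (a i) (s * b i) 0}"
      by (simp add: vec.independent_insert pt_eq_0_iff a_nz vec.dependent_single)
    with \<open>pt 0 0 (f i) \<noteq> pt (a i) (s * b i) 0\<close> have "vec.dim (U s) = 2"
      unfolding U_def by (simp add: vec.dim_eq_card_independent)
    then show ?thesis
      unfolding proj_line_def l_def by (intro exI[of _ "U s"]) (simp add: U_def)
  qed
  have base: "base_point i \<in> l s" for s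
  proof -
    have "pt 0 0 (f i) \<in> U s" unfolding mem_U by (intro exI[of _ 1] exI[of _ 0]) simp
    then show ?thesis unfolding l_def base_point_def
      by (simp add: span_U pt_eq_0_iff f_nz)
  qed
  have "l 1 \<noteq> l (-1)"
  proof -
    let ?p = "pt (a i) (b i) 0 :: complex ^ 'n var"
    have "?p \<in> U 1" unfolding mem_U by (intro exI[of _ 0] exI[of _ 1]) simp
    then have "vec.span {?p} \<in> l 1" by (simp add: l_def span_U pt_eq_0_iff a_nz)
    moreover have "?p \<notin> U (-1)"
      unfolding mem_U using a_nz[of i] b_nz[of i] by auto
    then have "vec.span {?p} \<notin> l (-1)"
      using vec.span_base[of ?p "{?p}"] by (auto simp: l_def)
    ultimately show ?thesis by blast
  qed
  moreover have "vec.span {config_vec f a b (i, e, e')} \<in> l (sg e * sg e')" for e e'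
  proof -
    have "config_vec f a b (i, e, e') \<in> U (sg e * sg e')"
      unfolding mem_U by (intro exI[of _ 1] exI[of _ "sg e"])
        (simp add: config_vec_def flip: mult.assoc)
    then show ?thesis by (simp add: l_def span_U config_vec_nonzero[OF adm])
  qed
  then have "vec.span {config_vec f a b (i, e, e')} \<in> l 1 \<union> l (-1)" for e e'
    by (metis Un_iff add.inverse_inverse mult_1 mult_minus1 sg_def)
  then have "config f a b \<inter> proj_span (insert (base_point i) (zero_locus (range Y))) \<subseteq> l 1 \<union> l (-1)"
    unfolding config_inter_span by auto
  ultimately show ?thesis using line base by blast
qed

end

lemma card_square_roots:
  fixes S :: "complex set"
  assumes "finite S" "0 \<notin> S"
  shows "card {r. r\<^sup>2 \<in> S} = 2 * card S"
proof -
  have roots: "{r. r\<^sup>2 = s} = {csqrt s, - csqrt s}" for s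
  proof -
    have "r\<^sup>2 = s \<longleftrightarrow> r = csqrt s \<or> r = - csqrt s" for r
      using power2_eq_iff[of r "csqrt s"] by simp
    then show ?thesis by auto
  qed
  have "card {r. r\<^sup>2 = s} = 2" if "s \<in> S" for s
    using that assms(2) unfolding roots by (auto simp: card_insert_if)
  then have "(\<Sum>s\<in>S. card {r. r\<^sup>2 = s}) = 2 * card S" by simp
  moreover have "{r. r\<^sup>2 \<in> S} = (\<Union>s\<in>S. {r. r\<^sup>2 = s})" by auto
  moreover have "card (\<Union>s\<in>S. {r. r\<^sup>2 = s}) = (\<Sum>s\<in>S. card {r. r\<^sup>2 = s})"
  proof (rule card_UN_disjoint[OF assms(1)])
    show "\<forall>s\<in>S. finite {r. r\<^sup>2 = s}" by (simp add: roots)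
  qed auto
  ultimately show ?thesis by simp
qed

text \<open>The points over \<open>f i\<close> project to the two points of the line \<open>Y = 0\<close> whose ratio \<open>Z2 / Z1\<close> is a
  square root of \<open>(b i / a i)^2\<close>; these pairs may coincide for different \<open>i\<close>.\<close>

lemma proj_to_x_config:
  fixes f :: "'n::finite \<Rightarrow> complex ^ 'n"
  assumes adm: "admissible f a b"
  shows "proj_to_x ` config f a b \<subseteq> zero_locus (range Y)"
    and "\<exists>k\<le>CARD('n). card (proj_to_x ` config f a b) = 2 * k"
proof -
  have nz: "a i \<noteq> 0" "b i \<noteq> 0" for i using adm by (auto simp: admissible_def)
  have proj: "proj_to_x (vec.span {config_vec f a b (i, e, e')}) =
      vec.span {pt (sg e * a i) (sg e' * b i) 0}" for i e e'
    by (simp add: proj_to_x_span config_vec_def)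
  show "proj_to_x ` config f a b \<subseteq> zero_locus (range Y)"
    by (auto simp: config_def proj span_mem_line_at_infinity pt_eq_0_iff nz)
  define P where "P r = vec.span {pt 1 r 0 :: complex ^ 'n var}" for r
  define S where "S = range (\<lambda>i. (b i / a i)\<^sup>2)"
  have P_inj: "inj P"
  proof (rule injI)
    fix r s assume "P r = P s"
    then obtain c where "pt 1 s 0 = c *s (pt 1 r 0 :: complex ^ 'n var)"
      unfolding P_def by (subst (asm) span_singleton_eq_iff) (auto simp: pt_eq_0_iff)
    then show "r = s" by (auto simp: scale_pt)
  qed
  have proj': "proj_to_x (vec.span {config_vec f a b (i, e, e')}) = P (sg e * sg e' * (b i / a i))"
    for i e e'
  proof -
    have "pt (sg e * a i) (sg e' * b i) 0 = (sg e * a i) *s (pt 1 (sg e * sg e' * (b i / a i)) 0 :: complex ^ 'n var)"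
      using nz by (cases e; cases e') (simp_all add: scale_pt)
    then show ?thesis unfolding proj P_def by (simp add: span_scale nz)
  qed
  have "proj_to_x ` config f a b = P ` {r. r\<^sup>2 \<in> S}"
  proof
    show "proj_to_x ` config f a b \<subseteq> P ` {r. r\<^sup>2 \<in> S}"
    proof -
      have "(sg e * sg e' * (b i / a i))\<^sup>2 \<in> S" for i e e'
        unfolding power_mult_distrib sg_simps mult_1 S_def by (rule rangeI)
      then show ?thesis unfolding config_def image_image by (auto simp only: proj' split_paired_all)
    qed
    show "P ` {r. r\<^sup>2 \<in> S} \<subseteq> proj_to_x ` config f a b"
    proof safe
      fix r assume "r\<^sup>2 \<in> S"
      then obtain i where "r\<^sup>2 = (b i / a i)\<^sup>2" by (auto simp: S_def)
      then obtain e where "r = sg e * (b i / a i)" using square_eq_imp_sg by blast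
      then have "P r = proj_to_x (vec.span {config_vec f a b (i, True, e)})" by (simp add: proj')
      then show "P r \<in> proj_to_x ` config f a b" by (auto simp: config_def)
    qed
  qed
  then have "card (proj_to_x ` config f a b) = card {r. r\<^sup>2 \<in> S}"
    using card_image[OF inj_on_subset[OF P_inj]] by simp
  also have "\<dots> = 2 * card S"
    by (rule card_square_roots) (auto simp: S_def nz)
  finally show "\<exists>k\<le>CARD('n). card (proj_to_x ` config f a b) = 2 * k"
    using card_image_le[of "UNIV :: 'n set" "\<lambda>i. (b i / a i)\<^sup>2"] by (auto simp: S_def)
qed

section \<open>Rank, forbidden locus and minimal apolar sets of the quartic\<close>

theorem theoremB:
  fixes F :: "'n::{finite,linorder} var mpoly"
  assumes n: "CARD('n) \<ge> 2"
    and F: "F = (X1 ^ 2 + X2 ^ 2) * (\<Sum>i\<in>UNIV. Y i ^ 2)"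
  shows "waring_rank F = 4 * CARD('n) \<and>
    forbidden_locus F = zero_locus {X1 ^ 2 + X2 ^ 2} \<union> zero_locus {\<Sum>i\<in>UNIV. Y i ^ 2} \<and>
    (\<forall>\<X>. apolar_set F \<X> \<and> card \<X> = 4 * CARD('n) \<longrightarrow>
      (let \<Y> = proj_to_y ` \<X>; \<W> = proj_to_x ` \<X>; ell = zero_locus (range Y) in
        (\<Y> \<subseteq> zero_locus {X1, X2} \<and> card \<Y> = CARD('n) \<and> linear_general_position \<Y> \<and>
         hilbert_fun \<Y> 0 = 1 \<and> hilbert_fun \<Y> 1 = CARD('n) \<and> hilbert_fun \<Y> 2 = CARD('n) \<and>
         (\<forall>i\<ge>3. hilbert_fun \<Y> i = CARD('n))) \<and>
        (\<forall>Q\<in>\<Y>. card (\<X> \<inter> proj_span (insert Q ell)) = 4 \<and>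
           (\<exists>l1 l2. proj_line l1 \<and> proj_line l2 \<and> l1 \<noteq> l2 \<and> Q \<in> l1 \<and> Q \<in> l2 \<and>
              \<X> \<inter> proj_span (insert Q ell) \<subseteq> l1 \<union> l2)) \<and>
        (\<exists>\<sigma> \<alpha> \<beta>. orthogonal_matrix \<sigma> \<and>
           (\<forall>i. i \<noteq> fst_idx \<longrightarrow> \<alpha> i \<noteq> 0 \<and> \<beta> i \<noteq> 0) \<and>
           (\<Sum>i\<in>UNIV - {fst_idx}. \<alpha> i) \<noteq> 0 \<and> (\<Sum>i\<in>UNIV - {fst_idx}. \<beta> i) \<noteq> 0 \<and>
           vanishing_ideal (act_y_point \<sigma> ` \<X>) =
             ideal_gen ({Y i * Y j | i j. i < j} \<union>
               {Z1 ^ 2 + (\<Sum>i\<in>UNIV - {fst_idx}. Const (\<alpha> i) * (Y fst_idx ^ 2 - Y i ^ 2)),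
                Z2 ^ 2 + (\<Sum>i\<in>UNIV - {fst_idx}. Const (\<beta> i) * (Y fst_idx ^ 2 - Y i ^ 2))})) \<and>
        (\<W> \<subseteq> zero_locus (range Y) \<and> (\<exists>k\<le>CARD('n). card \<W> = 2 * k))))"
proof (intro conjI allI impI)
  have F': "F = quartic" by (simp add: F quartic_eq)
  show "waring_rank F = 4 * CARD('n)" unfolding F' by (rule waring_rank_quartic[OF n])
  show "forbidden_locus F = zero_locus {X1 ^ 2 + X2 ^ 2} \<union> zero_locus {\<Sum>i\<in>UNIV. Y i ^ 2}"
    unfolding F' by (rule forbidden_locus_quartic[OF n])
  fix \<X> :: "'n var ppoint set"
  assume "apolar_set F \<X> \<and> card \<X> = 4 * CARD('n)"
  then obtain f :: "'n \<Rightarrow> (complex, 'n) vec" and a b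
    where adm: "admissible f a b" and X: "\<X> = config f a b"
    unfolding F' using apolar_set_structure by blast
  show "(let \<Y> = proj_to_y ` \<X>; \<W> = proj_to_x ` \<X>; ell = zero_locus (range Y) in
        (\<Y> \<subseteq> zero_locus {X1, X2} \<and> card \<Y> = CARD('n) \<and> linear_general_position \<Y> \<and>
         hilbert_fun \<Y> 0 = 1 \<and> hilbert_fun \<Y> 1 = CARD('n) \<and> hilbert_fun \<Y> 2 = CARD('n) \<and>
         (\<forall>i\<ge>3. hilbert_fun \<Y> i = CARD('n))) \<and>
        (\<forall>Q\<in>\<Y>. card (\<X> \<inter> proj_span (insert Q ell)) = 4 \<and>
           (\<exists>l1 l2. proj_line l1 \<and> proj_line l2 \<and> l1 \<noteq> l2 \<and> Q \<in> l1 \<and> Q \<in> l2 \<and>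
              \<X> \<inter> proj_span (insert Q ell) \<subseteq> l1 \<union> l2)) \<and>
        (\<exists>\<sigma> \<alpha> \<beta>. orthogonal_matrix \<sigma> \<and>
           (\<forall>i. i \<noteq> fst_idx \<longrightarrow> \<alpha> i \<noteq> 0 \<and> \<beta> i \<noteq> 0) \<and>
           (\<Sum>i\<in>UNIV - {fst_idx}. \<alpha> i) \<noteq> 0 \<and> (\<Sum>i\<in>UNIV - {fst_idx}. \<beta> i) \<noteq> 0 \<and>
           vanishing_ideal (act_y_point \<sigma> ` \<X>) =
             ideal_gen ({Y i * Y j | i j. i < j} \<union>
               {Z1 ^ 2 + (\<Sum>i\<in>UNIV - {fst_idx}. Const (\<alpha> i) * (Y fst_idx ^ 2 - Y i ^ 2)),
                Z2 ^ 2 + (\<Sum>i\<in>UNIV - {fst_idx}. Const (\<beta> i) * (Y fst_idx ^ 2 - Y i ^ 2))})) \<and>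
        (\<W> \<subseteq> zero_locus (range Y) \<and> (\<exists>k\<le>CARD('n). card \<W> = 2 * k)))"
    unfolding Let_def X proj_to_y_config[OF adm]
    using base_points_subset[OF adm] card_base_points[OF adm] base_points_general_position[OF adm]
      hilbert_fun_base_points[OF adm] card_config_inter_span[OF adm] config_two_lines[OF adm]
      vanishing_ideal_config[OF adm] proj_to_x_config[OF adm]
    by (simp add: config_quadrics_def)
qed

end
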